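(* Assume that there exist $\rho\in(0,1)$ and $C>0$ such that $q=q_2+\mathrm i r_2$ with $q_2,r_2\in L^\infty(\mathbb R^d;\mathbb R)$ satisfying $|q_2|\le Cf^{-\rho}$ and $|r_2|\le Cf^{-\rho}$ on $\mathbb R^d$. Let $\kappa=\lambda+\mathrm i\mu$ with $\lambda\in\mathbb R$ and $\mu>0$. Then for all sufficiently large $t\ge1$ (i.e. there is $t_0\ge 1$ such that for all $t\ge t_0$) the following holds: if $\phi\in\mathcal E_{\sqrt2\mu,-t}$ solves $(H-\kappa^2)\phi=0$ on $\mathbb R^d$ in the distributional sense, then $\phi\in\mathcal E_{-\sqrt2\mu,t}$.
   Context: Fix $d\in\mathbb N=\{1,2,\dots\}$. Fix a real-valued $\chi\in C^\infty(\mathbb R)$ with $\chi(\tau)=1$ for $\tau\le1$, $\chi(\tau)=0$ for $\tau\ge2$ and $\chi'\le0$. Define $f\in C^\infty(\mathbb R^d)$ by $f(x)=\chi(|x|)+|x|(1-\chi(|x|))$, so that $f$ is uniformly positive and $f(x)=|x|$ for $|x|\ge2$. Write $\partial_f=\sum_{j=1}^d(\partial_jf)\partial_j$. Let $V$ be a complex-valued potential on $\mathbb R^d$, $H=-\tfrac12\Delta+V$, and $q=V+\tfrac18(\Delta f)^2+\tfrac14(\partial_f\Delta f)$; all assumptions on $V$ are stated through $q$. For $s,t\in\mathbb R$, with $\rho$ the exponent in the assumption on $q$, set $\mathcal E_{s,t}=\mathrm e^{sf+tf^{1-\rho}}L^2(\mathbb R^d)$. *)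

theory Defs
  imports "HOL-Analysis.Analysis"
begin

section \<open>Partial derivatives and smooth functions\<close>

definition partial_deriv ::
    "'a::euclidean_space \<Rightarrow> ('a \<Rightarrow> 'b::real_normed_vector) \<Rightarrow> 'a \<Rightarrow> 'b" where
  "partial_deriv b u x = frechet_derivative u (at x) b"

definition laplacian ::
    "('a::euclidean_space \<Rightarrow> 'b::real_normed_vector) \<Rightarrow> 'a \<Rightarrow> 'b" where
  "laplacian u x = (\<Sum>b\<in>Basis. partial_deriv b (partial_deriv b u) x)"

text \<open>The first-order operator \<open>\<partial>\<^sub>f g = \<Sum>\<^sub>j (\<partial>\<^sub>j f) (\<partial>\<^sub>j g)\<close>.\<close>

definition grad_along ::
    "('a::euclidean_space \<Rightarrow> real) \<Rightarrow> ('a \<Rightarrow> 'b::real_normed_vector) \<Rightarrow> 'a \<Rightarrow> 'b" where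
  "grad_along f g x = (\<Sum>b\<in>Basis. partial_deriv b f x *\<^sub>R partial_deriv b g x)"

text \<open>Differentiability is required explicitly at every order, because
  \<^const>\<open>frechet_derivative\<close> is an arbitrary value at points where no derivative exists.\<close>

primrec Ck :: "nat \<Rightarrow> ('a::euclidean_space \<Rightarrow> 'b::real_normed_vector) \<Rightarrow> bool" where
  "Ck 0 u \<longleftrightarrow> continuous_on UNIV u"
| "Ck (Suc k) u \<longleftrightarrow> (\<forall>x. u differentiable (at x)) \<and> (\<forall>b\<in>Basis. Ck k (partial_deriv b u))"

definition smooth :: "('a::euclidean_space \<Rightarrow> 'b::real_normed_vector) \<Rightarrow> bool" where
  "smooth u \<longleftrightarrow> (\<forall>k. Ck k u)"

definition test_function :: "('a::euclidean_space \<Rightarrow> complex) \<Rightarrow> bool" where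
  "test_function \<psi> \<longleftrightarrow> smooth \<psi> \<and> compact (closure {x. \<psi> x \<noteq> 0})"


section \<open>The cut-off, the weight and the effective potential\<close>

definition cutoff :: "(real \<Rightarrow> real) \<Rightarrow> bool" where
  "cutoff chi \<longleftrightarrow> smooth chi \<and> (\<forall>\<tau>\<le>1. chi \<tau> = 1) \<and> (\<forall>\<tau>\<ge>2. chi \<tau> = 0) \<and> (\<forall>\<tau>. deriv chi \<tau> \<le> 0)"

definition weight :: "(real \<Rightarrow> real) \<Rightarrow> 'a::euclidean_space \<Rightarrow> real" where
  "weight chi x = chi (norm x) + norm x * (1 - chi (norm x))"

definition effective_potential ::
    "(real \<Rightarrow> real) \<Rightarrow> ('a::euclidean_space \<Rightarrow> complex) \<Rightarrow> 'a \<Rightarrow> complex" where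
  "effective_potential chi V x =
     V x + complex_of_real (1/8 * (laplacian (weight chi) x)\<^sup>2
                          + 1/4 * grad_along (weight chi) (laplacian (weight chi)) x)"


section \<open>Function spaces\<close>

text \<open>Elements of Lebesgue spaces are represented by functions rather than by classes modulo
  null sets; all the sets below are invariant under modification on a null set.\<close>

definition L_infinity :: "('a::euclidean_space \<Rightarrow> real) set" where
  "L_infinity = {g. g \<in> borel_measurable lebesgue \<and> (\<exists>M. AE x in lebesgue. \<bar>g x\<bar> \<le> M)}"

definition L_two :: "('a::euclidean_space \<Rightarrow> complex) set" where
  "L_two = {u. u \<in> borel_measurable lebesgue \<and> integrable lebesgue (\<lambda>x. (cmod (u x))\<^sup>2)}"

definition weighted_L_two ::
    "(real \<Rightarrow> real) \<Rightarrow> real \<Rightarrow> real \<Rightarrow> real \<Rightarrow> ('a::euclidean_space \<Rightarrow> complex) set" where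
  "weighted_L_two chi \<rho> s t =
     (\<lambda>u x. complex_of_real (exp (s * weight chi x + t * weight chi x powr (1 - \<rho>))) * u x) ` L_two"

definition locally_integrable :: "('a::euclidean_space \<Rightarrow> complex) \<Rightarrow> bool" where
  "locally_integrable u \<longleftrightarrow> (\<forall>K. compact K \<longrightarrow> u absolutely_integrable_on K)"


section \<open>The Schroedinger operator\<close>

definition schroedinger ::
    "('a::euclidean_space \<Rightarrow> complex) \<Rightarrow> ('a \<Rightarrow> complex) \<Rightarrow> 'a \<Rightarrow> complex" where
  "schroedinger V u x = - (1/2) * laplacian u x + V x * u x"

text \<open>\<open>(H - z) \<phi> = 0\<close> in the sense of distributions. The operator \<open>H - z\<close> is its own transpose for
  the bilinear pairing \<open>\<integral> \<phi> \<psi>\<close> (no complex conjugation, even for complex \<open>V\<close> and \<open>z\<close>), so it is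
  moved unchanged onto the test function. Local integrability of \<open>\<phi>\<close> and \<open>V \<phi>\<close> is what makes
  the two sides distributions; it also rules out that an integral vanishes
  merely because the integrand is not integrable.\<close>

definition distributional_solution ::
    "('a::euclidean_space \<Rightarrow> complex) \<Rightarrow> complex \<Rightarrow> ('a \<Rightarrow> complex) \<Rightarrow> bool" where
  "distributional_solution V z \<phi> \<longleftrightarrow>
     locally_integrable \<phi> \<and> locally_integrable (\<lambda>x. V x * \<phi> x) \<and>
     (\<forall>\<psi>. test_function \<psi> \<longrightarrow>
        (LINT x|lebesgue. \<phi> x * (schroedinger V \<psi> x - z * \<psi> x)) = 0)"

end

theory Submission
  imports Defs
begin

text \<open>
  Why the theorem holds. Put \<open>k = \<surd>2 \<kappa>\<close> and \<open>m = Im k = \<surd>2 \<mu> > 0\<close>, so that the equation reads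
  \<open>\<Delta>\<phi> + k\<^sup>2 \<phi> = 2 V \<phi>\<close>. For \<open>|x| > 2\<close> the weight is \<open>r = |x|\<close>, and the terms that separate \<open>q\<close> from \<open>V\<close>
  are \<open>O(r^(-2))\<close>; hence \<open>2 |V| \<le> Q r^(-\<rho>)\<close> there (lemma \<open>potential_bound\<close>). Free solutions grow or decay like
  \<open>e^(\<plusminus>mr)\<close>, and the theorem says that a solution that fails to grow at the full rate
  must decay at the full rate, where "full rate" is understood up to factors \<open>e^(\<plusminus>t r^(1-\<rho>))\<close>.

  The engine is an elementary energy identity. Multiply \<open>\<Delta>u + k\<^sup>2 u = S\<close> by \<open>v\<^sup>2\<close> times the conjugate of \<open>u\<close>,
  integrate by parts, multiply by \<open>\<alpha> = \<i> cnj k\<close> and take real parts. As \<open>Re \<alpha> = m\<close> and \<open>Re (\<alpha> k\<^sup>2) = - m |k|\<^sup>2\<close>,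
  the quadratic terms combine to \<open>m \<integral> v\<^sup>2 (|\<nabla>u|\<^sup>2 + |k|\<^sup>2 |u|\<^sup>2)\<close>, and the cross term is at most
  \<open>2 |k| \<integral> v |\<nabla>v| |u| |\<nabla>u|\<close>. So every weight with \<open>|\<nabla>v| \<le> (m - c) v\<close> leaves a positive gain
  \<open>\<integral> c v\<^sup>2 |k|\<^sup>2 |u|\<^sup>2\<close>: the rate \<open>m\<close> is critical, and it makes no difference whether \<open>v\<close> increases or decreases
  (lemmas \<open>energy_pointwise\<close> and \<open>energy_inequality\<close>). Errors \<open>g\<close> in the bound on \<open>|\<nabla>v|\<close>, caused by cut-offs, cost
  \<open>\<integral> g\<^sup>2 |u|\<^sup>2 / c\<close>. A distributional solution is only locally square integrable, so the inequality
  is applied to its mollifications and then passed to the limit; it contains no derivative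
  of the solution any more (\<open>weak_solution_energy_inequality\<close>).

  The weight is built from \<open>\<theta>(r) = m r - s r^(1-\<rho>)\<close>, for which \<open>m - \<theta>' = s (1 - \<rho>) r^(-\<rho>)\<close>. For large \<open>s\<close> this gain
  dominates \<open>2 |V|\<close>, and \<open>0 \<le> \<theta>' \<le> m\<close> outside a large ball. The function \<open>h = 1 / (e^(-\<theta>) + \<delta> e\<^sup>\<theta>)\<close> satisfies
  \<open>|h'| \<le> \<theta>' h\<close>; it increases to \<open>e\<^sup>\<theta>\<close> as \<open>\<delta>\<close> tends to 0, and it is \<open>O(e^(-\<theta>))\<close> at infinity, where the hypothesis on
  the solution gives integrability of \<open>e^(-2\<theta>) |u|\<^sup>2\<close>. With \<open>v\<close> equal to \<open>h\<close> times an inner and an outer cut-off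
  (\<open>radial_weight\<close>), the outer error vanishes in the limit and the inner error is a fixed local quantity
  (\<open>truncated_decay_estimate\<close>). Letting \<open>\<delta>\<close> tend to 0, Fatou's lemma bounds
  \<open>\<integral> r^(-\<rho>) e^(2\<theta>) |u|\<^sup>2\<close> (\<open>weak_solution_decay\<close>). The factor \<open>r^(-\<rho>)\<close> is paid for by taking \<open>s = t - \<rho> / (1 - \<rho>)\<close>
  (\<open>phase_shift\<close>).
\<close>

section \<open>Calculus of the classes \<open>Ck\<close>\<close>

lemma partial_deriv_eqI:
  "(u has_derivative D) (at x) \<Longrightarrow> partial_deriv b u x = D b"
  by (simp add: partial_deriv_def frechet_derivative_at[symmetric])

lemma Ck_Suc_imp_Ck: "Ck (Suc k) u \<Longrightarrow> Ck k u"
proof (induction k arbitrary: u)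
  case 0
  then show ?case
    by (auto intro!: differentiable_imp_continuous_on simp: differentiable_on_def intro: differentiable_at_withinI)
next
  case (Suc k)
  then show ?case by (metis Ck.simps(2))
qed

lemma Ck_add: "Ck k u \<Longrightarrow> Ck k v \<Longrightarrow> Ck k (\<lambda>x. u x + v x)"
proof (induction k arbitrary: u v)
  case 0
  then show ?case by (simp add: continuous_on_add)
next
  case (Suc k)
  have "partial_deriv b (\<lambda>x. u x + v x) = (\<lambda>x. partial_deriv b u x + partial_deriv b v x)" for b
    using Suc.prems
    by (intro ext partial_deriv_eqI)
       (auto simp: partial_deriv_def frechet_derivative_works[symmetric] intro!: has_derivative_add)
  then show ?case using Suc by auto
qed

lemma Ck_bounded_linear:
  assumes T: "bounded_linear T"
  shows "Ck k u \<Longrightarrow> Ck k (\<lambda>x. T (u x))"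
proof (induction k arbitrary: u)
  case 0
  then show ?case by (simp add: bounded_linear.continuous_on[OF T])
next
  case (Suc k)
  have D: "((\<lambda>x. T (u x)) has_derivative (\<lambda>h. T (frechet_derivative u (at x) h))) (at x)" for x
    using Suc.prems
    by (auto simp: frechet_derivative_works[symmetric] intro!: bounded_linear.has_derivative[OF T])
  have "partial_deriv b (\<lambda>x. T (u x)) = (\<lambda>x. T (partial_deriv b u x))" for b
    using partial_deriv_eqI[OF D] by (simp add: partial_deriv_def fun_eq_iff)
  then show ?case using Suc D by (auto simp: differentiable_def)
qed

lemma has_derivative_affine:
  assumes "\<And>x. u differentiable (at x)"
  shows "((\<lambda>y. u (a *\<^sub>R y + z)) has_derivative (\<lambda>h. a *\<^sub>R frechet_derivative u (at (a *\<^sub>R x + z)) h)) (at x)"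
proof -
  have D: "(u has_derivative frechet_derivative u (at (a *\<^sub>R x + z))) (at (a *\<^sub>R x + z))"
    using assms frechet_derivative_works by blast
  have "((\<lambda>y. u (a *\<^sub>R y + z)) has_derivative (\<lambda>h. frechet_derivative u (at (a *\<^sub>R x + z)) (a *\<^sub>R h))) (at x)"
    by (rule has_derivative_compose[where g = u]) (use D in \<open>auto intro!: derivative_eq_intros\<close>)
  then show ?thesis
    using linear_frechet_derivative[OF assms] by (simp add: linear_cmul)
qed

text \<open>The partial derivatives are again a scaled function composed with the same affine map, so the
  induction needs only closure under scaling. The case \<open>a = - 1\<close> yields reflected mollifiers
  as test functions.\<close>

lemma Ck_affine: "Ck k u \<Longrightarrow> Ck k (\<lambda>y. u (a *\<^sub>R y + z))"
proof (induction k arbitrary: u)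
  case 0
  then show ?case by (auto intro!: continuous_intros continuous_on_compose2[of UNIV u])
next
  case (Suc k)
  then have dif: "\<And>x. u differentiable (at x)" by auto
  note D = has_derivative_affine[OF dif]
  have eq: "partial_deriv b (\<lambda>y. u (a *\<^sub>R y + z)) = (\<lambda>y. a *\<^sub>R partial_deriv b u (a *\<^sub>R y + z))" for b
    using partial_deriv_eqI[OF D] by (simp add: partial_deriv_def fun_eq_iff)
  have "Ck k (\<lambda>y. a *\<^sub>R partial_deriv b u (a *\<^sub>R y + z))" if "b \<in> Basis" for b
    using Suc that by (intro Ck_bounded_linear[OF bounded_linear_scaleR_right]) auto
  then show ?case using D by (auto simp: eq intro: differentiableI[OF D])
qed

text \<open>Products with linear forms: enough of a product rule to treat radial functions.\<close>

lemma Ck_inner_scaleR: "Ck k w \<Longrightarrow> Ck k (\<lambda>x. (x \<bullet> c) *\<^sub>R w x)"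
proof (induction k arbitrary: w)
  case 0
  then show ?case by (auto intro!: continuous_intros)
next
  case (Suc k)
  have D: "((\<lambda>x. (x \<bullet> c) *\<^sub>R w x) has_derivative
      (\<lambda>h. (x \<bullet> c) *\<^sub>R frechet_derivative w (at x) h + (h \<bullet> c) *\<^sub>R w x)) (at x)" for x
  proof -
    have "(w has_derivative frechet_derivative w (at x)) (at x)"
      using Suc.prems by (auto simp: frechet_derivative_works[symmetric])
    moreover have "((\<lambda>x. x \<bullet> c) has_derivative (\<lambda>h. h \<bullet> c)) (at x)"
      by (intro bounded_linear_imp_has_derivative bounded_linear_inner_left)
    ultimately show ?thesis by (rule has_derivative_scaleR[rotated])
  qed
  have eq: "partial_deriv b (\<lambda>x. (x \<bullet> c) *\<^sub>R w x) = (\<lambda>x. (x \<bullet> c) *\<^sub>R partial_deriv b w x + (b \<bullet> c) *\<^sub>R w x)" for b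
    using partial_deriv_eqI[OF D] by (simp add: partial_deriv_def fun_eq_iff)
  have "Ck k (\<lambda>x. (x \<bullet> c) *\<^sub>R partial_deriv b w x + (b \<bullet> c) *\<^sub>R w x)" if "b \<in> Basis" for b
    using Suc.IH[of "partial_deriv b w"] Suc.prems that
    by (intro Ck_add Ck_bounded_linear[OF bounded_linear_scaleR_right] Ck_Suc_imp_Ck[OF Suc.prems]) auto
  then show ?case using D by (auto simp: eq intro: differentiableI[OF D])
qed

text \<open>A partial derivative of \<open>g(|x|\<^sup>2)\<close> is a linear form times another function of \<open>|x|\<^sup>2\<close>, so the induction
  runs over all \<open>g\<close>. This produces smooth bumps on the whole space from a cut-off on the line.\<close>

lemma Ck_radial:
  fixes g :: "real \<Rightarrow> 'b::real_normed_vector"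
  shows "Ck k g \<Longrightarrow> Ck k (\<lambda>x::'a::euclidean_space. g (x \<bullet> x))"
proof (induction k arbitrary: g)
  case 0
  then show ?case by (auto intro!: continuous_intros continuous_on_compose2[of UNIV g])
next
  case (Suc k)
  have D: "((\<lambda>x::'a. g (x \<bullet> x)) has_derivative
      (\<lambda>h. frechet_derivative g (at (x \<bullet> x)) (2 * (x \<bullet> h)))) (at x)" for x
  proof (rule has_derivative_compose[of _ _ _ _ g])
    show "((\<lambda>x. x \<bullet> x) has_derivative (\<lambda>h. 2 * (x \<bullet> h))) (at x)"
      by (rule has_derivative_eq_rhs, rule has_derivative_inner, rule has_derivative_ident, rule has_derivative_ident)
         (simp add: fun_eq_iff inner_commute)
    show "(g has_derivative frechet_derivative g (at (x \<bullet> x))) (at (x \<bullet> x))"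
      using Suc.prems by (auto simp: frechet_derivative_works[symmetric])
  qed
  have lin: "frechet_derivative g (at y) (2 * c) = c *\<^sub>R (2 *\<^sub>R partial_deriv 1 g y)" for y c
  proof -
    have "linear (frechet_derivative g (at y))" using Suc.prems by (auto intro: linear_frechet_derivative)
    from linear_cmul[OF this, of "2 * c" 1] show ?thesis by (simp add: partial_deriv_def mult.commute)
  qed
  have eq: "partial_deriv b (\<lambda>x::'a. g (x \<bullet> x)) = (\<lambda>x. (x \<bullet> b) *\<^sub>R (2 *\<^sub>R partial_deriv 1 g (x \<bullet> x)))" for b
    using partial_deriv_eqI[OF D] by (simp add: fun_eq_iff lin)
  have "Ck k (\<lambda>x::'a. (x \<bullet> b) *\<^sub>R (2 *\<^sub>R partial_deriv 1 g (x \<bullet> x)))" for b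
    using Suc by (intro Ck_inner_scaleR Ck_bounded_linear[OF bounded_linear_scaleR_right]) auto
  then show ?case using D by (auto simp: eq intro: differentiableI[OF D])
qed

section \<open>Functions that are continuously differentiable along a direction\<close>

text \<open>Integration by parts only sees one direction at a time, and one-variable derivatives at \<open>h = 0\<close> suffice
  for it. This avoids Frechet derivatives of convolutions and of the weights.\<close>

definition C1_along ::
    "'a::euclidean_space \<Rightarrow> ('a \<Rightarrow> 'b::real_normed_vector) \<Rightarrow> ('a \<Rightarrow> 'b) \<Rightarrow> bool" where
  "C1_along b u u' \<longleftrightarrow> continuous_on UNIV u \<and> continuous_on UNIV u' \<and>
     (\<forall>x. ((\<lambda>h. u (x + h *\<^sub>R b)) has_vector_derivative u' x) (at 0))"

lemma C1_along_mult:
  fixes u v :: "'a::euclidean_space \<Rightarrow> 'b::real_normed_algebra"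
  assumes "C1_along b u u'" "C1_along b v v'"
  shows "C1_along b (\<lambda>x. u x * v x) (\<lambda>x. u x * v' x + u' x * v x)"
proof -
  have "((\<lambda>h. u (x + h *\<^sub>R b) * v (x + h *\<^sub>R b)) has_vector_derivative u (x + 0 *\<^sub>R b) * v' x + u' x * v (x + 0 *\<^sub>R b)) (at 0)" for x
    using assms by (intro has_vector_derivative_mult) (auto simp: C1_along_def)
  then show ?thesis using assms by (auto simp: C1_along_def intro!: continuous_intros)
qed

lemma C1_along_bounded_linear:
  assumes "C1_along b u u'" and T: "bounded_linear T"
  shows "C1_along b (\<lambda>x. T (u x)) (\<lambda>x. T (u' x))"
  using assms
  by (auto simp: C1_along_def intro!: bounded_linear.has_vector_derivative[OF T] bounded_linear.continuous_on[OF T])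

lemma Ck_imp_C1_along:
  assumes "Ck (Suc k) u" "b \<in> Basis"
  shows "C1_along b u (partial_deriv b u)"
proof -
  have C0: "Ck 0 w" if "Ck j w" for j and w :: "'a \<Rightarrow> 'b"
    using that by (induction j) (simp, metis Ck_Suc_imp_Ck)
  have "((\<lambda>h. u (x + h *\<^sub>R b)) has_vector_derivative partial_deriv b u x) (at 0)" for x
  proof -
    have u: "u differentiable (at x)" using assms by auto
    have "((\<lambda>h. u (x + h *\<^sub>R b)) has_derivative (\<lambda>h. frechet_derivative u (at x) (h *\<^sub>R b))) (at 0)"
      by (rule has_derivative_compose[of _ _ _ _ u])
         (use u in \<open>auto simp: frechet_derivative_works[symmetric] intro!: derivative_eq_intros\<close>)
    then show ?thesis
      using linear_frechet_derivative[OF u]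
      by (simp add: has_vector_derivative_def partial_deriv_def linear_cmul)
  qed
  then show ?thesis
    using C0[OF assms(1)] C0[of k "partial_deriv b u"] assms by (auto simp: C1_along_def)
qed

text \<open>The quotient form is what dominated convergence is applied to.\<close>

lemma has_vector_derivative_at_0_iff_quotient:
  "(f has_vector_derivative d) (at 0) \<longleftrightarrow> ((\<lambda>t. (f t - f 0) /\<^sub>R t) \<longlongrightarrow> d) (at 0)"
proof -
  have ev: "\<forall>\<^sub>F t in at 0. norm (f (0 + t) - f 0 - t *\<^sub>R d) / norm t = norm ((f t - f 0) /\<^sub>R t - d)"
    unfolding eventually_at_filter
  proof (intro always_eventually allI impI)
    fix t :: real assume "t \<noteq> 0"
    then have "(f t - f 0) /\<^sub>R t - d = (f (0 + t) - f 0 - t *\<^sub>R d) /\<^sub>R t"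
      by (simp add: scaleR_diff_right)
    then show "norm (f (0 + t) - f 0 - t *\<^sub>R d) / norm t = norm ((f t - f 0) /\<^sub>R t - d)"
      by (simp add: divide_inverse mult.commute)
  qed
  have "(f has_vector_derivative d) (at 0) \<longleftrightarrow>
      ((\<lambda>t. norm (f (0 + t) - f 0 - t *\<^sub>R d) / norm t) \<longlongrightarrow> 0) (at 0)"
    by (simp add: has_vector_derivative_def has_derivative_at bounded_linear_scaleR_left)
  also have "\<dots> \<longleftrightarrow> ((\<lambda>t. norm ((f t - f 0) /\<^sub>R t - d)) \<longlongrightarrow> 0) (at 0)"
    by (rule tendsto_cong[OF ev])
  also have "\<dots> \<longleftrightarrow> ((\<lambda>t. (f t - f 0) /\<^sub>R t) \<longlongrightarrow> d) (at 0)"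
    by (simp add: tendsto_norm_zero_iff LIM_zero_iff)
  finally show ?thesis .
qed

lemma C1_along_shift:
  assumes "C1_along b u u'"
  shows "((\<lambda>h. u (x + h *\<^sub>R b)) has_vector_derivative u' (x + s *\<^sub>R b)) (at s)"
proof -
  have "((\<lambda>h. u ((x + s *\<^sub>R b) + h *\<^sub>R b)) has_vector_derivative u' (x + s *\<^sub>R b)) (at 0)"
    using assms by (auto simp: C1_along_def)
  then have "((\<lambda>h. u ((x + s *\<^sub>R b) + h *\<^sub>R b)) \<circ> (\<lambda>r. r - s) has_vector_derivative 1 *\<^sub>R u' (x + s *\<^sub>R b)) (at s)"
    by (intro vector_diff_chain_at) (auto intro!: derivative_eq_intros)
  then show ?thesis by (simp add: o_def algebra_simps)
qed

lemma C1_along_difference_bound: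
  assumes "C1_along b u u'" and "\<And>x. norm (u' x) \<le> B"
  shows "norm (u (x + h *\<^sub>R b) - u x) \<le> B * \<bar>h\<bar>"
proof -
  have "norm (u (x + h *\<^sub>R b) - u (x + 0 *\<^sub>R b)) \<le> B * norm (h - 0)"
  proof (rule differentiable_bound[where S = UNIV and f = "\<lambda>h. u (x + h *\<^sub>R b)"
        and f' = "\<lambda>s r. r *\<^sub>R u' (x + s *\<^sub>R b)"])
    show "((\<lambda>h. u (x + h *\<^sub>R b)) has_derivative (\<lambda>r. r *\<^sub>R u' (x + s *\<^sub>R b))) (at s within UNIV)" for s
      using C1_along_shift[OF assms(1)] by (simp add: has_vector_derivative_def)
    show "onorm (\<lambda>r. r *\<^sub>R u' (x + s *\<^sub>R b)) \<le> B" for s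
      using order_trans[OF norm_ge_zero assms(2)] assms(2)
      by (intro onorm_bound) (auto simp: mult.commute[of B] intro!: mult_left_mono)
  qed auto
  then show ?thesis by simp
qed

lemma C1_along_vanish:
  assumes "C1_along b u u'" and "\<And>x. M < norm x \<Longrightarrow> u x = 0" and "M < norm x"
  shows "u' x = 0"
proof -
  have "((\<lambda>h. x + h *\<^sub>R b) \<longlongrightarrow> x + 0 *\<^sub>R b) (at 0)" by (intro tendsto_intros)
  then have "((\<lambda>h. norm (x + h *\<^sub>R b)) \<longlongrightarrow> norm x) (at 0)" by (auto dest: tendsto_norm)
  then have "\<forall>\<^sub>F h in at 0. M < norm (x + h *\<^sub>R b)" using assms(3) by (rule order_tendstoD)
  then have "\<forall>\<^sub>F h in at 0. u (x + h *\<^sub>R b) = (\<lambda>_. 0) h" by eventually_elim (simp add: assms(2))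
  moreover have "((\<lambda>h. u (x + h *\<^sub>R b)) has_vector_derivative u' x) (at 0)"
    using assms by (auto simp: C1_along_def)
  ultimately have "((\<lambda>_. 0) has_vector_derivative u' x) (at 0)"
    unfolding has_vector_derivative_def
    using has_derivative_transform_eventually[where g = "\<lambda>_. 0"] assms by fastforce
  then show ?thesis
    by (rule vector_derivative_unique_at) (rule has_vector_derivative_const)
qed

lemma continuous_vanish_imp_bounded:
  fixes u :: "'a::euclidean_space \<Rightarrow> 'b::real_normed_vector"
  assumes "continuous_on UNIV u" and "\<And>x. M < norm x \<Longrightarrow> u x = 0"
  obtains B where "B \<ge> 0" "\<And>x. norm (u x) \<le> B"
proof -
  have "compact (u ` cball 0 M)"
    using assms(1) by (intro compact_continuous_image) (auto intro: continuous_on_subset)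
  then have "bounded (u ` cball 0 M)" by (rule compact_imp_bounded)
  then obtain B where B: "\<forall>x\<in>cball 0 M. norm (u x) \<le> B"
    unfolding bounded_iff by blast
  have "norm (u x) \<le> max B 0" for x
    using B assms(2)[of x] by (cases "norm x \<le> M") (auto intro: le_max_iff_disj[THEN iffD2])
  then show thesis using that[of "max B 0"] by auto
qed

lemma integrable_continuous_vanish:
  fixes u :: "'a::euclidean_space \<Rightarrow> 'b::euclidean_space"
  assumes "continuous_on UNIV u" and "\<And>x. M < norm x \<Longrightarrow> u x = 0"
  shows "integrable lborel u"
proof -
  have "set_integrable lborel (cball 0 M) u"
    using assms(1) unfolding set_integrable_def
    by (intro borel_integrable_compact) (auto intro: continuous_on_subset)
  moreover have "(\<lambda>x. indicator (cball 0 M) x *\<^sub>R u x) = u"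
    using assms(2) by (auto simp: fun_eq_iff indicator_def not_le)
  ultimately show ?thesis by (simp add: set_integrable_def)
qed

lemma integral_translation_lborel:
  fixes f :: "'a::euclidean_space \<Rightarrow> 'b::{banach,second_countable_topology}"
  assumes "f \<in> borel_measurable borel"
  shows "(LINT x|lborel. f (x + c)) = (LINT x|lborel. f x)"
proof -
  have "(LINT x|lborel. f x) = (LINT x|distr lborel borel ((+) c). f x)"
    by (simp add: lborel_distr_plus)
  also have "\<dots> = (LINT x|lborel. f (c + x))"
    using assms by (intro integral_distr) auto
  finally show ?thesis by (simp add: add.commute)
qed

text \<open>Integration by parts without Fubini: the difference quotients integrate to zero by translation
  invariance, and by the mean value bound they converge dominatedly to the derivative.\<close>

lemma integral_C1_along_eq_0:
  fixes G :: "'a::euclidean_space \<Rightarrow> 'b::euclidean_space"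
  assumes G: "C1_along b G G'" and van: "\<And>x. M < norm x \<Longrightarrow> G x = 0"
  shows "(LINT x|lborel. G' x) = 0"
proof -
  have van': "\<And>x. M < norm x \<Longrightarrow> G' x = 0" using C1_along_vanish[OF G van] by blast
  have cG: "continuous_on UNIV G" and cG': "continuous_on UNIV G'"
    and der: "\<And>x. ((\<lambda>h. G (x + h *\<^sub>R b)) has_vector_derivative G' x) (at 0)"
    using G by (auto simp: C1_along_def)
  have mG[measurable]: "G \<in> borel_measurable borel" "G' \<in> borel_measurable borel"
    using cG cG' by (auto intro: borel_measurable_continuous_onI)
  obtain B where B: "B \<ge> 0" "\<And>x. norm (G' x) \<le> B"
    using continuous_vanish_imp_bounded[OF cG' van'] by blast
  define h :: "nat \<Rightarrow> real" where "h n = 1 / real (Suc n)" for n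
  have h: "0 < h n" "h n \<le> 1" for n by (auto simp: h_def)
  have h0: "h \<longlonglongrightarrow> 0" unfolding h_def using LIMSEQ_inverse_real_of_nat by (simp add: inverse_eq_divide)
  define Q where "Q n x = (G (x + h n *\<^sub>R b) - G x) /\<^sub>R h n" for n x
  have intG: "integrable lborel G" by (rule integrable_continuous_vanish[OF cG van])
  have "(LINT x|lborel. Q n x) = 0" for n
  proof -
    have "integrable lborel (\<lambda>x. G (x + h n *\<^sub>R b))"
    proof (rule integrable_continuous_vanish)
      show "continuous_on UNIV (\<lambda>x. G (x + h n *\<^sub>R b))"
        using cG by (auto intro!: continuous_intros continuous_on_compose2[of UNIV G])
      show "M + norm (h n *\<^sub>R b) < norm x \<Longrightarrow> G (x + h n *\<^sub>R b) = 0" for x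
        using van[of "x + h n *\<^sub>R b"] norm_diff_ineq[of x "h n *\<^sub>R b"] by auto
    qed
    then show ?thesis
      using intG integral_translation_lborel[of G "h n *\<^sub>R b"] by (simp add: Q_def)
  qed
  moreover have "(\<lambda>n. LINT x|lborel. Q n x) \<longlonglongrightarrow> (LINT x|lborel. G' x)"
  proof (rule integral_dominated_convergence[where w = "\<lambda>x. B * indicator (cball 0 (M + norm b)) x"])
    show "G' \<in> borel_measurable lborel" by simp
    show "Q n \<in> borel_measurable lborel" for n unfolding Q_def by measurable
    show "integrable lborel (\<lambda>x. B * indicator (cball 0 (M + norm b)) (x::'a))"
      using emeasure_lborel_cball_finite[of "0::'a" "M + norm b"]
      by (intro integrable_mult_right integrable_real_indicator) auto
    show "AE x in lborel. (\<lambda>n. Q n x) \<longlonglongrightarrow> G' x"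
    proof (rule AE_I2)
      fix x
      have "((\<lambda>t. (G (x + t *\<^sub>R b) - G x) /\<^sub>R t) \<longlongrightarrow> G' x) (at 0)"
        using der[of x] by (simp add: has_vector_derivative_at_0_iff_quotient)
      then show "(\<lambda>n. Q n x) \<longlonglongrightarrow> G' x"
        unfolding Q_def using h0 h(1)
        by (auto simp: tendsto_at_iff_sequentially o_def less_imp_neq[symmetric])
    qed
    show "AE x in lborel. norm (Q n x) \<le> B * indicator (cball 0 (M + norm b)) x" for n
    proof (rule AE_I2)
      fix x
      show "norm (Q n x) \<le> B * indicator (cball 0 (M + norm b)) x"
      proof (cases "norm x \<le> M + norm b")
        case True
        then show ?thesis
          using C1_along_difference_bound[OF G B(2), of x "h n"] h[of n]
          unfolding Q_def by (simp add: divide_inverse[symmetric] divide_le_eq mult.commute[of "inverse _"])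
      next
        case False
        have "norm (h n *\<^sub>R b) \<le> norm b"
          using h[of n] by (simp add: mult_left_le_one_le)
        then have "M < norm (x + h n *\<^sub>R b)"
          using False norm_diff_ineq[of x "h n *\<^sub>R b"] by auto
        moreover have "M < norm x" using False by (smt (verit) norm_ge_zero)
        ultimately show ?thesis using van False by (simp add: Q_def)
      qed
    qed
  qed
  ultimately show ?thesis by (simp add: LIMSEQ_const_iff)
qed

section \<open>Convolution with a continuous kernel\<close>

text \<open>The kernel is real, the function complex: kernels will be mollifiers and their derivatives.\<close>

definition conv :: "('a::euclidean_space \<Rightarrow> real) \<Rightarrow> ('a \<Rightarrow> complex) \<Rightarrow> 'a \<Rightarrow> complex" where
  "conv K u x = (LINT y|lborel. K (x - y) *\<^sub>R u y)"

definition loc_int :: "('a::euclidean_space \<Rightarrow> complex) \<Rightarrow> bool" where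
  "loc_int u \<longleftrightarrow> u \<in> borel_measurable borel \<and> (\<forall>M. set_integrable lborel (cball 0 M) u)"

lemma loc_int_mult:
  assumes "loc_int u" "k \<in> borel_measurable borel"
    and "\<And>x. cmod (k x) \<le> B" and "\<And>x. M < norm x \<Longrightarrow> k x = 0"
  shows "integrable lborel (\<lambda>x. k x * u x)"
proof (rule Bochner_Integration.integrable_bound)
  show "integrable lborel (\<lambda>x. B *\<^sub>R (indicator (cball 0 M) x *\<^sub>R u x))"
    using assms(1) by (auto simp: loc_int_def set_integrable_def simp del: scaleR_scaleR)
  show "(\<lambda>x. k x * u x) \<in> borel_measurable lborel"
    using assms(1,2) by (auto simp: loc_int_def)
  show "AE x in lborel. norm (k x * u x) \<le> norm (B *\<^sub>R (indicator (cball 0 M) x *\<^sub>R u x))"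
  proof (rule AE_I2)
    fix x show "norm (k x * u x) \<le> norm (B *\<^sub>R (indicator (cball 0 M) x *\<^sub>R u x))"
      using assms(3)[of x] assms(4)[of x]
      by (cases "norm x \<le> M") (auto simp: norm_mult intro!: mult_right_mono)
  qed
qed

lemma loc_int_scaleR:
  assumes "loc_int u" "k \<in> borel_measurable borel"
    and "\<And>x. \<bar>k x\<bar> \<le> B" and "\<And>x. M < norm x \<Longrightarrow> k x = 0"
  shows "integrable lborel (\<lambda>x. k x *\<^sub>R u x)"
  using loc_int_mult[OF assms(1), of "\<lambda>x. complex_of_real (k x)" B M] assms(2-4)
  by (simp add: scaleR_conv_of_real)

lemma integrable_conv:
  assumes "loc_int u" "continuous_on UNIV K" "\<And>x. M < norm x \<Longrightarrow> K x = 0"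
  shows "integrable lborel (\<lambda>y. K (x - y) *\<^sub>R u y)"
proof -
  obtain B where B: "\<And>x. \<bar>K x\<bar> \<le> B"
    using continuous_vanish_imp_bounded[OF assms(2,3)] by (metis real_norm_def)
  show ?thesis
  proof (rule loc_int_scaleR[OF assms(1)])
    show "(\<lambda>y. K (x - y)) \<in> borel_measurable borel"
      using assms(2) by (auto intro!: borel_measurable_continuous_onI continuous_intros continuous_on_compose2[of UNIV K])
    show "K (x - y) = 0" if "norm x + M < norm y" for y
      using assms(3)[of "x - y"] that norm_triangle_ineq2[of y x] by (auto simp: norm_minus_commute)
  qed (use B in auto)
qed

lemma continuous_on_conv:
  assumes u: "loc_int u" and K: "continuous_on UNIV K" and van: "\<And>x. M < norm x \<Longrightarrow> K x = 0"
  shows "continuous_on UNIV (conv K u)"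
  unfolding continuous_on_sequentially
proof (intro allI ballI impI, elim conjE)
  fix X x assume X: "X \<longlonglongrightarrow> (x::'a)"
  obtain B where B: "\<And>x. \<bar>K x\<bar> \<le> B"
    using continuous_vanish_imp_bounded[OF K van] by (metis real_norm_def)
  obtain H where H: "\<And>n. norm (X n) \<le> H"
    using X convergent_imp_bounded[of X] by (auto simp: bounded_iff)
  have mK[measurable]: "K \<in> borel_measurable borel" and mu[measurable]: "u \<in> borel_measurable borel"
    using K u by (auto intro: borel_measurable_continuous_onI simp: loc_int_def)
  show "(conv K u \<circ> X) \<longlonglongrightarrow> conv K u x"
    unfolding conv_def o_def
  proof (rule integral_dominated_convergence)
    show "AE y in lborel. (\<lambda>n. K (X n - y) *\<^sub>R u y) \<longlonglongrightarrow> K (x - y) *\<^sub>R u y"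
    proof (rule AE_I2)
      fix y
      have "isCont K (x - y)" using K by (simp add: continuous_on_eq_continuous_at)
      moreover have "(\<lambda>n. X n - y) \<longlonglongrightarrow> x - y" by (intro tendsto_intros X)
      ultimately have "(\<lambda>n. K (X n - y)) \<longlonglongrightarrow> K (x - y)" by (rule isCont_tendsto_compose)
      then show "(\<lambda>n. K (X n - y) *\<^sub>R u y) \<longlonglongrightarrow> K (x - y) *\<^sub>R u y" by (intro tendsto_intros)
    qed
    show "integrable lborel (\<lambda>y. norm ((B * indicator (cball 0 (H + M)) y) *\<^sub>R u y))"
      using loc_int_scaleR[OF u, of "\<lambda>y. B * indicator (cball 0 (H + M)) y" "\<bar>B\<bar>" "H + M"]
      by (intro integrable_norm) (auto simp: indicator_def)
    show "AE y in lborel. norm (K (X n - y) *\<^sub>R u y) \<le> norm ((B * indicator (cball 0 (H + M)) y) *\<^sub>R u y)" for n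
    proof (rule AE_I2)
      fix y
      show "norm (K (X n - y) *\<^sub>R u y) \<le> norm ((B * indicator (cball 0 (H + M)) y) *\<^sub>R u y)"
      proof (cases "norm y \<le> H + M")
        case True
        then show ?thesis using B[of "X n - y"] by (auto intro!: mult_right_mono)
      next
        case False
        then have "M < norm (X n - y)"
          using H[of n] norm_triangle_ineq2[of y "X n"] by (auto simp: norm_minus_commute)
        then show ?thesis using van by simp
      qed
    qed
  qed measurable
qed

text \<open>Differentiation under the integral sign; all the regularity comes from the kernel.\<close>

lemma C1_along_conv:
  assumes u: "loc_int u" and K: "C1_along b K K'" and van: "\<And>x. M < norm x \<Longrightarrow> K x = 0"
  shows "C1_along b (conv K u) (conv K' u)"
proof -
  have van': "\<And>x. M < norm x \<Longrightarrow> K' x = 0" using C1_along_vanish[OF K van] by blast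
  have cK: "continuous_on UNIV K" and cK': "continuous_on UNIV K'"
    and der: "\<And>x. ((\<lambda>h. K (x + h *\<^sub>R b)) has_vector_derivative K' x) (at 0)"
    using K by (auto simp: C1_along_def)
  have [measurable]: "K \<in> borel_measurable borel" "K' \<in> borel_measurable borel" "u \<in> borel_measurable borel"
    using cK cK' u by (auto intro: borel_measurable_continuous_onI simp: loc_int_def)
  obtain B where B: "\<And>x. norm (K' x) \<le> B"
    using continuous_vanish_imp_bounded[OF cK' van'] by blast
  have "((\<lambda>h. conv K u (x + h *\<^sub>R b)) has_vector_derivative conv K' u x) (at 0)" for x
    unfolding has_vector_derivative_at_0_iff_quotient tendsto_at_iff_sequentially
  proof (intro allI impI)
    fix h :: "nat \<Rightarrow> real" assume h: "\<forall>i. h i \<in> UNIV - {0}" and h0: "h \<longlonglongrightarrow> 0"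
    obtain H where H: "\<And>n. \<bar>h n\<bar> \<le> H"
      using h0 convergent_imp_bounded[of h] by (auto simp: bounded_iff)
    define N where "N = norm x + H * norm b + M"
    have "(\<lambda>n. LINT y|lborel. ((K (x - y + h n *\<^sub>R b) - K (x - y)) / h n) *\<^sub>R u y) \<longlonglongrightarrow> (LINT y|lborel. K' (x - y) *\<^sub>R u y)"
    proof (rule integral_dominated_convergence)
      show "AE y in lborel. (\<lambda>n. ((K (x - y + h n *\<^sub>R b) - K (x - y)) / h n) *\<^sub>R u y) \<longlonglongrightarrow> K' (x - y) *\<^sub>R u y"
      proof (rule AE_I2)
        fix y
        have "(\<lambda>n. (K (x - y + h n *\<^sub>R b) - K (x - y)) / h n) \<longlonglongrightarrow> K' (x - y)"
          using der[of "x - y"] h h0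
          unfolding has_vector_derivative_at_0_iff_quotient tendsto_at_iff_sequentially
          by (auto simp: o_def divide_inverse mult.commute)
        then show "(\<lambda>n. ((K (x - y + h n *\<^sub>R b) - K (x - y)) / h n) *\<^sub>R u y) \<longlonglongrightarrow> K' (x - y) *\<^sub>R u y"
          by (intro tendsto_intros)
      qed
      show "integrable lborel (\<lambda>y. norm ((B * indicator (cball 0 N) y) *\<^sub>R u y))"
        using loc_int_scaleR[OF u, of "\<lambda>y. B * indicator (cball 0 N) y" "\<bar>B\<bar>" N]
        by (intro integrable_norm) (auto simp: indicator_def)
      show "AE y in lborel. norm (((K (x - y + h n *\<^sub>R b) - K (x - y)) / h n) *\<^sub>R u y) \<le> norm ((B * indicator (cball 0 N) y) *\<^sub>R u y)" for n
      proof (rule AE_I2)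
        fix y
        show "norm (((K (x - y + h n *\<^sub>R b) - K (x - y)) / h n) *\<^sub>R u y) \<le> norm ((B * indicator (cball 0 N) y) *\<^sub>R u y)"
        proof (cases "norm y \<le> N")
          case True
          have "\<bar>(K (x - y + h n *\<^sub>R b) - K (x - y)) / h n\<bar> \<le> B"
            using C1_along_difference_bound[OF K B, of "x - y" "h n"] h by (simp add: divide_le_eq)
          then show ?thesis using True unfolding norm_scaleR by (intro mult_right_mono) auto
        next
          case False
          have "norm (h n *\<^sub>R b) \<le> H * norm b" using H[of n] by (simp add: mult_right_mono)
          moreover have "0 \<le> H * norm b" using H[of 0] by (meson abs_ge_zero dual_order.trans mult_nonneg_nonneg norm_ge_zero)
          ultimately have "M < norm (x - y)" "M < norm (x - y + h n *\<^sub>R b)"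
            using False norm_triangle_ineq2[of y x] norm_diff_ineq[of "x - y" "h n *\<^sub>R b"]
            by (auto simp: norm_minus_commute N_def)
          then show ?thesis using van by simp
        qed
      qed
    qed measurable
    moreover have "(LINT y|lborel. ((K (x - y + h n *\<^sub>R b) - K (x - y)) / h n) *\<^sub>R u y)
        = (conv K u (x + h n *\<^sub>R b) - conv K u (x + 0 *\<^sub>R b)) /\<^sub>R h n" for n
    proof -
      have "(LINT y|lborel. K (x + h n *\<^sub>R b - y) *\<^sub>R u y - K (x - y) *\<^sub>R u y) = conv K u (x + h n *\<^sub>R b) - conv K u x"
        unfolding conv_def
        by (intro Bochner_Integration.integral_diff integrable_conv[OF u cK van])
      then have "(LINT y|lborel. (1 / h n) *\<^sub>R (K (x + h n *\<^sub>R b - y) *\<^sub>R u y - K (x - y) *\<^sub>R u y)) = (conv K u (x + h n *\<^sub>R b) - conv K u x) /\<^sub>R h n"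
        by (simp add: divide_inverse)
      moreover have "((K (x - y + h n *\<^sub>R b) - K (x - y)) / h n) *\<^sub>R u y
          = (1 / h n) *\<^sub>R (K (x + h n *\<^sub>R b - y) *\<^sub>R u y - K (x - y) *\<^sub>R u y)" for y
      proof -
        have "x - y + h n *\<^sub>R b = x + h n *\<^sub>R b - y" by simp
        then show ?thesis by (simp only:) (simp add: diff_divide_distrib scaleR_diff_left scaleR_diff_right)
      qed
      ultimately show ?thesis by simp
    qed
    ultimately show "((\<lambda>t. (conv K u (x + t *\<^sub>R b) - conv K u (x + 0 *\<^sub>R b)) /\<^sub>R t) \<circ> h) \<longlonglongrightarrow> conv K' u x"
      by (simp add: o_def conv_def[of K'])
  qed
  then show ?thesis
    using continuous_on_conv[OF u cK van] continuous_on_conv[OF u cK' van'] by (simp add: C1_along_def)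
qed

section \<open>Mollification in \<open>L\<^sup>2\<close>\<close>

text \<open>Square integrability for Borel functions. Working with Borel representatives and \<open>lborel\<close>
  gives direct access to Tonelli's theorem.\<close>

definition L2 :: "('a::euclidean_space \<Rightarrow> complex) \<Rightarrow> bool" where
  "L2 f \<longleftrightarrow> f \<in> borel_measurable borel \<and> integrable lborel (\<lambda>x. (cmod (f x))\<^sup>2)"

lemma cmod_add_square_le: "(cmod (a + b))\<^sup>2 \<le> 2 * (cmod a)\<^sup>2 + 2 * (cmod b)\<^sup>2"
proof -
  have "(cmod (a + b))\<^sup>2 \<le> (cmod a + cmod b)\<^sup>2" by (intro power_mono norm_triangle_ineq) auto
  also have "\<dots> \<le> 2 * (cmod a)\<^sup>2 + 2 * (cmod b)\<^sup>2"
    using sum_squares_bound[of "cmod a" "cmod b"] by (simp add: power2_sum)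
  finally show ?thesis .
qed

lemma cmod_diff_square_le: "(cmod (a - b))\<^sup>2 \<le> 2 * (cmod a)\<^sup>2 + 2 * (cmod b)\<^sup>2"
  using cmod_add_square_le[of a "-b"] by simp

lemma L2_add:
  assumes "L2 f" "L2 g" shows "L2 (\<lambda>x. f x + g x)"
  unfolding L2_def
proof (intro conjI)
  have [measurable]: "f \<in> borel_measurable borel" "g \<in> borel_measurable borel"
    using assms by (auto simp: L2_def)
  show "(\<lambda>x. f x + g x) \<in> borel_measurable borel" by measurable
  show "integrable lborel (\<lambda>x. (cmod (f x + g x))\<^sup>2)"
  proof (rule Bochner_Integration.integrable_bound)
    show "integrable lborel (\<lambda>x. 2 * (cmod (f x))\<^sup>2 + 2 * (cmod (g x))\<^sup>2)"
      using assms by (simp add: L2_def)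
  qed (auto simp: cmod_add_square_le)
qed

lemma L2_diff: "L2 f \<Longrightarrow> L2 g \<Longrightarrow> L2 (\<lambda>x. f x - g x)"
  using L2_add[of f "\<lambda>x. - g x"] by (simp add: L2_def)

lemma L2_bounded_support:
  fixes f :: "'a::euclidean_space \<Rightarrow> complex"
  assumes "f \<in> borel_measurable borel" "\<And>x. cmod (f x) \<le> B" "\<And>x. M < norm x \<Longrightarrow> f x = 0"
  shows "L2 f"
  unfolding L2_def
proof (intro conjI assms(1), rule Bochner_Integration.integrable_bound)
  show "integrable lborel (\<lambda>x. B\<^sup>2 * indicator (cball 0 M) (x::'a))"
    using emeasure_lborel_cball_finite[of "0::'a" M]
    by (intro integrable_mult_right integrable_real_indicator) auto
  show "(\<lambda>x. (cmod (f x))\<^sup>2) \<in> borel_measurable lborel" using assms(1) by measurable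
  show "AE x in lborel. norm ((cmod (f x))\<^sup>2) \<le> norm (B\<^sup>2 * indicator (cball 0 M) x)"
  proof (rule AE_I2)
    fix x show "norm ((cmod (f x))\<^sup>2) \<le> norm (B\<^sup>2 * indicator (cball 0 M) x)"
      using assms(2)[of x] assms(3)[of x] by (cases "norm x \<le> M") (auto intro!: power_mono)
  qed
qed

lemma L2_approx_bounded:
  assumes f: "L2 f" and "0 < e"
  obtains n :: nat where
    "(LINT x|lborel. (cmod (f x - (if norm x \<le> n \<and> cmod (f x) \<le> n then f x else 0)))\<^sup>2) < e"
proof -
  have [measurable]: "f \<in> borel_measurable borel" using f by (simp add: L2_def)
  define F where "F n x = (if norm x \<le> real n \<and> cmod (f x) \<le> real n then f x else 0)" for n x
  have [measurable]: "F n \<in> borel_measurable borel" for n unfolding F_def by measurable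
  have "(\<lambda>n. LINT x|lborel. (cmod (f x - F n x))\<^sup>2) \<longlonglongrightarrow> (LINT x|(lborel::'a measure). 0)"
  proof (rule integral_dominated_convergence[where w = "\<lambda>x. (cmod (f x))\<^sup>2"])
    show "AE x in lborel. (\<lambda>n. (cmod (f x - F n x))\<^sup>2) \<longlonglongrightarrow> 0"
    proof (rule AE_I2)
      fix x
      obtain N :: nat where N: "max (norm x) (cmod (f x)) \<le> real N" using real_arch_simple by blast
      have "(cmod (f x - F n x))\<^sup>2 = 0" if "N \<le> n" for n
        using N that by (auto simp: F_def)
      then show "(\<lambda>n. (cmod (f x - F n x))\<^sup>2) \<longlonglongrightarrow> 0"
        by (intro tendsto_eventually eventually_sequentiallyI)
    qed
  qed (use f in \<open>auto simp: L2_def F_def\<close>)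
  then have "\<forall>\<^sub>F n in sequentially. (LINT x|lborel. (cmod (f x - F n x))\<^sup>2) < e"
    using \<open>0 < e\<close> by (intro order_tendstoD) auto
  then obtain n where "(LINT x|lborel. (cmod (f x - F n x))\<^sup>2) < e"
    by (auto simp: eventually_sequentially)
  then show thesis using that unfolding F_def by blast
qed

text \<open>A Lebesgue measurable function is an almost everywhere limit of continuous functions. Truncating these in
  modulus at \<open>B\<close> and cutting them off outside a ball keeps the limit and makes them dominated.\<close>

lemma L2_approx_continuous_bounded:
  fixes f :: "'a::euclidean_space \<Rightarrow> complex"
  assumes f: "f \<in> borel_measurable borel" and bd: "\<And>x. cmod (f x) \<le> B"
    and van: "\<And>x. M < norm x \<Longrightarrow> f x = 0" and "0 < e" "0 < B"
  obtains g where "continuous_on UNIV g" "\<And>x. M + 1 < norm x \<Longrightarrow> g x = 0"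
    "(LINT x|lborel. (cmod (f x - g x))\<^sup>2) < e"
proof -
  have "f measurable_on UNIV"
    using f by (intro lebesgue_measurable_imp_measurable_on measurable_completion) simp_all
  then obtain N g where N: "negligible N" and cg: "\<And>n. continuous_on UNIV (g n)"
    and lim: "\<And>x. x \<notin> N \<Longrightarrow> (\<lambda>n. g n x) \<longlonglongrightarrow> f x"
    by (auto simp: measurable_on_def)
  \<comment> \<open>The second factor truncates the modulus at \<open>B\<close> without changing the argument.\<close>
  define G :: "nat \<Rightarrow> 'a \<Rightarrow> complex" where
    "G n x = (max 0 (min 1 (M + 1 - norm x)) * (B / max B (cmod (g n x)))) *\<^sub>R g n x" for n x
  have cG: "continuous_on UNIV (G n)" for n
    unfolding G_def using cg \<open>0 < B\<close> by (intro continuous_intros) auto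
  have [measurable]: "G n \<in> borel_measurable borel" "f \<in> borel_measurable borel" for n
    using cG f by (auto intro: borel_measurable_continuous_onI)
  have G0: "G n x = 0" if "M + 1 < norm x" for n x using that by (auto simp: G_def)
  have GB: "cmod (G n x) \<le> B" for n x
  proof -
    have "B / max B (cmod (g n x)) * cmod (g n x) \<le> B"
      using \<open>0 < B\<close> by (auto simp: field_simps max_def)
    moreover have "max 0 (min 1 (M + 1 - norm x)) * (B / max B (cmod (g n x)) * cmod (g n x))
        \<le> 1 * (B / max B (cmod (g n x)) * cmod (g n x))"
      using \<open>0 < B\<close> by (intro mult_right_mono) auto
    ultimately show ?thesis using \<open>0 < B\<close> by (simp add: G_def abs_mult)
  qed
  have "AE x in lborel. x \<notin> N"
  proof -
    have "AE x in lebesgue. x \<notin> N" using N by (simp add: negligible_iff_null_sets AE_not_in)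
    then show ?thesis by (simp only: AE_completion_iff)
  qed
  have "(\<lambda>n. LINT x|lborel. (cmod (f x - G n x))\<^sup>2) \<longlonglongrightarrow> (LINT x|(lborel::'a measure). 0)"
  proof (rule integral_dominated_convergence)
    show "AE x in lborel. (\<lambda>n. (cmod (f x - G n x))\<^sup>2) \<longlonglongrightarrow> 0"
      using \<open>AE x in lborel. x \<notin> N\<close>
    proof eventually_elim
      case (elim x)
      have "(\<lambda>n. G n x) \<longlonglongrightarrow> (max 0 (min 1 (M + 1 - norm x)) * (B / max B (cmod (f x)))) *\<^sub>R f x"
        unfolding G_def using \<open>0 < B\<close> by (intro tendsto_intros lim elim) auto
      moreover have "(max 0 (min 1 (M + 1 - norm x)) * (B / max B (cmod (f x)))) *\<^sub>R f x = f x"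
        using bd[of x] van[of x] \<open>0 < B\<close> by (cases "norm x \<le> M") (auto simp: max_absorb1)
      ultimately have "(\<lambda>n. (cmod (f x - G n x))\<^sup>2) \<longlonglongrightarrow> (cmod (f x - f x))\<^sup>2"
        by (intro tendsto_intros) simp_all
      then show ?case by simp
    qed
    show "integrable lborel (\<lambda>x. (cmod (complex_of_real (2 * B * indicator (cball 0 (M + 1)) (x::'a))))\<^sup>2)"
      using L2_bounded_support[of "\<lambda>x::'a. complex_of_real (2 * B * indicator (cball 0 (M + 1)) x)" "2 * B" "M + 1"] \<open>0 < B\<close>
      by (auto simp: L2_def norm_mult indicator_def)
    show "AE x in lborel. norm ((cmod (f x - G n x))\<^sup>2) \<le> (cmod (complex_of_real (2 * B * indicator (cball 0 (M + 1)) x)))\<^sup>2" for n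
    proof (rule AE_I2)
      fix x
      show "norm ((cmod (f x - G n x))\<^sup>2) \<le> (cmod (complex_of_real (2 * B * indicator (cball 0 (M + 1)) x)))\<^sup>2"
      proof (cases "norm x \<le> M + 1")
        case True
        have "cmod (f x - G n x) \<le> 2 * B" using norm_triangle_ineq4[of "f x" "G n x"] bd[of x] GB[of n x] by simp
        then show ?thesis using True \<open>0 < B\<close> power_mono[of "cmod (f x - G n x)" "2 * B" 2]
          by (simp add: norm_mult power_mult_distrib)
      next
        case False
        then show ?thesis using G0[of x n] van[of x] by auto
      qed
    qed
  qed auto
  then have "\<forall>\<^sub>F n in sequentially. (LINT x|lborel. (cmod (f x - G n x))\<^sup>2) < e"
    using \<open>0 < e\<close> by (intro order_tendstoD) auto
  then obtain n where "(LINT x|lborel. (cmod (f x - G n x))\<^sup>2) < e"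
    by (auto simp: eventually_sequentially)
  then show thesis using that[of "G n"] cG G0 by blast
qed

lemma L2_approx_continuous:
  fixes f :: "'a::euclidean_space \<Rightarrow> complex"
  assumes f: "L2 f" and "0 < e"
  obtains g M where "continuous_on UNIV g" "\<And>x. M < norm x \<Longrightarrow> g x = 0"
    "(LINT x|lborel. (cmod (f x - g x))\<^sup>2) < e"
proof -
  have mf[measurable]: "f \<in> borel_measurable borel" using f by (simp add: L2_def)
  obtain n :: nat where n: "(LINT x|lborel. (cmod (f x - (if norm x \<le> n \<and> cmod (f x) \<le> n then f x else 0)))\<^sup>2) < e / 4"
    using L2_approx_bounded[OF f, of "e / 4"] \<open>0 < e\<close> by auto
  define F where "F x = (if norm x \<le> real n \<and> cmod (f x) \<le> real n then f x else 0)" for x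
  have mF[measurable]: "F \<in> borel_measurable borel" unfolding F_def by measurable
  have FB: "cmod (F x) \<le> real n + 1" and F0: "real n < norm x \<Longrightarrow> F x = 0" for x by (auto simp: F_def)
  obtain g where g: "continuous_on UNIV g" "\<And>x. real n + 1 < norm x \<Longrightarrow> g x = 0"
    "(LINT x|lborel. (cmod (F x - g x))\<^sup>2) < e / 4"
    using L2_approx_continuous_bounded[OF mF FB F0, where e = "e / 4"] \<open>0 < e\<close> by auto
  have [measurable]: "g \<in> borel_measurable borel" using g(1) by (auto intro: borel_measurable_continuous_onI)
  obtain B where B: "\<And>x. cmod (g x) \<le> B" using continuous_vanish_imp_bounded[OF g(1,2)] by blast
  have "L2 g" by (rule L2_bounded_support[OF _ B g(2)]) auto
  moreover have "L2 F" by (rule L2_bounded_support[OF _ FB F0]) auto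
  ultimately have L: "L2 (\<lambda>x. f x - F x)" "L2 (\<lambda>x. F x - g x)" "L2 (\<lambda>x. f x - g x)" using f L2_diff by blast+
  have "(LINT x|lborel. (cmod (f x - g x))\<^sup>2) \<le> (LINT x|lborel. 2 * (cmod (f x - F x))\<^sup>2 + 2 * (cmod (F x - g x))\<^sup>2)"
  proof (rule integral_mono)
    show "(cmod (f x - g x))\<^sup>2 \<le> 2 * (cmod (f x - F x))\<^sup>2 + 2 * (cmod (F x - g x))\<^sup>2" for x
      using cmod_add_square_le[of "f x - F x" "F x - g x"] by simp
  qed (use L in \<open>auto simp: L2_def\<close>)
  also have "\<dots> = 2 * (LINT x|lborel. (cmod (f x - F x))\<^sup>2) + 2 * (LINT x|lborel. (cmod (F x - g x))\<^sup>2)"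
    using L by (simp add: L2_def)
  also have "\<dots> < e" using n g(3) unfolding F_def by simp
  finally show thesis using that[OF g(1,2)] by blast
qed

lemma L2_translation:
  assumes "L2 f" shows "L2 (\<lambda>x. f (x + c))"
    and "(LINT x|lborel. (cmod (f (x + c)))\<^sup>2) = (LINT x|lborel. (cmod (f x))\<^sup>2)"
proof -
  have [measurable]: "f \<in> borel_measurable borel" using assms by (simp add: L2_def)
  have "integrable (distr lborel borel ((+) c)) (\<lambda>x. (cmod (f x))\<^sup>2)"
    using assms by (simp add: lborel_distr_plus L2_def)
  then have "integrable lborel (\<lambda>x. (cmod (f (c + x)))\<^sup>2)"
    by (subst (asm) integrable_distr_eq) auto
  then show "L2 (\<lambda>x. f (x + c))" by (simp add: L2_def add.commute)
  show "(LINT x|lborel. (cmod (f (x + c)))\<^sup>2) = (LINT x|lborel. (cmod (f x))\<^sup>2)"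
    by (rule integral_translation_lborel) measurable
qed

text \<open>Uniform continuity on a ball makes the integrand small, and the support has finite measure.\<close>

lemma L2_translation_continuous_vanish:
  fixes g :: "'a::euclidean_space \<Rightarrow> complex"
  assumes g: "continuous_on UNIV g" and van: "\<And>x. M < norm x \<Longrightarrow> g x = 0" and "0 < e"
  obtains d where "0 < d" "\<And>z. norm z \<le> d \<Longrightarrow> (LINT x|lborel. (cmod (g (x + z) - g x))\<^sup>2) \<le> e"
proof -
  define vol where "vol = measure lborel (cball (0::'a) (M + 1))"
  have vol: "0 \<le> vol" by (simp add: vol_def)
  define eta where "eta = sqrt (e / (vol + 1))"
  have eta: "0 < eta" "eta\<^sup>2 * vol \<le> e"
    using vol \<open>0 < e\<close> by (auto simp: eta_def field_simps)
  have "uniformly_continuous_on (cball 0 (M + 2)) g"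
    using g by (intro compact_uniformly_continuous) (auto intro: continuous_on_subset)
  then obtain d where d: "0 < d"
    "\<And>x y. x \<in> cball 0 (M + 2) \<Longrightarrow> y \<in> cball 0 (M + 2) \<Longrightarrow> dist y x < d \<Longrightarrow> dist (g y) (g x) < eta"
    using eta(1) unfolding uniformly_continuous_on_def by blast
  have [measurable]: "g \<in> borel_measurable borel" using g by (rule borel_measurable_continuous_onI)
  have "(LINT x|lborel. (cmod (g (x + z) - g x))\<^sup>2) \<le> e" if z: "norm z \<le> min 1 (d / 2)" for z
  proof -
    have "(LINT x|lborel. (cmod (g (x + z) - g x))\<^sup>2) \<le> (LINT x|lborel. eta\<^sup>2 * indicator (cball 0 (M + 1)) (x::'a))"
    proof (rule integral_mono')
      show "integrable lborel (\<lambda>x. eta\<^sup>2 * indicator (cball 0 (M + 1)) (x::'a))"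
        using emeasure_lborel_cball_finite[of "0::'a" "M + 1"]
        by (intro integrable_mult_right integrable_real_indicator) auto
      show "(cmod (g (x + z) - g x))\<^sup>2 \<le> eta\<^sup>2 * indicator (cball 0 (M + 1)) x" for x
      proof (cases "norm x \<le> M + 1")
        case True
        then have "dist (g (x + z)) (g x) < eta"
        proof (intro d(2))
          show "x \<in> cball 0 (M + 2)" "x + z \<in> cball 0 (M + 2)"
            using True z norm_triangle_ineq[of x z] unfolding mem_cball_0 by auto
          show "dist (x + z) x < d" using z d(1) by (simp add: dist_norm)
        qed
        then show ?thesis using True by (auto simp: dist_norm intro!: power_mono)
      next
        case False
        then show ?thesis using z van[of x] van[of "x + z"] norm_diff_ineq[of x z] by auto
      qed
    qed auto
    also have "\<dots> = eta\<^sup>2 * vol" by (simp add: vol_def)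
    finally show ?thesis using eta by simp
  qed
  then show thesis using that[of "min 1 (d / 2)"] d(1) by auto
qed

lemma L2_translation_continuous:
  fixes f :: "'a::euclidean_space \<Rightarrow> complex"
  assumes f: "L2 f" and "0 < e"
  obtains d where "0 < d" "\<And>z. norm z \<le> d \<Longrightarrow> (LINT x|lborel. (cmod (f (x + z) - f x))\<^sup>2) \<le> e"
proof -
  obtain g M where g: "continuous_on UNIV g" "\<And>x. M < norm x \<Longrightarrow> g x = 0"
    "(LINT x|lborel. (cmod (f x - g x))\<^sup>2) < e / 16"
    using L2_approx_continuous[OF f, of "e / 16"] \<open>0 < e\<close> by auto
  obtain d where d: "0 < d" "\<And>z. norm z \<le> d \<Longrightarrow> (LINT x|lborel. (cmod (g (x + z) - g x))\<^sup>2) \<le> e / 4"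
    using L2_translation_continuous_vanish[OF g(1,2), where e = "e / 4"] \<open>0 < e\<close> by auto
  obtain B where "\<And>x. cmod (g x) \<le> B" using continuous_vanish_imp_bounded[OF g(1,2)] by blast
  then have Lg: "L2 g" using g(1,2) by (intro L2_bounded_support) (auto intro: borel_measurable_continuous_onI)
  define h where "h x = f x - g x" for x
  have Lh: "L2 h" unfolding h_def using f Lg by (rule L2_diff)
  have "(LINT x|lborel. (cmod (f (x + z) - f x))\<^sup>2) \<le> e" if "norm z \<le> d" for z
  proof -
    note L = L2_diff[OF L2_translation(1)[OF f, of z] f] L2_translation(1)[OF Lh, of z] Lh
      L2_diff[OF L2_translation(1)[OF Lg, of z] Lg]
    have "(LINT x|lborel. (cmod (f (x + z) - f x))\<^sup>2) \<le>
        (LINT x|lborel. 4 * (cmod (h (x + z)))\<^sup>2 + 4 * (cmod (h x))\<^sup>2 + 2 * (cmod (g (x + z) - g x))\<^sup>2)"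
    proof (rule integral_mono)
      show "(cmod (f (x + z) - f x))\<^sup>2 \<le>
          4 * (cmod (h (x + z)))\<^sup>2 + 4 * (cmod (h x))\<^sup>2 + 2 * (cmod (g (x + z) - g x))\<^sup>2" for x
        using cmod_add_square_le[of "h (x + z) - h x" "g (x + z) - g x"] cmod_diff_square_le[of "h (x + z)" "h x"]
        by (simp add: h_def algebra_simps)
    qed (use L in \<open>auto simp: L2_def\<close>)
    also have "\<dots> = 4 * (LINT x|lborel. (cmod (h (x + z)))\<^sup>2) + 4 * (LINT x|lborel. (cmod (h x))\<^sup>2)
        + 2 * (LINT x|lborel. (cmod (g (x + z) - g x))\<^sup>2)"
      using L by (simp add: L2_def)
    also have "\<dots> \<le> e"
      using d(2)[OF that] g(3) L2_translation(2)[OF Lh, of z] by (simp add: h_def)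
    finally show ?thesis .
  qed
  then show thesis using that d(1) by blast
qed

lemma L2_imp_loc_int:
  assumes "L2 f" shows "loc_int f"
  unfolding loc_int_def
proof (intro conjI allI)
  have [measurable]: "f \<in> borel_measurable borel" using assms by (simp add: L2_def)
  show "f \<in> borel_measurable borel" by simp
  show "set_integrable lborel (cball 0 M) f" for M
    unfolding set_integrable_def
  proof (rule Bochner_Integration.integrable_bound)
    show "integrable lborel (\<lambda>x. indicator (cball 0 M) x + (cmod (f x))\<^sup>2)"
      using assms emeasure_lborel_cball_finite[of "0::'a" M]
      by (intro Bochner_Integration.integrable_add integrable_real_indicator) (auto simp: L2_def)
    show "AE x in lborel. norm (indicator (cball 0 M) x *\<^sub>R f x) \<le> norm (indicator (cball 0 M) x + (cmod (f x))\<^sup>2)"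
    proof (rule AE_I2)
      fix x
      have "cmod (f x) \<le> 1 + (cmod (f x))\<^sup>2"
        using sum_squares_bound[of "cmod (f x)" 1] by (simp add: power2_eq_square) (smt (verit) norm_ge_zero)
      then show "norm (indicator (cball 0 M) x *\<^sub>R f x) \<le> norm (indicator (cball 0 M) x + (cmod (f x))\<^sup>2)"
        by (simp add: indicator_def)
    qed
  qed (auto intro!: borel_measurable_scaleR borel_measurable_indicator)
qed

text \<open>Jensen's inequality for the square, obtained by expanding \<open>\<integral> w (D - A)\<^sup>2 \<ge> 0\<close> at the mean \<open>A\<close>.\<close>

lemma square_integral_le:
  fixes w D :: "'a \<Rightarrow> real"
  assumes w: "integrable M w" "\<And>x. 0 \<le> w x" "integral\<^sup>L M w = 1"
    and D: "integrable M (\<lambda>x. w x * D x)" "integrable M (\<lambda>x. w x * (D x)\<^sup>2)"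
  shows "(LINT x|M. w x * D x)\<^sup>2 \<le> (LINT x|M. w x * (D x)\<^sup>2)"
proof -
  define A where "A = (LINT x|M. w x * D x)"
  have "0 \<le> (LINT x|M. w x * (D x - A)\<^sup>2)" using w(2) by simp
  also have "\<dots> = (LINT x|M. w x * (D x)\<^sup>2 - 2 * A * (w x * D x) + A\<^sup>2 * w x)"
    by (intro Bochner_Integration.integral_cong) (auto simp: power2_eq_square algebra_simps)
  also have "\<dots> = (LINT x|M. w x * (D x)\<^sup>2) - 2 * A * A + A\<^sup>2"
    using w D by (simp add: A_def)
  finally show ?thesis by (simp add: A_def power2_eq_square)
qed

lemma nn_integral_reflect_lborel:
  fixes h :: "'a::euclidean_space \<Rightarrow> ennreal"
  assumes [measurable]: "h \<in> borel_measurable borel"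
  shows "(\<integral>\<^sup>+y. h y \<partial>lborel) = (\<integral>\<^sup>+z. h (x - z) \<partial>lborel)"
proof -
  have "(lborel::'a measure) = density (distr lborel borel (\<lambda>z. x + (-1) *\<^sub>R z)) (\<lambda>_. ennreal (\<bar>-1\<bar> ^ DIM('a)))"
    by (rule lborel_affine) simp
  also have "\<dots> = distr lborel borel (\<lambda>z. x - z)" by (simp add: density_1)
  finally have eq: "(lborel::'a measure) = distr lborel borel (\<lambda>z. x - z)" .
  show ?thesis by (subst eq) (simp add: nn_integral_distr)
qed

text \<open>All estimates depend on the kernel only through the radius \<open>d\<close> of its support.\<close>

locale mollifier =
  fixes K :: "'a::euclidean_space \<Rightarrow> real" and d :: real
  assumes cont: "continuous_on UNIV K" and nonneg: "0 \<le> K x" 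
    and vanish: "d < norm x \<Longrightarrow> K x = 0" and integral_1: "(LINT x|lborel. K x) = 1"
begin

lemma measurable_K[measurable]: "K \<in> borel_measurable borel"
  using cont by (rule borel_measurable_continuous_onI)

lemma integrable_K: "integrable lborel K"
  using cont vanish by (rule integrable_continuous_vanish)

lemma nn_integral_K: "(\<integral>\<^sup>+x. ennreal (K x) \<partial>lborel) = 1"
  using integrable_K nonneg integral_1 by (subst nn_integral_eq_integral) auto

lemma nn_integral_reflected: "(\<integral>\<^sup>+y. ennreal (K (x - y)) \<partial>lborel) = 1" 
  using nn_integral_reflect_lborel[of "\<lambda>y. ennreal (K (x - y))" x] nn_integral_K by simp

lemma integrable_reflected: "integrable lborel (\<lambda>y. K (x - y))" "(LINT y|lborel. K (x - y)) = 1"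
proof -
  show "integrable lborel (\<lambda>y. K (x - y))"
    using nn_integral_reflected[of x] nonneg by (intro integrableI_nonneg) auto
  show "(LINT y|lborel. K (x - y)) = 1"
    using nn_integral_reflected[of x] nonneg by (subst integral_eq_nn_integral) auto
qed

lemma conv_diff_square_le:
  assumes f: "L2 f"
  shows "ennreal ((cmod (conv K f x - f x))\<^sup>2) \<le> (\<integral>\<^sup>+y. ennreal (K (x - y) * (cmod (f y - f x))\<^sup>2) \<partial>lborel)"
proof -
  have [measurable]: "f \<in> borel_measurable borel" using f by (simp add: L2_def)
  obtain B where B: "\<And>x. norm (K x) \<le> B" using continuous_vanish_imp_bounded[OF cont vanish] by blast
  have i1: "integrable lborel (\<lambda>y. K (x - y) *\<^sub>R f y)"
    by (rule integrable_conv[OF L2_imp_loc_int[OF f] cont vanish])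
  have i2: "integrable lborel (\<lambda>y. K (x - y) *\<^sub>R f x)"
    using integrable_reflected(1)[of x] by simp
  have "integrable lborel (\<lambda>y. K (x - y) *\<^sub>R f y - K (x - y) *\<^sub>R f x)" using i1 i2 by simp
  then have "integrable lborel (\<lambda>y. K (x - y) *\<^sub>R (f y - f x))" by (simp add: scaleR_diff_right)
  then have "integrable lborel (\<lambda>y. norm (K (x - y) *\<^sub>R (f y - f x)))" by (rule integrable_norm)
  then have i3: "integrable lborel (\<lambda>y. K (x - y) * cmod (f y - f x))" using nonneg by simp
  have i4: "integrable lborel (\<lambda>y. K (x - y) * (cmod (f y - f x))\<^sup>2)"
  proof (rule Bochner_Integration.integrable_bound)
    show "integrable lborel (\<lambda>y. 2 * B * (cmod (f y))\<^sup>2 + 2 * (cmod (f x))\<^sup>2 * K (x - y))"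
      using f integrable_reflected(1)[of x] by (simp add: L2_def)
    show "AE y in lborel. norm (K (x - y) * (cmod (f y - f x))\<^sup>2) \<le> norm (2 * B * (cmod (f y))\<^sup>2 + 2 * (cmod (f x))\<^sup>2 * K (x - y))"
    proof (rule AE_I2)
      fix y
      have "K (x - y) * (cmod (f y - f x))\<^sup>2 \<le> K (x - y) * (2 * (cmod (f y))\<^sup>2 + 2 * (cmod (f x))\<^sup>2)"
        using nonneg cmod_diff_square_le by (intro mult_left_mono) auto
      also have "\<dots> \<le> 2 * B * (cmod (f y))\<^sup>2 + 2 * (cmod (f x))\<^sup>2 * K (x - y)"
        using mult_right_mono[of "K (x - y)" B "2 * (cmod (f y))\<^sup>2"] B[of "x - y"]
        by (simp add: algebra_simps)
      finally show "norm (K (x - y) * (cmod (f y - f x))\<^sup>2) \<le> norm (2 * B * (cmod (f y))\<^sup>2 + 2 * (cmod (f x))\<^sup>2 * K (x - y))"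
        using nonneg[of "x - y"] by simp
    qed
  qed measurable
  have "conv K f x - f x = (LINT y|lborel. K (x - y) *\<^sub>R f y) - (LINT y|lborel. K (x - y) *\<^sub>R f x)"
    using integrable_reflected[of x] by (simp add: conv_def)
  also have "\<dots> = (LINT y|lborel. K (x - y) *\<^sub>R (f y - f x))"
    using i1 i2 by (simp add: scaleR_diff_right)
  finally have "cmod (conv K f x - f x) \<le> (LINT y|lborel. norm (K (x - y) *\<^sub>R (f y - f x)))"
    using integral_norm_bound by metis
  also have "\<dots> = (LINT y|lborel. K (x - y) * cmod (f y - f x))" using nonneg by simp
  finally have "(cmod (conv K f x - f x))\<^sup>2 \<le> (LINT y|lborel. K (x - y) * cmod (f y - f x))\<^sup>2"
    by (intro power_mono) auto
  also have "\<dots> \<le> (LINT y|lborel. K (x - y) * (cmod (f y - f x))\<^sup>2)"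
    by (rule square_integral_le[OF integrable_reflected(1) _ integrable_reflected(2) i3 i4]) (rule nonneg)
  finally have "ennreal ((cmod (conv K f x - f x))\<^sup>2) \<le> ennreal (LINT y|lborel. K (x - y) * (cmod (f y - f x))\<^sup>2)"
    by (rule ennreal_leI)
  also have "\<dots> = (\<integral>\<^sup>+y. ennreal (K (x - y) * (cmod (f y - f x))\<^sup>2) \<partial>lborel)"
    using i4 nonneg by (subst nn_integral_eq_integral) auto
  finally show ?thesis .
qed

text \<open>Jensen's inequality in the kernel variable and Tonelli reduce the error of mollification to the \<open>L\<^sup>2\<close>
  modulus of continuity under translations.\<close>

lemma L2_conv_diff:
  assumes f: "L2 f" and "0 \<le> e"
    and e: "\<And>z. norm z \<le> d \<Longrightarrow> (LINT x|lborel. (cmod (f (x + z) - f x))\<^sup>2) \<le> e"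
  shows "L2 (\<lambda>x. conv K f x - f x)" "(LINT x|lborel. (cmod (conv K f x - f x))\<^sup>2) \<le> e"
proof -
  have [measurable]: "f \<in> borel_measurable borel" using f by (simp add: L2_def)
  have mc[measurable]: "conv K f \<in> borel_measurable borel"
    using continuous_on_conv[OF L2_imp_loc_int[OF f] cont vanish] by (rule borel_measurable_continuous_onI)
  have "(\<integral>\<^sup>+x. ennreal ((cmod (conv K f x - f x))\<^sup>2) \<partial>lborel)
      \<le> (\<integral>\<^sup>+x. (\<integral>\<^sup>+y. ennreal (K (x - y) * (cmod (f y - f x))\<^sup>2) \<partial>lborel) \<partial>lborel)"
    by (intro nn_integral_mono conv_diff_square_le[OF f])
  also have "\<dots> = (\<integral>\<^sup>+x. (\<integral>\<^sup>+z. ennreal (K z * (cmod (f (x - z) - f x))\<^sup>2) \<partial>lborel) \<partial>lborel)"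
  proof (rule nn_integral_cong)
    fix x
    show "(\<integral>\<^sup>+y. ennreal (K (x - y) * (cmod (f y - f x))\<^sup>2) \<partial>lborel) = (\<integral>\<^sup>+z. ennreal (K z * (cmod (f (x - z) - f x))\<^sup>2) \<partial>lborel)"
      using nn_integral_reflect_lborel[of "\<lambda>y. ennreal (K (x - y) * (cmod (f y - f x))\<^sup>2)" x] by simp
  qed
  also have "\<dots> = (\<integral>\<^sup>+z. (\<integral>\<^sup>+x. ennreal (K z * (cmod (f (x - z) - f x))\<^sup>2) \<partial>lborel) \<partial>lborel)"
    by (rule lborel_pair.Fubini') measurable
  also have "\<dots> \<le> (\<integral>\<^sup>+z. ennreal (K z) * ennreal e \<partial>lborel)"
  proof (rule nn_integral_mono)
    fix z
    show "(\<integral>\<^sup>+x. ennreal (K z * (cmod (f (x - z) - f x))\<^sup>2) \<partial>lborel) \<le> ennreal (K z) * ennreal e"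
    proof (cases "norm z \<le> d")
      case True
      have "integrable lborel (\<lambda>x. (cmod (f (x + - z) - f x))\<^sup>2)"
        using L2_diff[OF L2_translation(1)[OF f, of "- z"] f] by (simp add: L2_def)
      then have "(\<integral>\<^sup>+x. ennreal ((cmod (f (x - z) - f x))\<^sup>2) \<partial>lborel) = ennreal (LINT x|lborel. (cmod (f (x - z) - f x))\<^sup>2)"
        by (subst nn_integral_eq_integral) auto
      also have "\<dots> \<le> ennreal e" using e[of "- z"] True by (intro ennreal_leI) simp
      finally show ?thesis
        using nonneg[of z] by (simp add: ennreal_mult nn_integral_cmult mult_left_mono)
    next
      case False
      then show ?thesis using vanish[of z] by simp
    qed
  qed
  also have "\<dots> = ennreal e" by (simp add: nn_integral_multc nn_integral_K)
  finally have *: "(\<integral>\<^sup>+x. ennreal ((cmod (conv K f x - f x))\<^sup>2) \<partial>lborel) \<le> ennreal e" .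
  then have i: "integrable lborel (\<lambda>x. (cmod (conv K f x - f x))\<^sup>2)"
    by (intro integrableI_nonneg) (auto simp: top_unique[symmetric] intro: le_less_trans)
  then show "L2 (\<lambda>x. conv K f x - f x)" by (simp add: L2_def)
  show "(LINT x|lborel. (cmod (conv K f x - f x))\<^sup>2) \<le> e"
    using * i \<open>0 \<le> e\<close> by (subst (asm) nn_integral_eq_integral) auto
qed

end

text \<open>From \<open>|p\<^sup>2 - q\<^sup>2| \<le> r (r + 2 q)\<close> with \<open>r = |p - q|\<close>; the free parameter \<open>h\<close> splits the mixed term
  and takes the place of the Cauchy-Schwarz inequality.\<close>

lemma integral_weighted_square_diff_le:
  assumes X: "L2 X" and D: "L2 (\<lambda>x. Y x - X x)" and a: "a \<in> borel_measurable borel" "\<And>x. \<bar>a x\<bar> \<le> A"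
    and "0 < (h::real)"
  shows "integrable lborel (\<lambda>x. a x * (cmod (X x))\<^sup>2)"
    and "\<bar>(LINT x|lborel. a x * (cmod (Y x))\<^sup>2) - (LINT x|lborel. a x * (cmod (X x))\<^sup>2)\<bar>
      \<le> A * ((1 + 1 / h) * (LINT x|lborel. (cmod (Y x - X x))\<^sup>2) + h * (LINT x|lborel. (cmod (X x))\<^sup>2))"
proof -
  have A: "0 \<le> A" using a(2) order_trans[OF abs_ge_zero] by blast
  have int: "integrable lborel (\<lambda>x. a x * (cmod (Z x))\<^sup>2)" if "L2 Z" for Z
  proof (rule Bochner_Integration.integrable_bound)
    show "integrable lborel (\<lambda>x. A * (cmod (Z x))\<^sup>2)" using that by (simp add: L2_def)
    show "(\<lambda>x. a x * (cmod (Z x))\<^sup>2) \<in> borel_measurable lborel"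
      using a(1) that by (auto simp: L2_def intro!: borel_measurable_times borel_measurable_power borel_measurable_norm)
    show "AE x in lborel. norm (a x * (cmod (Z x))\<^sup>2) \<le> norm (A * (cmod (Z x))\<^sup>2)"
      using a(2) A by (auto simp: abs_mult intro!: mult_right_mono)
  qed
  show iX: "integrable lborel (\<lambda>x. a x * (cmod (X x))\<^sup>2)" by (rule int[OF X])
  have "L2 Y" using L2_add[OF D X] by simp
  then have iY: "integrable lborel (\<lambda>x. a x * (cmod (Y x))\<^sup>2)" by (rule int)
  have "\<bar>(LINT x|lborel. a x * (cmod (Y x))\<^sup>2) - (LINT x|lborel. a x * (cmod (X x))\<^sup>2)\<bar>
      = norm (LINT x|lborel. a x * (cmod (Y x))\<^sup>2 - a x * (cmod (X x))\<^sup>2)"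
    using iX iY by simp
  also have "\<dots> \<le> (LINT x|lborel. norm (a x * (cmod (Y x))\<^sup>2 - a x * (cmod (X x))\<^sup>2))"
    by (rule integral_norm_bound)
  also have "\<dots> \<le> (LINT x|lborel. A * ((1 + 1 / h) * (cmod (Y x - X x))\<^sup>2 + h * (cmod (X x))\<^sup>2))"
  proof (rule integral_mono)
    show "norm (a x * (cmod (Y x))\<^sup>2 - a x * (cmod (X x))\<^sup>2) \<le> A * ((1 + 1 / h) * (cmod (Y x - X x))\<^sup>2 + h * (cmod (X x))\<^sup>2)" for x
    proof -
      define p q r where "p = cmod (Y x)" and "q = cmod (X x)" and "r = cmod (Y x - X x)"
      have pq: "\<bar>p - q\<bar> \<le> r" "0 \<le> p" "0 \<le> q" unfolding p_def q_def r_def by (auto intro: norm_triangle_ineq3)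
      have "\<bar>p\<^sup>2 - q\<^sup>2\<bar> = \<bar>p - q\<bar> * (p + q)" using pq by (simp add: power2_eq_square square_diff_square_factored abs_mult mult.commute)
      also have "\<dots> \<le> r * (r + 2 * q)" using pq by (intro mult_mono) auto
      also have "\<dots> \<le> (1 + 1 / h) * r\<^sup>2 + h * q\<^sup>2"
      proof -
        have "0 \<le> (r - h * q)\<^sup>2 / h" using \<open>0 < h\<close> by simp
        also have "\<dots> = r\<^sup>2 / h - 2 * r * q + h * q\<^sup>2"
          using \<open>0 < h\<close> by (simp add: power2_eq_square field_simps)
        finally show ?thesis by (simp add: algebra_simps power2_eq_square)
      qed
      finally have "\<bar>a x\<bar> * \<bar>p\<^sup>2 - q\<^sup>2\<bar> \<le> A * ((1 + 1 / h) * r\<^sup>2 + h * q\<^sup>2)"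
        using a(2)[of x] A by (intro mult_mono) auto
      then show ?thesis unfolding p_def q_def r_def by (simp add: right_diff_distrib[symmetric] abs_mult)
    qed
  qed (use iX iY X D in \<open>auto simp: L2_def\<close>)
  also have "\<dots> = A * ((1 + 1 / h) * (LINT x|lborel. (cmod (Y x - X x))\<^sup>2) + h * (LINT x|lborel. (cmod (X x))\<^sup>2))"
    using X D by (simp add: L2_def)
  finally show "\<bar>(LINT x|lborel. a x * (cmod (Y x))\<^sup>2) - (LINT x|lborel. a x * (cmod (X x))\<^sup>2)\<bar>
      \<le> A * ((1 + 1 / h) * (LINT x|lborel. (cmod (Y x - X x))\<^sup>2) + h * (LINT x|lborel. (cmod (X x))\<^sup>2))" .
qed

text \<open>The energy inequality is quadratic, so this one-parameter limit statement is all
  that is needed to pass from mollifications to the function itself.\<close>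

lemma mollifier_weighted_square:
  assumes X: "L2 (X::'a::euclidean_space \<Rightarrow> complex)" and a: "a \<in> borel_measurable borel" "\<And>x. \<bar>a x\<bar> \<le> A" and "0 < e"
  obtains d where "0 < d"
    "\<And>K. mollifier K d \<Longrightarrow> \<bar>(LINT x|lborel. a x * (cmod (conv K X x))\<^sup>2) - (LINT x|lborel. a x * (cmod (X x))\<^sup>2)\<bar> \<le> e"
proof -
  have A: "0 \<le> A" using a(2) order_trans[OF abs_ge_zero] by blast
  define I where "I = (LINT x|lborel. (cmod (X x))\<^sup>2)"
  have I: "0 \<le> I" by (simp add: I_def)
  \<comment> \<open>\<open>h\<close> makes the term with \<open>I\<close> at most \<open>e / 2\<close>, then \<open>e'\<close> does the same for the mollification error.\<close>
  define h where "h = e / (2 * (A + 1) * (I + 1))"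
  have h: "0 < h" using A I \<open>0 < e\<close> by (simp add: h_def)
  define e' where "e' = e / (2 * (A + 1) * (1 + 1 / h))"
  have e': "0 < e'" using A h \<open>0 < e\<close> by (simp add: e'_def add_pos_pos)
  obtain d where d: "0 < d" "\<And>z. norm z \<le> d \<Longrightarrow> (LINT x|lborel. (cmod (X (x + z) - X x))\<^sup>2) \<le> e'"
    using L2_translation_continuous[OF X e'] by blast
  have "\<bar>(LINT x|lborel. a x * (cmod (conv K X x))\<^sup>2) - (LINT x|lborel. a x * (cmod (X x))\<^sup>2)\<bar> \<le> e"
    if "mollifier K d" for K
  proof -
    interpret mollifier K d by fact
    note c = L2_conv_diff[OF X less_imp_le[OF e'] d(2)]
    have "A * ((1 + 1 / h) * (LINT x|lborel. (cmod (conv K X x - X x))\<^sup>2) + h * I) \<le> (A + 1) * ((1 + 1 / h) * e' + h * (I + 1))"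
      using A I h e' c(2) by (intro mult_mono add_mono mult_left_mono add_nonneg_nonneg mult_nonneg_nonneg) auto
    also have "\<dots> = e"
    proof -
      have "(A + 1) * ((1 + 1 / h) * e') = e / 2" using A h by (simp add: e'_def add_pos_pos less_imp_neq[symmetric] divide_simps)
      moreover have "(A + 1) * (h * (I + 1)) = e / 2" using A I by (simp add: h_def divide_simps) 
      ultimately show ?thesis by (simp add: distrib_left)
    qed
    finally show ?thesis
      using integral_weighted_square_diff_le(2)[OF X c(1) a h] by (simp add: I_def)
  qed
  then show thesis using that d(1) by blast
qed

section \<open>Smooth mollifiers\<close>

lemma cutoff_bounds:
  assumes "cutoff chi" shows "0 \<le> chi s" "chi s \<le> 1"
proof -
  have dif: "chi differentiable (at x)" for x
  proof -
    have "Ck (Suc 0) chi" using assms by (simp add: cutoff_def smooth_def)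
    then show ?thesis by simp
  qed
  have anti: "chi y \<le> chi x" if "x \<le> y" for x y
  proof (rule DERIV_nonpos_imp_nonincreasing[OF that])
    fix z
    have "DERIV chi z :> deriv chi z" using dif[of z] by (simp add: DERIV_deriv_iff_real_differentiable)
    then show "\<exists>D. DERIV chi z :> D \<and> D \<le> 0" using assms by (auto simp: cutoff_def)
  qed
  have "chi (max s 2) \<le> chi s" "chi s \<le> chi (min s 1)" by (auto intro: anti)
  then show "0 \<le> chi s" "chi s \<le> 1" using assms by (auto simp: cutoff_def)
qed

lemma smooth_mollifier_exists:
  assumes chi: "cutoff chi" and "0 < d"
  obtains K :: "'a::euclidean_space \<Rightarrow> real" where "mollifier K d" "smooth K"
proof -
  \<comment> \<open>The scaling turns \<open>chi = 0\<close> on \<open>[2, \<infinity>)\<close> into vanishing for \<open>|z| \<ge> d\<close>; the summand 0 fits \<open>Ck_affine\<close>.\<close>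
  define B :: "'a \<Rightarrow> real" where "B z = chi (((sqrt 2 / d) *\<^sub>R z + 0) \<bullet> ((sqrt 2 / d) *\<^sub>R z + 0))" for z
  have B: "B z = chi (2 * (norm z)\<^sup>2 / d\<^sup>2)" for z
    by (simp add: B_def dot_square_norm power_divide power_mult_distrib)
  have Ck_B: "Ck k B" for k
    unfolding B_def using chi by (intro Ck_affine[of k "\<lambda>z. chi (z \<bullet> z)"] Ck_radial) (simp add: cutoff_def smooth_def)
  have cB: "continuous_on UNIV B" using Ck_B[of 0] by simp
  have vB: "B z = 0" if "d < norm z" for z
  proof -
    have "d\<^sup>2 \<le> (norm z)\<^sup>2" using that \<open>0 < d\<close> by (intro power_mono) auto
    then have "2 \<le> 2 * (norm z)\<^sup>2 / d\<^sup>2" using \<open>0 < d\<close> by (simp add: field_simps)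
    then show ?thesis using chi by (simp add: B cutoff_def)
  qed
  have B1: "B z = 1" if "norm z \<le> d / 2" for z
  proof -
    have "(norm z)\<^sup>2 \<le> (d / 2)\<^sup>2" using that by (intro power_mono) auto
    then have "4 * (norm z)\<^sup>2 \<le> d\<^sup>2" by (simp add: power_divide)
    then have "2 * (norm z)\<^sup>2 \<le> d\<^sup>2" using zero_le_power2[of "norm z"] by linarith
    then have "2 * (norm z)\<^sup>2 / d\<^sup>2 \<le> 1" using \<open>0 < d\<close> by (simp add: divide_le_eq)
    then show ?thesis using chi by (simp add: B cutoff_def)
  qed
  have B0: "0 \<le> B z" for z using cutoff_bounds[OF chi] by (simp add: B)
  have iB: "integrable lborel B" by (rule integrable_continuous_vanish[OF cB vB])
  have "0 < measure lborel (ball (0::'a) (d / 2))" using \<open>0 < d\<close> by (simp add: content_ball_pos)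
  also have "\<dots> = (LINT z|lborel. indicator (ball (0::'a) (d / 2)) z)" by simp
  also have "\<dots> \<le> (LINT z|lborel. B z)"
    by (rule integral_mono'[OF iB]) (auto simp: indicator_def B0 B1)
  finally have c: "0 < (LINT z|lborel. B z)" .
  define K where "K z = (1 / (LINT z|lborel. B z)) *\<^sub>R B z" for z
  have Ck_K: "Ck k K" for k
    unfolding K_def by (rule Ck_bounded_linear[OF bounded_linear_scaleR_right Ck_B])
  have "mollifier K d"
  proof
    show "continuous_on UNIV K" using Ck_K[of 0] by simp
  qed (use c B0 vB in \<open>auto simp: K_def\<close>)
  then show thesis using that Ck_K by (auto simp: smooth_def)
qed

lemma laplacian_reflected:
  assumes K: "\<And>k. Ck k K"
  shows "laplacian (\<lambda>y. complex_of_real (K (x - y))) y = complex_of_real (laplacian K (x - y))"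
proof -
  have one: "partial_deriv b (\<lambda>y. complex_of_real (w (x - y))) = (\<lambda>y. - complex_of_real (partial_deriv b w (x - y)))"
    if "Ck (Suc 0) w" for w b
  proof
    fix y
    have "((\<lambda>y. w ((-1) *\<^sub>R y + x)) has_derivative (\<lambda>h. (-1) *\<^sub>R frechet_derivative w (at ((-1) *\<^sub>R y + x)) h)) (at y)"
      using that by (intro has_derivative_affine) auto
    then have "((\<lambda>y. w (x - y)) has_derivative (\<lambda>h. - frechet_derivative w (at (x - y)) h)) (at y)" by simp
    then have "((\<lambda>y. complex_of_real (w (x - y))) has_derivative (\<lambda>h. complex_of_real (- frechet_derivative w (at (x - y)) h))) (at y)"
      by (rule bounded_linear.has_derivative[OF bounded_linear_of_real])
    from partial_deriv_eqI[OF this]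
    show "partial_deriv b (\<lambda>y. complex_of_real (w (x - y))) y = - complex_of_real (partial_deriv b w (x - y))"
      by (simp add: partial_deriv_def)
  qed
  have "partial_deriv b (partial_deriv b (\<lambda>y. complex_of_real (K (x - y)))) y
      = complex_of_real (partial_deriv b (partial_deriv b K) (x - y))" if "b \<in> Basis" for b
  proof -
    have "Ck (Suc 0) (\<lambda>x. - partial_deriv b K x)"
      using K[of "Suc (Suc 0)"] that by (intro Ck_bounded_linear[OF bounded_linear_minus[OF bounded_linear_ident]]) auto
    note * = one[OF this]
    have "partial_deriv b (\<lambda>x. - partial_deriv b K x) z = - partial_deriv b (partial_deriv b K) z" for z
    proof (rule partial_deriv_eqI[THEN trans])
      show "((\<lambda>x. - partial_deriv b K x) has_derivative (\<lambda>h. - frechet_derivative (partial_deriv b K) (at z) h)) (at z)"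
        using K[of "Suc (Suc 0)"] that by (intro has_derivative_minus) (auto simp: frechet_derivative_works[symmetric])
    qed (simp add: partial_deriv_def)
    then show ?thesis using * by (simp add: one[OF K])
  qed
  then show ?thesis by (simp add: laplacian_def)
qed

lemma test_function_reflected:
  assumes K: "smooth K" and van: "\<And>x. d < norm x \<Longrightarrow> K x = 0"
  shows "test_function (\<lambda>y. complex_of_real (K (x - y)))"
  unfolding test_function_def smooth_def
proof (intro conjI allI)
  have "Ck k (\<lambda>y. K ((-1) *\<^sub>R y + x))" for k
    using K by (intro Ck_affine) (simp add: smooth_def)
  then show "Ck k (\<lambda>y. complex_of_real (K (x - y)))" for k
    using Ck_bounded_linear[OF bounded_linear_of_real, of k "\<lambda>y. K (x - y)"] by simp
  have "{y. complex_of_real (K (x - y)) \<noteq> 0} \<subseteq> cball x d"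
  proof
    fix y assume "y \<in> {y. complex_of_real (K (x - y)) \<noteq> 0}"
    then show "y \<in> cball x d" using van[of "x - y"] by (cases "norm (x - y) \<le> d") (auto simp: dist_norm)
  qed
  then have "bounded {y. complex_of_real (K (x - y)) \<noteq> 0}" by (rule bounded_subset[OF bounded_cball])
  then show "compact (closure {y. complex_of_real (K (x - y)) \<noteq> 0})" by (simp add: compact_closure)
qed

section \<open>The energy inequality\<close>

text \<open>The three mixed terms are absorbed by completing squares: \<open>U s\<close> with parameter \<open>b\<close>, the part \<open>(m - c) v\<close> of the
  gradient with the balanced square of \<open>k U - N\<close>, and the part \<open>g\<close> with the gain \<open>c v\<^sup>2 N\<^sup>2\<close> that is left.
  Here \<open>U\<close>, \<open>N\<close>, \<open>s\<close> stand for the moduli of \<open>u\<close>, of its gradient, and of \<open>S\<close>.\<close>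

lemma energy_real_inequality:
  fixes k m c b v g U N s :: real
  assumes "0 < c" "0 < b" "0 \<le> v" "0 \<le> g" "v \<noteq> 0 \<Longrightarrow> c \<le> m" "0 \<le> k" "0 \<le> U" "0 \<le> N"
  shows "k * (((k * c - b / 2) * v\<^sup>2 - k * g\<^sup>2 / c) * U\<^sup>2 - v\<^sup>2 / (2 * b) * s\<^sup>2)
    \<le> m * v\<^sup>2 * N\<^sup>2 + m * k\<^sup>2 * v\<^sup>2 * U\<^sup>2 - k * v\<^sup>2 * U * s - 2 * k * v * U * (((m - c) * v + g) * N)"
proof -
  have 1: "v\<^sup>2 * (U * s) \<le> v\<^sup>2 * (b / 2 * U\<^sup>2 + s\<^sup>2 / (2 * b))"
  proof (rule mult_left_mono)
    have "0 \<le> (b * U - s)\<^sup>2 / (2 * b)" using \<open>0 < b\<close> by simp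
    also have "\<dots> = b / 2 * U\<^sup>2 + s\<^sup>2 / (2 * b) - U * s"
      using \<open>0 < b\<close> by (simp add: power2_eq_square field_simps)
    finally show "U * s \<le> b / 2 * U\<^sup>2 + s\<^sup>2 / (2 * b)" by simp
  qed simp
  have 2: "2 * k * v * U * ((m - c) * v * N) \<le> (m - c) * v\<^sup>2 * (k\<^sup>2 * U\<^sup>2 + N\<^sup>2)"
  proof (cases "v = 0")
    case False
    then have "0 \<le> (m - c) * v\<^sup>2 * (k * U - N)\<^sup>2" using assms by simp
    then show ?thesis by (simp add: power2_eq_square algebra_simps)
  qed simp
  have 3: "2 * k * v * U * (g * N) \<le> c * v\<^sup>2 * N\<^sup>2 + k\<^sup>2 * g\<^sup>2 * U\<^sup>2 / c"
  proof -
    have "0 \<le> (c * v * N - k * g * U)\<^sup>2 / c" using \<open>0 < c\<close> by simp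
    also have "\<dots> = c * v\<^sup>2 * N\<^sup>2 + k\<^sup>2 * g\<^sup>2 * U\<^sup>2 / c - 2 * k * v * U * (g * N)"
      using \<open>0 < c\<close> by (simp add: power2_eq_square field_simps)
    finally show ?thesis by simp
  qed
  have "k * (v\<^sup>2 * (U * s)) \<le> k * (v\<^sup>2 * (b / 2 * U\<^sup>2 + s\<^sup>2 / (2 * b)))"
    using 1 \<open>0 \<le> k\<close> by (rule mult_left_mono)
  then show ?thesis using 2 3 by (simp add: algebra_simps power2_eq_square)
qed

text \<open>The sum on the right is the divergence of the vector field \<open>v\<^sup>2 cnj u \<nabla>u\<close>, whose integral vanishes. The multiplier
  \<open>\<i> cnj k\<close> is the one for which \<open>Re (\<i> cnj k) = Im k\<close> and \<open>Re (\<i> cnj k k\<^sup>2) = - |k|\<^sup>2 Im k\<close>, so the gradient term and the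
  term of order zero enter with the same sign and with the weights \<open>1\<close> and \<open>|k|\<^sup>2\<close> that balance the cross term exactly.\<close>

lemma energy_pointwise:
  fixes k u S :: complex and p pp :: "'i \<Rightarrow> complex" and w :: "'i \<Rightarrow> real"
  assumes "finite I" and S: "S = (\<Sum>i\<in>I. pp i) + k\<^sup>2 * u"
    and w: "L2_set w I \<le> (Im k - c) * v + g"
    and "0 < c" "0 < b" "0 \<le> v" "0 \<le> g" "v \<noteq> 0 \<Longrightarrow> c \<le> Im k"
  shows "cmod k * (((cmod k * c - b / 2) * v\<^sup>2 - cmod k * g\<^sup>2 / c) * (cmod u)\<^sup>2 - v\<^sup>2 / (2 * b) * (cmod S)\<^sup>2)
    \<le> Re (\<i> * cnj k * (\<Sum>i\<in>I. p i * (of_real (v * v) * cnj (p i) + of_real (v * w i + w i * v) * cnj u)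
        + pp i * (of_real (v * v) * cnj u)))"
proof -
  define N where "N = L2_set (\<lambda>i. cmod (p i)) I"
  define Z where "Z = (\<Sum>i\<in>I. of_real (w i) * p i)"
  have N: "0 \<le> N" "N\<^sup>2 = (\<Sum>i\<in>I. (cmod (p i))\<^sup>2)"
    by (simp_all add: N_def L2_set_def sum_nonneg)
  have "cmod Z \<le> (\<Sum>i\<in>I. \<bar>w i\<bar> * \<bar>cmod (p i)\<bar>)"
    unfolding Z_def by (rule order_trans[OF norm_sum]) (simp add: norm_mult)
  also have "\<dots> \<le> L2_set w I * N" unfolding N_def by (rule L2_set_mult_ineq)
  also have "\<dots> \<le> ((Im k - c) * v + g) * N" using w N(1) by (rule mult_right_mono)
  finally have Z: "cmod Z \<le> ((Im k - c) * v + g) * N" .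
  have "(\<Sum>i\<in>I. p i * (of_real (v * v) * cnj (p i) + of_real (v * w i + w i * v) * cnj u)
        + pp i * (of_real (v * v) * cnj u))
      = (\<Sum>i\<in>I. of_real (v\<^sup>2) * (p i * cnj (p i))) + (\<Sum>i\<in>I. of_real (2 * v) * cnj u * (of_real (w i) * p i))
        + (\<Sum>i\<in>I. of_real (v\<^sup>2) * cnj u * pp i)"
    by (simp add: sum.distrib[symmetric] algebra_simps power2_eq_square)
  also have "\<dots> = of_real (v\<^sup>2 * N\<^sup>2) + of_real (2 * v) * cnj u * Z + of_real (v\<^sup>2) * cnj u * (S - k\<^sup>2 * u)"
    by (simp add: sum_distrib_left[symmetric] N(2) Z_def S complex_norm_square[symmetric] del: of_real_power)
  finally have sum: "(\<Sum>i\<in>I. p i * (of_real (v * v) * cnj (p i) + of_real (v * w i + w i * v) * cnj u)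
        + pp i * (of_real (v * v) * cnj u))
      = of_real (v\<^sup>2 * N\<^sup>2) + of_real (2 * v) * cnj u * Z + of_real (v\<^sup>2) * cnj u * (S - k\<^sup>2 * u)" .
  have eq: "\<i> * cnj k * (\<Sum>i\<in>I. p i * (of_real (v * v) * cnj (p i) + of_real (v * w i + w i * v) * cnj u)
        + pp i * (of_real (v * v) * cnj u))
      = \<i> * cnj k * of_real (v\<^sup>2 * N\<^sup>2) + of_real (2 * v) * (\<i> * cnj k * cnj u * Z)
        + of_real (v\<^sup>2) * (\<i> * cnj k * cnj u * S) - of_real (v\<^sup>2) * (\<i> * (k * cnj k) * k * (u * cnj u))"
  proof -
    have g: "a * (X + Y * cu * Z + W * cu * (S - k\<^sup>2 * u))
        = a * X + Y * (a * cu * Z) + W * (a * cu * S) - W * (a * k\<^sup>2 * (u * cu))" for a X Y W cu :: complex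
      by (simp add: algebra_simps)
    have h: "\<i> * cnj k * k\<^sup>2 = \<i> * (k * cnj k) * k" by (simp add: power2_eq_square)
    show ?thesis unfolding sum g h by (rule refl)
  qed
  have r1: "Re (\<i> * cnj k * of_real (v\<^sup>2 * N\<^sup>2)) = Im k * v\<^sup>2 * N\<^sup>2" by simp
  have r2: "- (2 * cmod k * v * cmod u * (((Im k - c) * v + g) * N)) \<le> Re (of_real (2 * v) * (\<i> * cnj k * cnj u * Z))"
  proof -
    have "- Re (of_real (2 * v) * (\<i> * cnj k * cnj u * Z)) \<le> cmod (of_real (2 * v) * (\<i> * cnj k * cnj u * Z))"
      using abs_Re_le_cmod by (metis abs_ge_minus_self order_trans)
    also have "\<dots> = 2 * v * cmod k * cmod u * cmod Z" using \<open>0 \<le> v\<close> by (simp add: norm_mult)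
    also have "\<dots> \<le> 2 * v * cmod k * cmod u * (((Im k - c) * v + g) * N)"
      using Z \<open>0 \<le> v\<close> by (intro mult_left_mono) auto
    finally show ?thesis by (simp add: algebra_simps)
  qed
  have r3: "- (cmod k * v\<^sup>2 * cmod u * cmod S) \<le> Re (of_real (v\<^sup>2) * (\<i> * cnj k * cnj u * S))"
  proof -
    have "- Re (of_real (v\<^sup>2) * (\<i> * cnj k * cnj u * S)) \<le> cmod (of_real (v\<^sup>2) * (\<i> * cnj k * cnj u * S))"
      using abs_Re_le_cmod by (metis abs_ge_minus_self order_trans)
    also have "\<dots> = cmod k * v\<^sup>2 * cmod u * cmod S" by (simp add: norm_mult norm_power)
    finally show ?thesis by simp
  qed
  have r4: "Re (of_real (v\<^sup>2) * (\<i> * (k * cnj k) * k * (u * cnj u))) = - (Im k * (cmod k)\<^sup>2 * v\<^sup>2 * (cmod u)\<^sup>2)"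
    by (simp add: complex_norm_square[symmetric] del: of_real_power)
  show ?thesis
    using energy_real_inequality[OF assms(4-8) norm_ge_zero norm_ge_zero N(1), of k u "cmod S"] r1 r2 r3 r4
    unfolding eq plus_complex.sel minus_complex.sel by linarith
qed

text \<open>In the applications \<open>c\<close> is the distance of the logarithmic slope of \<open>v\<close> from the critical rate \<open>Im k\<close>,
  \<open>g\<close> is the contribution of cut-offs, and \<open>\<beta>\<close> is a bound for the potential that splits the product \<open>u S\<close>.\<close>

theorem energy_inequality:
  fixes u S :: "'a::euclidean_space \<Rightarrow> complex"
  assumes u: "\<And>b. b \<in> Basis \<Longrightarrow> C1_along b u (p b)"
    and p: "\<And>b. b \<in> Basis \<Longrightarrow> C1_along b (p b) (pp b)"
    and S: "\<And>x. S x = (\<Sum>b\<in>Basis. pp b x) + k\<^sup>2 * u x"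
    and v: "\<And>b. b \<in> Basis \<Longrightarrow> C1_along b v (w b)" "\<And>x. 0 \<le> v x" "\<And>x. M < norm x \<Longrightarrow> v x = 0"
    and g: "continuous_on UNIV g" "\<And>x. 0 \<le> g x" "\<And>x. M < norm x \<Longrightarrow> g x = 0"
    and c: "continuous_on UNIV c" "\<And>x. 0 < c x" and \<beta>: "continuous_on UNIV \<beta>" "\<And>x. 0 < \<beta> x"
    and le: "\<And>x. v x \<noteq> 0 \<Longrightarrow> c x \<le> Im k"
    and grad: "\<And>x. L2_set (\<lambda>b. w b x) Basis \<le> (Im k - c x) * v x + g x"
    and "k \<noteq> 0"
  shows "(LINT x|lborel. ((cmod k * c x - \<beta> x / 2) * (v x)\<^sup>2 - cmod k * (g x)\<^sup>2 / c x) * (cmod (u x))\<^sup>2)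
    \<le> (LINT x|lborel. (v x)\<^sup>2 / (2 * \<beta> x) * (cmod (S x))\<^sup>2)"
proof -
  define G' where "G' b x = p b x * (of_real (v x * v x) * cnj (p b x) + of_real (v x * w b x + w b x * v x) * cnj (u x))
        + pp b x * (of_real (v x * v x) * cnj (u x))" for b x
  have G: "C1_along b (\<lambda>x. p b x * (of_real (v x * v x) * cnj (u x))) (G' b)" if "b \<in> Basis" for b
    unfolding G'_def
    by (intro C1_along_mult[OF p] C1_along_mult C1_along_bounded_linear[OF _ bounded_linear_of_real]
        C1_along_bounded_linear[OF _ bounded_linear_cnj] u v that)
  have iG: "integrable lborel (G' b)" "(LINT x|lborel. G' b x) = 0" if "b \<in> Basis" for b
  proof -
    have z: "\<And>x. M < norm x \<Longrightarrow> p b x * (of_real (v x * v x) * cnj (u x)) = 0" using v(3) by simp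
    show "(LINT x|lborel. G' b x) = 0" by (rule integral_C1_along_eq_0[OF G[OF that] z])
    have "continuous_on UNIV (G' b)" using G[OF that] by (simp add: C1_along_def)
    then show "integrable lborel (G' b)"
      by (rule integrable_continuous_vanish) (rule C1_along_vanish[OF G[OF that] z])
  qed
  obtain b0 :: 'a where b0: "b0 \<in> Basis" using nonempty_Basis by blast
  have cu: "continuous_on UNIV u" and cv: "continuous_on UNIV v" using u[OF b0] v(1)[OF b0] by (auto simp: C1_along_def)
  have cS: "continuous_on UNIV S"
    unfolding S[abs_def] using p cu by (intro continuous_intros) (auto simp: C1_along_def)
  define L where "L x = ((cmod k * c x - \<beta> x / 2) * (v x)\<^sup>2 - cmod k * (g x)\<^sup>2 / c x) * (cmod (u x))\<^sup>2" for x
  define R where "R x = (v x)\<^sup>2 / (2 * \<beta> x) * (cmod (S x))\<^sup>2" for x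
  have nz: "c x \<noteq> 0" "2 * \<beta> x \<noteq> 0" for x using c(2)[of x] \<beta>(2)[of x] by auto
  have iL: "integrable lborel L"
  proof (rule integrable_continuous_vanish)
    show "continuous_on UNIV L" unfolding L_def[abs_def] using c(1) \<beta>(1) g(1) cu cv nz by (intro continuous_intros) auto
    show "M < norm x \<Longrightarrow> L x = 0" for x using v(3) g(3) by (simp add: L_def)
  qed
  have iR: "integrable lborel R"
  proof (rule integrable_continuous_vanish)
    show "continuous_on UNIV R" unfolding R_def[abs_def] using \<beta>(1) cS cv nz by (intro continuous_intros) auto
    show "M < norm x \<Longrightarrow> R x = 0" for x using v(3) by (simp add: R_def)
  qed
  have "(LINT x|lborel. cmod k * (L x - R x)) \<le> (LINT x|lborel. Re (\<i> * cnj k * (\<Sum>b\<in>Basis. G' b x)))"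
  proof (rule integral_mono)
    show "cmod k * (L x - R x) \<le> Re (\<i> * cnj k * (\<Sum>b\<in>Basis. G' b x))" for x
      unfolding L_def R_def G'_def
      by (rule energy_pointwise) (use S grad c \<beta> v g le in auto)
    show "integrable lborel (\<lambda>x. cmod k * (L x - R x))" using iL iR by simp
    show "integrable lborel (\<lambda>x. Re (\<i> * cnj k * (\<Sum>b\<in>Basis. G' b x)))"
      using iG by (intro integrable_Re integrable_mult_right Bochner_Integration.integrable_sum) auto
  qed
  also have "\<dots> = Re (LINT x|lborel. \<i> * cnj k * (\<Sum>b\<in>Basis. G' b x))"
    using iG by (intro integral_Re integrable_mult_right Bochner_Integration.integrable_sum) auto
  also have "\<dots> = 0" using iG by (simp add: Bochner_Integration.integral_sum)
  finally have "cmod k * ((LINT x|lborel. L x) - (LINT x|lborel. R x)) \<le> 0" using iL iR by simp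
  then have "(LINT x|lborel. L x) - (LINT x|lborel. R x) \<le> 0" using \<open>k \<noteq> 0\<close> by (simp add: mult_le_0_iff)
  then show ?thesis by (simp add: L_def R_def)
qed

section \<open>The energy inequality for weak solutions\<close>

text \<open>The equation \<open>\<Delta>u + k\<^sup>2 u = F\<close> in the sense of distributions. Keeping the right-hand side abstract separates
  the analysis from the potential, which need not be measurable.\<close>

definition weak_solution :: "complex \<Rightarrow> ('a::euclidean_space \<Rightarrow> complex) \<Rightarrow> ('a \<Rightarrow> complex) \<Rightarrow> bool" where
  "weak_solution k F u \<longleftrightarrow> (\<forall>\<psi>. test_function \<psi> \<longrightarrow>
     (LINT x|lborel. u x * (laplacian \<psi> x + k\<^sup>2 * \<psi> x)) = (LINT x|lborel. F x * \<psi> x))"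

definition L2_loc :: "('a::euclidean_space \<Rightarrow> complex) \<Rightarrow> bool" where
  "L2_loc u \<longleftrightarrow> (\<forall>M. L2 (\<lambda>x. indicator (cball 0 M) x *\<^sub>R u x))"

lemma smooth_mollifier_derivatives:
  assumes K: "mollifier K d" "smooth K" and b: "b \<in> Basis"
  shows "C1_along b K (partial_deriv b K)"
    and "C1_along b (partial_deriv b K) (partial_deriv b (partial_deriv b K))"
    and "d < norm x \<Longrightarrow> partial_deriv b K x = 0"
    and "d < norm x \<Longrightarrow> partial_deriv b (partial_deriv b K) x = 0"
proof -
  interpret mollifier K d by fact
  have C: "Ck k K" for k using K(2) by (simp add: smooth_def)
  show 1: "C1_along b K (partial_deriv b K)" using C b by (rule Ck_imp_C1_along)
  show 2: "C1_along b (partial_deriv b K) (partial_deriv b (partial_deriv b K))"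
    using C[of "Suc (Suc 0)"] b by (intro Ck_imp_C1_along[where k = 0]) auto
  show 3: "d < norm x \<Longrightarrow> partial_deriv b K x = 0" for x
    by (rule C1_along_vanish[OF 1 vanish])
  show "d < norm x \<Longrightarrow> partial_deriv b (partial_deriv b K) x = 0"
    by (rule C1_along_vanish[OF 2 3])
qed

text \<open>Testing with the reflected kernel \<open>y \<mapsto> K(x - y)\<close> shows that mollification commutes with the equation.\<close>

lemma weak_solution_mollified:
  fixes u :: "'a::euclidean_space \<Rightarrow> complex"
  assumes K: "mollifier K d" "smooth K" and u: "loc_int u" and F: "loc_int F" and sol: "weak_solution k F u"
  shows "(\<Sum>b\<in>Basis. conv (partial_deriv b (partial_deriv b K)) u x) + k\<^sup>2 * conv K u x = conv K F x"
proof -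
  interpret mollifier K d by fact
  note D = smooth_mollifier_derivatives[OF K]
  have i: "integrable lborel (\<lambda>y. partial_deriv b (partial_deriv b K) (x - y) *\<^sub>R u y)" if "b \<in> Basis" for b
    by (rule integrable_conv[OF u _ D(4)[OF that]]) (use D(2)[OF that] in \<open>auto simp: C1_along_def\<close>)
  have iK: "integrable lborel (\<lambda>y. K (x - y) *\<^sub>R u y)" by (rule integrable_conv[OF u cont vanish])
  have "(\<Sum>b\<in>Basis. conv (partial_deriv b (partial_deriv b K)) u x) + k\<^sup>2 * conv K u x
      = (LINT y|lborel. (\<Sum>b\<in>Basis. partial_deriv b (partial_deriv b K) (x - y) *\<^sub>R u y) + k\<^sup>2 * (K (x - y) *\<^sub>R u y))"
  proof -
    have "integrable lborel (\<lambda>y. k\<^sup>2 * (K (x - y) *\<^sub>R u y))" using iK by (rule integrable_mult_right)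
    moreover have "integrable lborel (\<lambda>y. \<Sum>b\<in>Basis. partial_deriv b (partial_deriv b K) (x - y) *\<^sub>R u y)"
      using i by (rule Bochner_Integration.integrable_sum)
    moreover have "(LINT y|lborel. k\<^sup>2 * (K (x - y) *\<^sub>R u y)) = k\<^sup>2 * conv K u x"
      unfolding conv_def
      by (rule Bochner_Integration.integral_mult_right) (rule iK)
    moreover have "(LINT y|lborel. (\<Sum>b\<in>Basis. partial_deriv b (partial_deriv b K) (x - y) *\<^sub>R u y))
        = (\<Sum>b\<in>Basis. conv (partial_deriv b (partial_deriv b K)) u x)"
      unfolding conv_def using i by (rule Bochner_Integration.integral_sum)
    ultimately show ?thesis by (simp only: Bochner_Integration.integral_add)
  qed
  also have "\<dots> = (LINT y|lborel. u y * (laplacian (\<lambda>y. complex_of_real (K (x - y))) y + k\<^sup>2 * complex_of_real (K (x - y))))"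
  proof (rule Bochner_Integration.integral_cong)
    fix y
    show "(\<Sum>b\<in>Basis. partial_deriv b (partial_deriv b K) (x - y) *\<^sub>R u y) + k\<^sup>2 * (K (x - y) *\<^sub>R u y)
        = u y * (laplacian (\<lambda>y. complex_of_real (K (x - y))) y + k\<^sup>2 * complex_of_real (K (x - y)))"
      using K(2) by (subst laplacian_reflected)
        (auto simp: smooth_def laplacian_def scaleR_sum_left[symmetric] scaleR_conv_of_real algebra_simps sum_distrib_left)
  qed simp
  also have "\<dots> = (LINT y|lborel. F y * complex_of_real (K (x - y)))"
    using sol test_function_reflected[OF K(2) vanish] by (simp add: weak_solution_def)
  also have "\<dots> = conv K F x" by (simp add: conv_def scaleR_conv_of_real mult.commute)
  finally show ?thesis .
qed

lemma conv_cong: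
  assumes "mollifier K d" and "\<And>y. norm (x - y) \<le> d \<Longrightarrow> u y = u' y"
  shows "conv K u x = conv K u' x"
proof -
  interpret mollifier K d by fact
  have "K (x - y) *\<^sub>R u y = K (x - y) *\<^sub>R u' y" for y
    using assms(2)[of y] vanish[of "x - y"] by (cases "norm (x - y) \<le> d") auto
  then show ?thesis unfolding conv_def by (intro Bochner_Integration.integral_cong refl)
qed

lemma mollifier_mono: "mollifier K d \<Longrightarrow> d \<le> d' \<Longrightarrow> mollifier K d'"
  by (auto simp: mollifier_def)

text \<open>The bound on \<open>F\<close> is only available for \<open>|x| > r0\<close>, and the weight lives in \<open>|x| \<ge> r1 > r0\<close>: the gap leaves room
  for mollification. Since \<open>v\<close> and \<open>g\<close> vanish outside a ball, \<open>u\<close> and \<open>F\<close> may be replaced by their truncations \<open>U\<close> and \<open>W\<close>,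
  which are globally square integrable.\<close>

theorem weak_solution_energy_inequality:
  fixes u F :: "'a::euclidean_space \<Rightarrow> complex"
  assumes chi: "cutoff chi"
    and u: "loc_int u" "L2_loc u" and F: "loc_int F" and sol: "weak_solution k F u"
    and dom: "AE x in lborel. r0 < norm x \<longrightarrow> cmod (F x) \<le> \<beta> x * cmod (u x)"
    and v: "\<And>b. b \<in> Basis \<Longrightarrow> C1_along b v (w b)" "\<And>x. 0 \<le> v x" "\<And>x. M < norm x \<Longrightarrow> v x = 0"
    and v0: "\<And>x. norm x < r1 \<Longrightarrow> v x = 0" "\<And>x. norm x < r1 \<Longrightarrow> g x = 0" and r: "r0 < r1"
    and g: "continuous_on UNIV g" "\<And>x. 0 \<le> g x" "\<And>x. M < norm x \<Longrightarrow> g x = 0"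
    and c: "continuous_on UNIV c" "\<And>x. 0 < c x" and \<beta>: "continuous_on UNIV \<beta>" "\<And>x. 0 < \<beta> x"
    and le: "\<And>x. v x \<noteq> 0 \<Longrightarrow> c x \<le> Im k"
    and grad: "\<And>x. L2_set (\<lambda>b. w b x) Basis \<le> (Im k - c x) * v x + g x"
    and "k \<noteq> 0"
  shows "integrable lborel (\<lambda>x. (cmod k * c x - \<beta> x) * (v x)\<^sup>2 * (cmod (u x))\<^sup>2)"
    and "integrable lborel (\<lambda>x. (g x)\<^sup>2 / c x * (cmod (u x))\<^sup>2)"
    and "(LINT x|lborel. (cmod k * c x - \<beta> x) * (v x)\<^sup>2 * (cmod (u x))\<^sup>2)
      \<le> cmod k * (LINT x|lborel. (g x)\<^sup>2 / c x * (cmod (u x))\<^sup>2)"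
proof -
  obtain b0 :: 'a where b0: "b0 \<in> Basis" using nonempty_Basis by blast
  have cv: "continuous_on UNIV v" using v(1)[OF b0] by (auto simp: C1_along_def)
  have nz: "c x \<noteq> 0" "\<beta> x \<noteq> 0" for x using c(2)[of x] \<beta>(2)[of x] by auto
  have [measurable]: "u \<in> borel_measurable borel" "F \<in> borel_measurable borel" using u F by (auto simp: loc_int_def)
  define U where "U x = indicator (cball 0 (M + 1)) x *\<^sub>R u x" for x
  define W where "W x = indicator {x. r0 < norm x \<and> norm x \<le> M + 1} x *\<^sub>R F x" for x
  have U: "L2 U" using u(2) unfolding U_def L2_loc_def by blast
  have [measurable]: "U \<in> borel_measurable borel" using U by (simp add: L2_def)
  have mW[measurable]: "W \<in> borel_measurable borel" unfolding W_def by measurable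
  have dom': "AE x in lborel. cmod (W x) \<le> \<beta> x * cmod (U x)"
    using dom
  proof eventually_elim
    case (elim x)
    then show ?case using \<beta>(2)[of x] by (auto simp: W_def U_def indicator_def)
  qed
  have W: "L2 W"
  proof -
    have "compact (\<beta> ` cball 0 (M + 1))"
      using \<beta>(1) by (intro compact_continuous_image) (auto intro: continuous_on_subset)
    then have "bounded (\<beta> ` cball 0 (M + 1))" by (rule compact_imp_bounded)
    then obtain B where B: "\<forall>x\<in>cball 0 (M + 1). norm (\<beta> x) \<le> B" unfolding bounded_iff by blast
    have "integrable lborel (\<lambda>x. (cmod (W x))\<^sup>2)"
    proof (rule Bochner_Integration.integrable_bound)
      show "integrable lborel (\<lambda>x. B\<^sup>2 * (cmod (U x))\<^sup>2)" using U by (simp add: L2_def)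
      show "AE x in lborel. norm ((cmod (W x))\<^sup>2) \<le> norm (B\<^sup>2 * (cmod (U x))\<^sup>2)"
        using dom'
      proof eventually_elim
        case (elim x)
        have "\<beta> x * cmod (U x) \<le> B * cmod (U x)"
          using B by (cases "norm x \<le> M + 1") (auto simp: U_def abs_le_iff intro!: mult_right_mono)
        then have "cmod (W x) \<le> B * cmod (U x)" using elim by simp
        then have "(cmod (W x))\<^sup>2 \<le> (B * cmod (U x))\<^sup>2" by (intro power_mono) auto
        then show ?case by (simp add: power_mult_distrib)
      qed
    qed measurable
    then show ?thesis using mW by (simp add: L2_def)
  qed
  define a1 where "a1 x = (cmod k * c x - \<beta> x / 2) * (v x)\<^sup>2 - cmod k * (g x)\<^sup>2 / c x" for x
  define a2 where "a2 x = (v x)\<^sup>2 / (2 * \<beta> x)" for x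
  have ca: "continuous_on UNIV a1" "continuous_on UNIV a2"
    unfolding a1_def[abs_def] a2_def[abs_def] using c(1) \<beta>(1) g(1) cv nz by (auto intro!: continuous_intros)
  then have ma: "a1 \<in> borel_measurable borel" "a2 \<in> borel_measurable borel"
    by (auto intro: borel_measurable_continuous_onI)
  have za: "a1 x = 0" "a2 x = 0" if "M < norm x" for x using that v(3) g(3) by (auto simp: a1_def a2_def)
  have zi: "a2 x = 0" if "norm x < r1" for x using that v0 by (auto simp: a2_def)
  obtain A1 A2 where A: "\<And>x. \<bar>a1 x\<bar> \<le> A1" "\<And>x. \<bar>a2 x\<bar> \<le> A2"
    using continuous_vanish_imp_bounded[OF ca(1) za(1)] continuous_vanish_imp_bounded[OF ca(2) za(2)]
    by (metis real_norm_def)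
  have lim: "(LINT x|lborel. a1 x * (cmod (U x))\<^sup>2) \<le> (LINT x|lborel. a2 x * (cmod (W x))\<^sup>2)"
  proof (rule field_le_epsilon)
    fix e :: real assume "0 < e"
    then have e: "0 < e / 2" by simp
    obtain d1 where d1: "0 < d1"
      "\<And>K. mollifier K d1 \<Longrightarrow> \<bar>(LINT x|lborel. a1 x * (cmod (conv K U x))\<^sup>2) - (LINT x|lborel. a1 x * (cmod (U x))\<^sup>2)\<bar> \<le> e / 2"
      using mollifier_weighted_square[OF U ma(1) A(1) e] by blast
    obtain d2 where d2: "0 < d2"
      "\<And>K. mollifier K d2 \<Longrightarrow> \<bar>(LINT x|lborel. a2 x * (cmod (conv K W x))\<^sup>2) - (LINT x|lborel. a2 x * (cmod (W x))\<^sup>2)\<bar> \<le> e / 2"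
      using mollifier_weighted_square[OF W ma(2) A(2) e] by blast
    define d where "d = min (min d1 d2) (min 1 ((r1 - r0) / 2))"
    have "d \<le> (r1 - r0) / 2" unfolding d_def by (meson min.cobounded2 order_trans)
    moreover have "0 < d" "d \<le> d1" "d \<le> d2" "d \<le> 1" using d1 d2 r by (auto simp: d_def)
    ultimately have d: "0 < d" "d \<le> d1" "d \<le> d2" "d \<le> 1" "d \<le> (r1 - r0) / 2" by blast+
    obtain K :: "'a \<Rightarrow> real" where K: "mollifier K d" "smooth K"
      using smooth_mollifier_exists[OF chi d(1)] by blast
    interpret mollifier K d by fact
    note D = smooth_mollifier_derivatives[OF K]
    have "(LINT x|lborel. ((cmod k * c x - \<beta> x / 2) * (v x)\<^sup>2 - cmod k * (g x)\<^sup>2 / c x) * (cmod (conv K u x))\<^sup>2)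
        \<le> (LINT x|lborel. (v x)\<^sup>2 / (2 * \<beta> x) * (cmod (conv K F x))\<^sup>2)"
    proof (rule energy_inequality)
      show "C1_along b (conv K u) (conv (partial_deriv b K) u)" if "b \<in> Basis" for b
        by (rule C1_along_conv[OF u(1) D(1)[OF that] vanish])
      show "C1_along b (conv (partial_deriv b K) u) (conv (partial_deriv b (partial_deriv b K)) u)" if "b \<in> Basis" for b
        by (rule C1_along_conv[OF u(1) D(2)[OF that] D(3)[OF that]])
      show "conv K F x = (\<Sum>b\<in>Basis. conv (partial_deriv b (partial_deriv b K)) u x) + k\<^sup>2 * conv K u x" for x
        by (rule weak_solution_mollified[OF K u(1) F sol, symmetric])
    qed fact+
    also have "(LINT x|lborel. ((cmod k * c x - \<beta> x / 2) * (v x)\<^sup>2 - cmod k * (g x)\<^sup>2 / c x) * (cmod (conv K u x))\<^sup>2)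
        = (LINT x|lborel. a1 x * (cmod (conv K U x))\<^sup>2)"
    proof (intro Bochner_Integration.integral_cong refl)
      fix x
      have "conv K u x = conv K U x" if "norm x \<le> M"
      proof (rule conv_cong[OF K(1)])
        fix y assume "norm (x - y) \<le> d"
        then have "norm y \<le> M + 1" using that d(4) norm_triangle_ineq2[of y x] by (simp add: norm_minus_commute)
        then show "u y = U y" by (simp add: U_def)
      qed
      then show "((cmod k * c x - \<beta> x / 2) * (v x)\<^sup>2 - cmod k * (g x)\<^sup>2 / c x) * (cmod (conv K u x))\<^sup>2
          = a1 x * (cmod (conv K U x))\<^sup>2"
        using za(1)[of x] by (cases "norm x \<le> M") (auto simp: a1_def)
    qed
    also have "(LINT x|lborel. (v x)\<^sup>2 / (2 * \<beta> x) * (cmod (conv K F x))\<^sup>2) = (LINT x|lborel. a2 x * (cmod (conv K W x))\<^sup>2)"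
    proof (intro Bochner_Integration.integral_cong refl)
      fix x
      have "conv K F x = conv K W x" if "norm x \<le> M" "r1 \<le> norm x"
      proof (rule conv_cong[OF K(1)])
        fix y assume "norm (x - y) \<le> d"
        then have "norm y \<le> M + 1" "r0 < norm y"
          using that d r norm_triangle_ineq2[of y x] norm_triangle_ineq2[of x y]
          by (auto simp: norm_minus_commute)
        then show "F y = W y" by (simp add: W_def)
      qed
      then show "(v x)\<^sup>2 / (2 * \<beta> x) * (cmod (conv K F x))\<^sup>2 = a2 x * (cmod (conv K W x))\<^sup>2"
        using za(2)[of x] zi[of x] by (cases "norm x \<le> M \<and> r1 \<le> norm x") (auto simp: a2_def)
    qed
    finally show "(LINT x|lborel. a1 x * (cmod (U x))\<^sup>2) \<le> (LINT x|lborel. a2 x * (cmod (W x))\<^sup>2) + e"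
      using d1(2)[OF mollifier_mono[OF K(1) d(2)]] d2(2)[OF mollifier_mono[OF K(1) d(3)]] unfolding abs_le_iff by linarith
  qed
  have int: "integrable lborel (\<lambda>x. a x * (cmod (U x))\<^sup>2)"
    if a: "continuous_on UNIV a" "\<And>x. M < norm x \<Longrightarrow> a x = 0" for a
  proof -
    obtain A where A: "\<And>x. \<bar>a x\<bar> \<le> A" using continuous_vanish_imp_bounded[OF a] by (metis real_norm_def)
    show ?thesis
      by (rule integral_weighted_square_diff_le(1)[OF U _ _ A, where h = 1 and Y = U])
         (use a(1) in \<open>auto simp: L2_def intro: borel_measurable_continuous_onI\<close>)
  qed
  have i1: "integrable lborel (\<lambda>x. (cmod k * c x - \<beta> x) * (v x)\<^sup>2 * (cmod (U x))\<^sup>2)"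
    and i2: "integrable lborel (\<lambda>x. (g x)\<^sup>2 / c x * (cmod (U x))\<^sup>2)"
    and i3: "integrable lborel (\<lambda>x. \<beta> x / 2 * (v x)\<^sup>2 * (cmod (U x))\<^sup>2)"
    using c(1) \<beta>(1) g(1) cv nz v(3) g(3) by (intro int continuous_intros; simp)+
  have eq1: "(cmod k * c x - \<beta> x) * (v x)\<^sup>2 * (cmod (U x))\<^sup>2 = (cmod k * c x - \<beta> x) * (v x)\<^sup>2 * (cmod (u x))\<^sup>2"
    and eq2: "(g x)\<^sup>2 / c x * (cmod (U x))\<^sup>2 = (g x)\<^sup>2 / c x * (cmod (u x))\<^sup>2" for x
    using v(3)[of x] g(3)[of x] by (auto simp: U_def indicator_def)
  show "integrable lborel (\<lambda>x. (cmod k * c x - \<beta> x) * (v x)\<^sup>2 * (cmod (u x))\<^sup>2)"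
    "integrable lborel (\<lambda>x. (g x)\<^sup>2 / c x * (cmod (u x))\<^sup>2)" using i1 i2 by (simp_all only: eq1 eq2)
  have "(LINT x|lborel. a2 x * (cmod (W x))\<^sup>2) \<le> (LINT x|lborel. \<beta> x / 2 * (v x)\<^sup>2 * (cmod (U x))\<^sup>2)"
  proof (rule integral_mono_AE)
    show "integrable lborel (\<lambda>x. a2 x * (cmod (W x))\<^sup>2)"
      by (rule integral_weighted_square_diff_le(1)[OF W _ ma(2) A(2), where h = 1 and Y = W]) (auto simp: L2_def)
    show "AE x in lborel. a2 x * (cmod (W x))\<^sup>2 \<le> \<beta> x / 2 * (v x)\<^sup>2 * (cmod (U x))\<^sup>2"
      using dom'
    proof eventually_elim
      case (elim x)
      then have "(cmod (W x))\<^sup>2 \<le> (\<beta> x * cmod (U x))\<^sup>2" by (intro power_mono) auto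
      then have "a2 x * (cmod (W x))\<^sup>2 \<le> a2 x * (\<beta> x * cmod (U x))\<^sup>2"
        using \<beta>(2)[of x] by (intro mult_left_mono) (auto simp: a2_def)
      also have "\<dots> = \<beta> x / 2 * (v x)\<^sup>2 * (cmod (U x))\<^sup>2"
        using nz(2)[of x] by (simp add: a2_def power2_eq_square field_simps)
      finally show ?case .
    qed
  qed (rule i3)
  with lim have "(LINT x|lborel. a1 x * (cmod (U x))\<^sup>2) \<le> (LINT x|lborel. \<beta> x / 2 * (v x)\<^sup>2 * (cmod (U x))\<^sup>2)"
    by simp
  moreover have "(LINT x|lborel. a1 x * (cmod (U x))\<^sup>2) = (LINT x|lborel. (cmod k * c x - \<beta> x) * (v x)\<^sup>2 * (cmod (U x))\<^sup>2
      + \<beta> x / 2 * (v x)\<^sup>2 * (cmod (U x))\<^sup>2 - cmod k * ((g x)\<^sup>2 / c x * (cmod (U x))\<^sup>2))"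
    by (intro Bochner_Integration.integral_cong refl) (simp add: a1_def algebra_simps)
  moreover have "\<dots> = (LINT x|lborel. (cmod k * c x - \<beta> x) * (v x)\<^sup>2 * (cmod (U x))\<^sup>2)
      + (LINT x|lborel. \<beta> x / 2 * (v x)\<^sup>2 * (cmod (U x))\<^sup>2) - cmod k * (LINT x|lborel. (g x)\<^sup>2 / c x * (cmod (U x))\<^sup>2)"
  proof -
    have i4: "integrable lborel (\<lambda>x. cmod k * ((g x)\<^sup>2 / c x * (cmod (U x))\<^sup>2))"
      using i2 by (rule integrable_mult_right)
    have e4: "(LINT x|lborel. cmod k * ((g x)\<^sup>2 / c x * (cmod (U x))\<^sup>2))
        = cmod k * (LINT x|lborel. (g x)\<^sup>2 / c x * (cmod (U x))\<^sup>2)"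
      by (rule Bochner_Integration.integral_mult_right) (rule i2)
    show ?thesis
      unfolding Bochner_Integration.integral_diff[OF Bochner_Integration.integrable_add[OF i1 i3] i4]
        Bochner_Integration.integral_add[OF i1 i3] e4 by (rule refl)
  qed
  ultimately show "(LINT x|lborel. (cmod k * c x - \<beta> x) * (v x)\<^sup>2 * (cmod (u x))\<^sup>2)
      \<le> cmod k * (LINT x|lborel. (g x)\<^sup>2 / c x * (cmod (u x))\<^sup>2)"
    by (simp only: eq1 eq2)
qed

section \<open>Radial weights\<close>

text \<open>The denominator \<open>max 1 |x|\<close> equals \<open>|x|\<close> wherever the profile is not constantly zero, and it keeps the expression
  continuous at the origin, where the norm is not differentiable.\<close>

lemma C1_along_radial:
  fixes om om' :: "real \<Rightarrow> real" and b :: "'a::euclidean_space"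
  assumes der: "\<And>r. (om has_field_derivative om' r) (at r)" and c: "continuous_on UNIV om'"
    and zero: "\<And>r. r \<le> 1 \<Longrightarrow> om r = 0"
  shows "C1_along b (\<lambda>x::'a. om (norm x)) (\<lambda>x. om' (norm x) * (x \<bullet> b) / max 1 (norm x))"
proof -
  have com: "continuous_on UNIV om"
    using der by (auto intro!: DERIV_isCont continuous_at_imp_continuous_on)
  have zero': "om' r = 0" if "r < 1" for r
  proof -
    have "(om has_field_derivative 0) (at r)"
      by (rule has_field_derivative_transform_within_open[where S = "{..<1}" and f = "\<lambda>_. 0"])
         (use that zero in auto)
    then show ?thesis using der DERIV_unique by blast
  qed
  have "((\<lambda>h. om (norm (x + h *\<^sub>R b))) has_vector_derivative om' (norm x) * (x \<bullet> b) / max 1 (norm x)) (at 0)" for x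
  proof (cases "norm x < 1")
    case True
    have "((\<lambda>h. norm (x + h *\<^sub>R b)) \<longlongrightarrow> norm (x + 0 *\<^sub>R b)) (at 0)" by (intro tendsto_intros)
    then have "\<forall>\<^sub>F h in at 0. norm (x + h *\<^sub>R b) < 1" using True by (intro order_tendstoD) auto
    then have "\<forall>\<^sub>F h in at 0. 0 = om (norm (x + h *\<^sub>R b))" by eventually_elim (simp add: zero)
    then have "((\<lambda>h. om (norm (x + h *\<^sub>R b))) has_vector_derivative 0) (at 0)"
      unfolding has_vector_derivative_def
      by (rule has_derivative_transform_eventually[where f = "\<lambda>_. 0", rotated]) (use True zero in auto)
    then show ?thesis using True zero' by simp
  next
    case False
    then have "x \<noteq> 0" by auto
    have "((\<lambda>h. norm (x + h *\<^sub>R b)) has_derivative (\<lambda>h. (h *\<^sub>R b) \<bullet> sgn (x + 0 *\<^sub>R b))) (at 0)"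
    proof (rule has_derivative_compose[where g = norm])
      show "((\<lambda>h. x + h *\<^sub>R b) has_derivative (\<lambda>h. h *\<^sub>R b)) (at 0)"
        by (auto intro!: derivative_eq_intros)
      show "(norm has_derivative (\<lambda>h. h \<bullet> sgn (x + 0 *\<^sub>R b))) (at (x + 0 *\<^sub>R b))"
        using \<open>x \<noteq> 0\<close> by (intro has_derivative_norm) simp
    qed
    then have "((\<lambda>h. norm (x + h *\<^sub>R b)) has_field_derivative (x \<bullet> b) / norm x) (at 0)"
      unfolding has_field_derivative_def
      by (rule has_derivative_eq_rhs) (simp add: fun_eq_iff sgn_div_norm divide_inverse inner_commute)
    from DERIV_chain2[OF der this]
    have "((\<lambda>h. om (norm (x + h *\<^sub>R b))) has_field_derivative om' (norm x) * ((x \<bullet> b) / norm x)) (at 0)"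
      by simp
    then show ?thesis
      using False by (simp add: has_real_derivative_iff_has_vector_derivative max_def)
  qed
  moreover have "continuous_on UNIV (\<lambda>x. om' (norm x) * (x \<bullet> b) / max 1 (norm x))"
    by (intro continuous_intros continuous_on_compose2[OF c]) auto
  moreover have "continuous_on UNIV (\<lambda>x::'a. om (norm x))"
    by (intro continuous_intros continuous_on_compose2[OF com]) auto
  ultimately show ?thesis by (simp add: C1_along_def)
qed

lemma L2_set_radial_gradient:
  fixes x :: "'a::euclidean_space"
  shows "L2_set (\<lambda>b. d * (x \<bullet> b) / max 1 (norm x)) Basis \<le> \<bar>d\<bar>"
proof -
  have "L2_set (\<lambda>b. (\<bar>d\<bar> / max 1 (norm x)) * (x \<bullet> b)) Basis = \<bar>d\<bar> / max 1 (norm x) * norm x"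
  proof -
    have "norm x = L2_set (\<lambda>b. x \<bullet> b) Basis"
      by (simp add: L2_set_def norm_eq_sqrt_inner euclidean_inner[of x x] power2_eq_square)
    then show ?thesis by (subst L2_set_right_distrib[symmetric]) auto
  qed
  also have "L2_set (\<lambda>b. (\<bar>d\<bar> / max 1 (norm x)) * (x \<bullet> b)) Basis = L2_set (\<lambda>b. d * (x \<bullet> b) / max 1 (norm x)) Basis"
    by (simp add: L2_set_def power_mult_distrib power_divide)
  also have "\<bar>d\<bar> / max 1 (norm x) * norm x \<le> \<bar>d\<bar> * 1"
    unfolding times_divide_eq_left times_divide_eq_right[symmetric] by (intro mult_left_mono) auto
  finally show ?thesis by simp
qed

lemma cutoff_derivative:
  assumes chi: "cutoff chi"
  obtains chi' B where "\<And>x. (chi has_field_derivative chi' x) (at x)" "continuous_on UNIV chi'"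
    "\<And>x. x < 1 \<Longrightarrow> chi' x = 0" "\<And>x. 2 < x \<Longrightarrow> chi' x = 0" "\<And>x. \<bar>chi' x\<bar> \<le> B"
proof -
  have C: "C1_along 1 chi (partial_deriv 1 chi)"
    using chi by (intro Ck_imp_C1_along[of 0]) (auto simp: cutoff_def smooth_def)
  have der: "(chi has_field_derivative partial_deriv 1 chi x) (at x)" for x
    using C1_along_shift[OF C, of 0 x] by (simp add: has_real_derivative_iff_has_vector_derivative)
  have low: "partial_deriv 1 chi x = 0" if "x < 1" for x
  proof -
    have "(chi has_field_derivative 0) (at x)"
      by (rule has_field_derivative_transform_within_open[where S = "{..<1}" and f = "\<lambda>_. 1"])
         (use that chi in \<open>auto simp: cutoff_def\<close>)
    then show ?thesis using der DERIV_unique by blast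
  qed
  have high: "partial_deriv 1 chi x = 0" if "2 < x" for x
  proof -
    have "(chi has_field_derivative 0) (at x)"
      by (rule has_field_derivative_transform_within_open[where S = "{2<..}" and f = "\<lambda>_. 0"])
         (use that chi in \<open>auto simp: cutoff_def\<close>)
    then show ?thesis using der DERIV_unique by blast
  qed
  have cont: "continuous_on UNIV (partial_deriv 1 chi)" using C by (simp add: C1_along_def)
  have "partial_deriv 1 chi x = 0" if "2 < norm x" for x
    using that high[of x] low[of x] by (cases "2 < x") auto
  then obtain B where B: "\<And>x. norm (partial_deriv 1 chi x) \<le> B"
    using continuous_vanish_imp_bounded[OF cont, of 2] by blast
  show thesis
    by (rule that[of "partial_deriv 1 chi" B]) (use der cont low high B in auto)
qed

text \<open>The exponent \<open>\<theta>\<close>. Outside the unit ball it is \<open>m r - s r^(1-\<rho>)\<close>; the maximum keeps it continuous on the whole line.\<close>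

definition phase :: "real \<Rightarrow> real \<Rightarrow> real \<Rightarrow> real \<Rightarrow> real" where
  "phase m s \<rho> r = m * r - s * max 1 r powr (1 - \<rho>)"

text \<open>Up to constants \<open>min (e\<^sup>y) (e^(-y) / \<delta>)\<close>, in a smooth form whose logarithmic derivative has modulus at most 1: the weight grows like \<open>e\<^sup>y\<close>
  and then decays like \<open>e^(-y)\<close>, which the energy inequality tolerates equally well.\<close>

definition capped_exp :: "real \<Rightarrow> real \<Rightarrow> real" where
  "capped_exp \<delta> y = 1 / (exp (- y) + \<delta> * exp y)"

lemma capped_exp_denominator_pos: "0 \<le> \<delta> \<Longrightarrow> 0 < exp (- y) + \<delta> * exp (y::real)"
  by (simp add: add_pos_nonneg)

lemma capped_exp_bounds:
  assumes "0 < \<delta>"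
  shows "0 < capped_exp \<delta> y" "capped_exp \<delta> y \<le> exp y" "capped_exp \<delta> y \<le> exp (- y) / \<delta>"
proof -
  have p: "0 < exp (- y) + \<delta> * exp y" using assms by (simp add: capped_exp_denominator_pos)
  show "0 < capped_exp \<delta> y" using p by (simp add: capped_exp_def)
  have "capped_exp \<delta> y \<le> 1 / exp (- y)" unfolding capped_exp_def using assms by (intro divide_left_mono) (auto simp: p)
  then show "capped_exp \<delta> y \<le> exp y" by (simp add: exp_minus field_simps)
  have "capped_exp \<delta> y \<le> 1 / (\<delta> * exp y)" unfolding capped_exp_def using assms by (intro divide_left_mono) (auto simp: p)
  then show "capped_exp \<delta> y \<le> exp (- y) / \<delta>" by (simp add: exp_minus field_simps)
qed

lemma capped_exp_derivative:
  assumes "0 < \<delta>"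
  obtains hat' where "\<And>y. (capped_exp \<delta> has_field_derivative hat' y) (at y)" "continuous_on UNIV hat'" "\<And>y. \<bar>hat' y\<bar> \<le> capped_exp \<delta> y"
proof -
  define D where "D y = exp (- y) + \<delta> * exp y" for y
  have p: "0 < D y" for y using assms by (simp add: D_def capped_exp_denominator_pos)
  define hat' where "hat' y = (exp (- y) - \<delta> * exp y) / (D y)\<^sup>2" for y
  have "(capped_exp \<delta> has_field_derivative hat' y) (at y)" for y
  proof -
    have "(D has_field_derivative (- exp (- y) + \<delta> * exp y)) (at y)"
      unfolding D_def[abs_def] by (auto intro!: derivative_eq_intros)
    from DERIV_divide[OF DERIV_const this, of 1] p[of y]
    have "((\<lambda>y. 1 / D y) has_field_derivative hat' y) (at y)"
      by (simp add: hat'_def power2_eq_square)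
    then show ?thesis by (simp add: capped_exp_def[abs_def] D_def)
  qed
  moreover have "continuous_on UNIV hat'"
    unfolding hat'_def[abs_def] D_def using p by (intro continuous_intros) (simp add: D_def less_imp_neq[symmetric])
  moreover have "\<bar>hat' y\<bar> \<le> capped_exp \<delta> y" for y
  proof -
    have "\<bar>exp (- y) - \<delta> * exp y\<bar> \<le> D y" using assms by (simp add: D_def abs_le_iff)
    then have "\<bar>hat' y\<bar> \<le> D y / (D y)\<^sup>2" unfolding hat'_def abs_divide by (simp add: divide_right_mono)
    also have "\<dots> = capped_exp \<delta> y" by (simp add: capped_exp_def D_def[symmetric] power2_eq_square)
    finally show ?thesis .
  qed
  ultimately show thesis using that by blast
qed

lemma phase_has_derivative:
  assumes "1 < r"
  shows "(phase m s \<rho> has_field_derivative m - s * (1 - \<rho>) * max 1 r powr (- \<rho>)) (at r)"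
proof (rule has_field_derivative_transform_within_open[where S = "{1<..}" and f = "\<lambda>r. m * r - s * r powr (1 - \<rho>)"])
  show "((\<lambda>r. m * r - s * r powr (1 - \<rho>)) has_field_derivative m - s * (1 - \<rho>) * max 1 r powr - \<rho>) (at r)"
    using assms by (auto intro!: derivative_eq_intros simp: max_def)
qed (use assms in \<open>auto simp: phase_def max_def\<close>)

lemma continuous_on_phase: "continuous_on UNIV (phase m s \<rho>)"
  unfolding phase_def[abs_def] by (intro continuous_intros) auto

text \<open>Rises from 0 to 1 for \<open>R \<le> r \<le> 2 R\<close> and falls back to 0 for \<open>J \<le> r \<le> 2 J\<close>.\<close>

definition ramp :: "(real \<Rightarrow> real) \<Rightarrow> real \<Rightarrow> real \<Rightarrow> real \<Rightarrow> real" where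
  "ramp chi R J r = (1 - chi (r / R)) * chi (r / J)"

text \<open>The slope bound for the profile. The hypothesis on \<open>R\<close> says that \<open>\<theta>' \<ge> 0\<close> from the radius \<open>R\<close> on, which is needed because
  \<open>\<theta>'\<close> is negative near the origin when \<open>s\<close> is large; the ramp removes that region.\<close>

lemma radial_weight:
  assumes chi: "cutoff chi"
    and chi': "\<And>x. (chi has_field_derivative chi' x) (at x)" "continuous_on UNIV chi'" "\<And>x. x < 1 \<Longrightarrow> chi' x = 0"
    and R: "1 < R" and J: "0 < J" and \<delta>: "0 < \<delta>"
    and small: "s * (1 - \<rho>) * R powr (- \<rho>) \<le> m" and s: "0 < s" and \<rho>: "0 < \<rho>" "\<rho> < 1"
  obtains om' where "\<And>r. ((\<lambda>r. ramp chi R J r * capped_exp \<delta> (phase m s \<rho> r)) has_field_derivative om' r) (at r)"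
    "continuous_on UNIV om'"
    "\<And>r. \<bar>om' r\<bar> \<le> (m - s * (1 - \<rho>) * max 1 r powr (- \<rho>)) * (ramp chi R J r * capped_exp \<delta> (phase m s \<rho> r))
      + (\<bar>chi' (r / R)\<bar> / R + \<bar>chi' (r / J)\<bar> / J) * capped_exp \<delta> (phase m s \<rho> r)"
proof -
  obtain hat' where hat': "\<And>y. (capped_exp \<delta> has_field_derivative hat' y) (at y)" "continuous_on UNIV hat'" "\<And>y. \<bar>hat' y\<bar> \<le> capped_exp \<delta> y"
    using capped_exp_derivative[OF \<delta>] by blast
  define c where "c r = s * (1 - \<rho>) * max 1 r powr (- \<rho>)" for r
  define P where "P = phase m s \<rho>"
  define D where "D r = (- chi' (r / R) / R) * chi (r / J) + (1 - chi (r / R)) * (chi' (r / J) / J)" for r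
  define om' where "om' r = D r * capped_exp \<delta> (P r) + ramp chi R J r * (hat' (P r) * (m - c r))" for r
  have chi1: "chi r = 1" if "r \<le> 1" for r using chi that by (simp add: cutoff_def)
  note b = cutoff_bounds[OF chi]
  have scale: "((\<lambda>r. chi (r / L)) has_field_derivative chi' (r / L) / L) (at r)" if "0 < L" for L r
  proof -
    have "((\<lambda>r. r / L) has_field_derivative 1 / L) (at r)"
      using that by (auto intro!: derivative_eq_intros)
    from DERIV_chain2[OF chi'(1) this] show ?thesis by simp
  qed
  have ramp: "(ramp chi R J has_field_derivative D r) (at r)" for r
    unfolding ramp_def[abs_def] D_def using scale[of R r] scale[OF J, of r] R
    by (auto intro!: derivative_eq_intros)
  have zero: "ramp chi R J r = 0" "D r = 0" if "r < R" for r
    using chi1[of "r / R"] chi'(3)[of "r / R"] that R by (auto simp: ramp_def D_def)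
  have "((\<lambda>r. ramp chi R J r * capped_exp \<delta> (P r)) has_field_derivative om' r) (at r)" for r
  proof (cases "r < R")
    case True
    have "((\<lambda>r. ramp chi R J r * capped_exp \<delta> (P r)) has_field_derivative 0) (at r)"
      by (rule has_field_derivative_transform_within_open[where S = "{..<R}" and f = "\<lambda>_. 0"]) (use True zero in auto)
    then show ?thesis using zero[OF True] by (simp add: om'_def)
  next
    case False
    then have "(P has_field_derivative m - c r) (at r)"
      unfolding P_def c_def using R by (intro phase_has_derivative) auto
    from DERIV_mult[OF ramp DERIV_chain2[OF hat'(1) this]]
    show ?thesis by (simp add: om'_def algebra_simps)
  qed
  moreover have "continuous_on UNIV om'"
  proof -
    have cchi: "continuous_on UNIV chi" using chi'(1) by (auto intro!: DERIV_isCont continuous_at_imp_continuous_on)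
    have chat: "continuous_on UNIV (capped_exp \<delta>)" using hat'(1) by (auto intro!: DERIV_isCont continuous_at_imp_continuous_on)
    have cP: "continuous_on UNIV P" unfolding P_def by (rule continuous_on_phase)
    show ?thesis
      unfolding om'_def[abs_def] D_def ramp_def c_def
      by (intro continuous_intros continuous_on_compose2[OF cchi] continuous_on_compose2[OF chi'(2)]
          continuous_on_compose2[OF chat] continuous_on_compose2[OF hat'(2)] continuous_on_compose2[OF cP]) (use R J in auto)
  qed
  moreover have "\<bar>om' r\<bar> \<le> (m - c r) * (ramp chi R J r * capped_exp \<delta> (P r)) + (\<bar>chi' (r / R)\<bar> / R + \<bar>chi' (r / J)\<bar> / J) * capped_exp \<delta> (P r)" for r
  proof -
    have h: "0 < capped_exp \<delta> (P r)" using capped_exp_bounds(1)[OF \<delta>] .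
    have "\<bar>- chi' (r / R) / R * chi (r / J)\<bar> = \<bar>chi' (r / R)\<bar> / R * chi (r / J)"
      using R b(1)[of "r / J"] by (simp add: abs_mult)
    also have "\<dots> \<le> \<bar>chi' (r / R)\<bar> / R" using R b(2) by (intro mult_left_le) auto
    finally have "\<bar>- chi' (r / R) / R * chi (r / J)\<bar> \<le> \<bar>chi' (r / R)\<bar> / R" .
    moreover have "\<bar>(1 - chi (r / R)) * (chi' (r / J) / J)\<bar> \<le> \<bar>chi' (r / J)\<bar> / J"
      unfolding abs_mult using J b[of "r / R"] by (simp add: divide_right_mono mult_left_le_one_le)
    ultimately have "\<bar>D r\<bar> \<le> \<bar>chi' (r / R)\<bar> / R + \<bar>chi' (r / J)\<bar> / J"
      unfolding D_def by (rule order_trans[OF abs_triangle_ineq add_mono])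
    then have 1: "\<bar>D r * capped_exp \<delta> (P r)\<bar> \<le> (\<bar>chi' (r / R)\<bar> / R + \<bar>chi' (r / J)\<bar> / J) * capped_exp \<delta> (P r)"
      using h by (simp add: abs_mult)
    have 2: "\<bar>ramp chi R J r * (hat' (P r) * (m - c r))\<bar> \<le> (m - c r) * (ramp chi R J r * capped_exp \<delta> (P r))"
    proof (cases "r < R")
      case False
      have "max 1 r powr (- \<rho>) \<le> R powr (- \<rho>)" using False R \<rho> by (intro powr_mono2') auto
      then have "c r \<le> s * (1 - \<rho>) * R powr (- \<rho>)" unfolding c_def using s \<rho> by (intro mult_left_mono) auto
      then have mc: "0 \<le> m - c r" using small by simp
      have rr: "0 \<le> ramp chi R J r" using b by (simp add: ramp_def)
      have "\<bar>hat' (P r)\<bar> * (ramp chi R J r * (m - c r)) \<le> capped_exp \<delta> (P r) * (ramp chi R J r * (m - c r))"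
        using hat'(3) rr mc by (intro mult_right_mono) auto
      then show ?thesis using rr mc by (simp add: abs_mult mult_ac)
    qed (simp add: zero)
    show ?thesis unfolding om'_def using order_trans[OF abs_triangle_ineq add_mono[OF 1 2]] by simp
  qed
  ultimately show thesis using that unfolding c_def P_def by blast
qed

section \<open>Decay of weak solutions\<close>

lemma loc_square_integrable_bounded:
  fixes u :: "'a::euclidean_space \<Rightarrow> complex"
  assumes u: "L2_loc u" and a: "continuous_on UNIV a"
  shows "integrable lborel (\<lambda>x. indicator (cball 0 M) x * (a x * (cmod (u x))\<^sup>2))"
proof -
  have U: "L2 (\<lambda>x. indicator (cball 0 M) x *\<^sub>R u x)" using u by (simp add: L2_loc_def)
  have "bounded (a ` cball 0 M)"
    using a by (intro compact_imp_bounded compact_continuous_image) (auto intro: continuous_on_subset)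
  then obtain A where A: "\<forall>x\<in>cball 0 M. \<bar>a x\<bar> \<le> A" unfolding bounded_iff by auto
  have [measurable]: "a \<in> borel_measurable borel" using a by (rule borel_measurable_continuous_onI)
  have "integrable lborel (\<lambda>x. (indicator (cball 0 M) x * a x) * (cmod (indicator (cball 0 M) x *\<^sub>R u x))\<^sup>2)"
  proof (rule integral_weighted_square_diff_le(1)[OF U _ _ _, where h = 1 and Y = "\<lambda>x. indicator (cball 0 M) x *\<^sub>R u x"])
    show "(\<lambda>x. indicator (cball 0 M) x * a x) \<in> borel_measurable borel"
      by (intro borel_measurable_times borel_measurable_indicator) auto
    show "\<bar>indicator (cball 0 M) x * a x\<bar> \<le> \<bar>A\<bar>" for x
      using A[rule_format, of x] by (auto simp: indicator_def)
  qed (auto simp: L2_def)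
  moreover have "(indicator (cball 0 M) x * a x) * (cmod (indicator (cball 0 M) x *\<^sub>R u x))\<^sup>2
      = indicator (cball 0 M) x * (a x * (cmod (u x))\<^sup>2)" for x
    by (simp add: indicator_def)
  ultimately show ?thesis by (simp only:)
qed

text \<open>The energy inequality for one fixed weight. In the bound, the term with \<open>R\<close> comes from the inner cut-off, where
  \<open>capped_exp \<delta> \<theta> \<le> e\<^sup>\<theta>\<close>, and it depends neither on \<open>\<delta>\<close> nor on \<open>J\<close>; the other one comes from the outer cut-off, where
  \<open>capped_exp \<delta> \<theta> \<le> e^(-\<theta>) / \<delta>\<close>. The division by the gain costs a factor \<open>r\<^sup>\<rho> \<le> 2 J\<close>, which the square of the slope
  \<open>O(1 / J)\<close> of the outer cut-off turns into \<open>O(1 / J)\<close>.\<close>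

lemma truncated_decay_estimate:
  fixes u F :: "'a::euclidean_space \<Rightarrow> complex"
  assumes chi: "cutoff chi"
    and chi': "\<And>x. (chi has_field_derivative chi' x) (at x)" "continuous_on UNIV chi'"
      "\<And>x. x < 1 \<Longrightarrow> chi' x = 0" "\<And>x. 2 < x \<Longrightarrow> chi' x = 0" "\<And>x. \<bar>chi' x\<bar> \<le> B"
    and u: "loc_int u" "L2_loc u" and F: "loc_int F" and sol: "weak_solution k F u"
    and dom: "AE x in lborel. 2 < norm x \<longrightarrow> cmod (F x) \<le> Q * max 1 (norm x) powr (- \<rho>) * cmod (u x)"
    and Q: "0 < Q" and s: "0 < s" and \<rho>: "0 < \<rho>" "\<rho> < 1"
    and big: "Q + 1 \<le> cmod k * (s * (1 - \<rho>))"
    and R: "2 < R" and small: "s * (1 - \<rho>) * R powr (- \<rho>) \<le> Im k"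
    and J: "2 * R \<le> J" and \<delta>: "0 < \<delta>"
    and init: "integrable lborel (\<lambda>x. exp (- 2 * phase (Im k) s \<rho> (norm x)) * (cmod (u x))\<^sup>2)"
  shows "(\<integral>\<^sup>+x. ennreal (indicator {x. 2 * R \<le> norm x \<and> norm x \<le> J} x *
        (max 1 (norm x) powr (- \<rho>) * (capped_exp \<delta> (phase (Im k) s \<rho> (norm x)))\<^sup>2 * (cmod (u x))\<^sup>2)) \<partial>lborel)
    \<le> ennreal (cmod k * (4 * B\<^sup>2 / (s * (1 - \<rho>))) *
        (R * (LINT x|lborel. indicator (cball 0 (2 * R)) x * (exp (2 * phase (Im k) s \<rho> (norm x)) * (cmod (u x))\<^sup>2))
         + 1 / (J * \<delta>\<^sup>2) * (LINT x|lborel. exp (- 2 * phase (Im k) s \<rho> (norm x)) * (cmod (u x))\<^sup>2)))"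
proof -
  define P where "P = phase (Im k) s \<rho>"
  define c where "c x = s * (1 - \<rho>) * max 1 (norm x) powr (- \<rho>)" for x :: 'a
  define \<beta> where "\<beta> x = Q * max 1 (norm x) powr (- \<rho>)" for x :: 'a
  define om where "om r = ramp chi R J r * capped_exp \<delta> (P r)" for r
  define g where "g x = (\<bar>chi' (norm x / R)\<bar> / R + \<bar>chi' (norm x / J)\<bar> / J) * capped_exp \<delta> (P (norm x))" for x :: 'a
  have R0: "0 < R" "1 < R" and J0: "0 < J" using R J by auto
  have k0: "0 < cmod k" using big Q s \<rho> by (metis add_pos_pos less_le_trans mult_zero_left norm_eq_zero not_less zero_less_norm_iff zero_less_one)
  obtain om' where om': "\<And>r. (om has_field_derivative om' r) (at r)" "continuous_on UNIV om'"
    "\<And>r. \<bar>om' r\<bar> \<le> (Im k - s * (1 - \<rho>) * max 1 r powr (- \<rho>)) * om r + (\<bar>chi' (r / R)\<bar> / R + \<bar>chi' (r / J)\<bar> / J) * capped_exp \<delta> (P r)"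
    using radial_weight[OF chi chi'(1-3) R0(2) J0 \<delta> small s \<rho>] unfolding om_def P_def by blast
  note hb = capped_exp_bounds[OF \<delta>]
  have chi1: "chi r = 1" if "r \<le> 1" for r using chi that by (simp add: cutoff_def)
  have chi2: "chi r = 0" if "2 \<le> r" for r using chi that by (simp add: cutoff_def)
  have om0: "om r = 0" if "r \<le> R" for r using that R0 by (simp add: om_def ramp_def chi1)
  have om2: "om r = 0" if "2 * J < r" for r using that J0 by (simp add: om_def ramp_def chi2 field_simps)
  have om_nonneg: "0 \<le> om r" for r
    unfolding om_def ramp_def using cutoff_bounds[OF chi] hb(1) by (intro mult_nonneg_nonneg) (auto simp: less_imp_le)
  have c_pos: "0 < c x" and \<beta>_pos: "0 < \<beta> x" for x using s \<rho> Q by (auto simp: c_def \<beta>_def)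
  have cP: "continuous_on UNIV P" unfolding P_def by (rule continuous_on_phase)
  have chat: "continuous_on UNIV (capped_exp \<delta>)"
    using capped_exp_derivative[OF \<delta>] by (metis DERIV_isCont continuous_at_imp_continuous_on)
  have le: "c x \<le> Im k" if "om (norm x) \<noteq> 0" for x
  proof -
    have "R < norm x" using om0 that not_le by blast
    then have "max 1 (norm x) powr (- \<rho>) \<le> R powr (- \<rho>)" using R \<rho> by (intro powr_mono2') auto
    then have "c x \<le> s * (1 - \<rho>) * R powr (- \<rho>)" unfolding c_def using s \<rho> by (intro mult_left_mono) auto
    then show ?thesis using small by simp
  qed
  have dom': "AE x in lborel. 2 < norm x \<longrightarrow> cmod (F x) \<le> \<beta> x * cmod (u x)" using dom by (simp add: \<beta>_def)
  have grad_om: "C1_along b (\<lambda>x. om (norm x)) (\<lambda>x. om' (norm x) * (x \<bullet> b) / max 1 (norm x))" if "b \<in> Basis" for b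
    using om'(1,2) om0 R0 by (intro C1_along_radial) auto
  have cont_g: "continuous_on UNIV g"
    unfolding g_def[abs_def]
    by (intro continuous_intros continuous_on_compose2[OF chi'(2)] continuous_on_compose2[OF chat] continuous_on_compose2[OF cP])
       (use R0 J0 in auto)
  have g_below: "g x = 0" if "norm x < R" for x
    using that R0 J chi'(3) by (simp add: g_def)
  have g_above: "g x = 0" if "2 * J < norm x" for x
  proof -
    have "2 < norm x / R" "2 < norm x / J" using that R0 J J0 by (auto simp: field_simps)
    then show ?thesis using chi'(4) by (simp add: g_def)
  qed
  have g_nonneg: "0 \<le> g x" for x unfolding g_def using R0 J0 hb(1)[of "P (norm x)"] by simp
  have cont_c: "continuous_on UNIV c" and cont_b: "continuous_on UNIV \<beta>"
    unfolding c_def[abs_def] \<beta>_def[abs_def] by (intro continuous_intros; auto)+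
  have slope: "L2_set (\<lambda>b. om' (norm x) * (x \<bullet> b) / max 1 (norm x)) Basis \<le> (Im k - c x) * om (norm x) + g x" for x
    using order_trans[OF L2_set_radial_gradient om'(3)] by (simp add: c_def g_def)
  have om_below: "om (norm x) = 0" if "norm x < R" for x :: 'a using that om0 by simp
  have om_above: "om (norm x) = 0" if "2 * J < norm x" for x :: 'a using that om2 by simp
  have k: "k \<noteq> 0" using k0 by auto
  have om_nonneg': "0 \<le> om (norm x)" for x :: 'a by (rule om_nonneg)
  have energy: "integrable lborel (\<lambda>x. (cmod k * c x - \<beta> x) * (om (norm x))\<^sup>2 * (cmod (u x))\<^sup>2) \<and>
      integrable lborel (\<lambda>x. (g x)\<^sup>2 / c x * (cmod (u x))\<^sup>2) \<and>
      (LINT x|lborel. (cmod k * c x - \<beta> x) * (om (norm x))\<^sup>2 * (cmod (u x))\<^sup>2)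
        \<le> cmod k * (LINT x|lborel. (g x)\<^sup>2 / c x * (cmod (u x))\<^sup>2)"
    by (intro conjI; rule weak_solution_energy_inequality[where v = "\<lambda>x. om (norm x)"
        and w = "\<lambda>b x. om' (norm x) * (x \<bullet> b) / max 1 (norm x)" and g = g and c = c and \<beta> = \<beta>
        and M = "2 * J" and ?r0.0 = 2 and ?r1.0 = R, OF chi u F sol]; fact)
  \<comment> \<open>This is where a large \<open>s\<close> beats the potential: the gain minus the loss is at least \<open>r^(-\<rho>)\<close>.\<close>
  have gain: "max 1 (norm x) powr (- \<rho>) \<le> cmod k * c x - \<beta> x" for x
  proof -
    have "(Q + 1) * max 1 (norm x) powr (- \<rho>) \<le> cmod k * (s * (1 - \<rho>)) * max 1 (norm x) powr (- \<rho>)"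
      using big by (intro mult_right_mono) auto
    then show ?thesis by (simp add: c_def \<beta>_def algebra_simps)
  qed
  have "(\<integral>\<^sup>+x. ennreal (indicator {x. 2 * R \<le> norm x \<and> norm x \<le> J} x *
        (max 1 (norm x) powr (- \<rho>) * (capped_exp \<delta> (P (norm x)))\<^sup>2 * (cmod (u x))\<^sup>2)) \<partial>lborel)
      \<le> (\<integral>\<^sup>+x. ennreal ((cmod k * c x - \<beta> x) * (om (norm x))\<^sup>2 * (cmod (u x))\<^sup>2) \<partial>lborel)"
  proof (intro nn_integral_mono ennreal_leI)
    fix x :: 'a
    have "max 1 (norm x) powr (- \<rho>) * (capped_exp \<delta> (P (norm x)))\<^sup>2 * (cmod (u x))\<^sup>2
        \<le> (cmod k * c x - \<beta> x) * (om (norm x))\<^sup>2 * (cmod (u x))\<^sup>2" if "2 * R \<le> norm x" "norm x \<le> J"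
    proof -
      have "om (norm x) = capped_exp \<delta> (P (norm x))"
        using that R0 J0 by (simp add: om_def ramp_def chi1 chi2 field_simps)
      then show ?thesis using gain[of x] by (simp add: mult_right_mono)
    qed
    moreover have "0 \<le> (cmod k * c x - \<beta> x) * (om (norm x))\<^sup>2 * (cmod (u x))\<^sup>2"
      using order_trans[OF powr_ge_zero gain[of x]] by simp
    ultimately show "indicator {x. 2 * R \<le> norm x \<and> norm x \<le> J} x *
        (max 1 (norm x) powr (- \<rho>) * (capped_exp \<delta> (P (norm x)))\<^sup>2 * (cmod (u x))\<^sup>2)
        \<le> (cmod k * c x - \<beta> x) * (om (norm x))\<^sup>2 * (cmod (u x))\<^sup>2"
      by (auto simp: indicator_def)
  qed
  also have "\<dots> = ennreal (LINT x|lborel. (cmod k * c x - \<beta> x) * (om (norm x))\<^sup>2 * (cmod (u x))\<^sup>2)"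
  proof (rule nn_integral_eq_integral[OF conjunct1[OF energy]], rule AE_I2)
    fix x :: 'a
    show "0 \<le> (cmod k * c x - \<beta> x) * (om (norm x))\<^sup>2 * (cmod (u x))\<^sup>2"
      using order_trans[OF powr_ge_zero gain[of x]] by simp
  qed
  also have "\<dots> \<le> ennreal (cmod k * (LINT x|lborel. (g x)\<^sup>2 / c x * (cmod (u x))\<^sup>2))"
    using energy by (intro ennreal_leI) blast
  also have "\<dots> \<le> ennreal (cmod k * ((4 * B\<^sup>2 / (s * (1 - \<rho>))) *
        (R * (LINT x|lborel. indicator (cball 0 (2 * R)) x * (exp (2 * P (norm x)) * (cmod (u x))\<^sup>2))
         + 1 / (J * \<delta>\<^sup>2) * (LINT x|lborel. exp (- 2 * P (norm x)) * (cmod (u x))\<^sup>2))))"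
  proof (intro ennreal_leI mult_left_mono norm_ge_zero)
    define E1 where "E1 x = indicator (cball 0 (2 * R)) x * (exp (2 * P (norm x)) * (cmod (u x))\<^sup>2)" for x
    define E2 where "E2 x = exp (- 2 * P (norm x)) * (cmod (u x))\<^sup>2" for x
    have i1: "integrable lborel E1"
      unfolding E1_def by (intro loc_square_integrable_bounded[OF u(2)] continuous_intros continuous_on_compose2[OF cP]) auto
    have i2: "integrable lborel E2" unfolding E2_def using init by (simp add: P_def)
    define D where "D = 4 * B\<^sup>2 / (s * (1 - \<rho>))"
    have "(LINT x|lborel. (g x)\<^sup>2 / c x * (cmod (u x))\<^sup>2) \<le> (LINT x|lborel. D * (R * E1 x + 1 / (J * \<delta>\<^sup>2) * E2 x))"
    proof (rule integral_mono[OF conjunct1[OF conjunct2[OF energy]]])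
      show "integrable lborel (\<lambda>x. D * (R * E1 x + 1 / (J * \<delta>\<^sup>2) * E2 x))" using i1 i2 by simp
      fix x :: 'a
      define h where "h = capped_exp \<delta> (P (norm x))"
      define a b where "a = \<bar>chi' (norm x / R)\<bar> / R" and "b = \<bar>chi' (norm x / J)\<bar> / J"
      define U where "U = (cmod (u x))\<^sup>2"
      have U: "0 \<le> U" by (simp add: U_def)
      have h: "0 < h" "h \<le> exp (P (norm x))" "h \<le> exp (- P (norm x)) / \<delta>" using hb unfolding h_def by auto
      have h1: "h\<^sup>2 \<le> exp (2 * P (norm x))"
        using power_mono[OF h(2), of 2] h(1) by (simp add: exp_double)
      have h2: "h\<^sup>2 \<le> exp (- 2 * P (norm x)) / \<delta>\<^sup>2"
        using power_mono[OF h(3), of 2] h(1) exp_double[of "- P (norm x)"] by (simp add: power_divide)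
      have sr: "0 < s * (1 - \<rho>)" using s \<rho> by simp
      have ic: "1 / c x \<le> L / (s * (1 - \<rho>))" if "norm x \<le> L" "1 \<le> L" for L
      proof -
        have "max 1 (norm x) powr \<rho> \<le> max 1 (norm x) powr 1" using \<rho> by (intro powr_mono) auto
        then have "max 1 (norm x) powr \<rho> \<le> L" using that by simp
        then have "max 1 (norm x) powr \<rho> / (s * (1 - \<rho>)) \<le> L / (s * (1 - \<rho>))" using sr by (intro divide_right_mono) auto
        then show ?thesis by (simp add: c_def powr_minus field_simps)
      qed
      have aa: "a\<^sup>2 * h\<^sup>2 / c x * U \<le> D / 2 * (R * E1 x)"
      proof (cases "norm x \<le> 2 * R")
        case True
        have "a \<le> B" 
          unfolding a_def using chi'(5)[of "norm x / R"] R0 abs_ge_zero[of "chi' (norm x / R)"] 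
          by (simp add: divide_le_eq) (smt (verit) mult_le_cancel_left1)
        then have "a\<^sup>2 \<le> B\<^sup>2" unfolding a_def using R0 by (intro power_mono) auto
        then have "(a\<^sup>2 * h\<^sup>2) * (1 / c x) * U \<le> (B\<^sup>2 * exp (2 * P (norm x))) * (2 * R / (s * (1 - \<rho>))) * U"
          using h1 ic[OF True] R0 c_pos[of x] U sr by (intro mult_right_mono mult_mono) (auto intro: less_imp_le)
        also have "\<dots> = D / 2 * (R * E1 x)" using True by (simp add: D_def E1_def U_def)
        finally show ?thesis by simp
      next
        case False
        then have "2 < norm x / R" using R0 by (simp add: field_simps)
        then have "a = 0" using chi'(4) by (simp add: a_def)
        then show ?thesis using False by (simp add: E1_def)
      qed
      have bb: "b\<^sup>2 * h\<^sup>2 / c x * U \<le> D / 2 * (1 / (J * \<delta>\<^sup>2) * E2 x)"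
      proof (cases "norm x \<le> 2 * J")
        case True
        have "b \<le> B / J" unfolding b_def using chi'(5) J0 by (intro divide_right_mono) auto
        then have "b\<^sup>2 \<le> (B / J)\<^sup>2" unfolding b_def using J0 by (intro power_mono) auto
        then have "(b\<^sup>2 * h\<^sup>2) * (1 / c x) * U \<le> ((B / J)\<^sup>2 * (exp (- 2 * P (norm x)) / \<delta>\<^sup>2)) * (2 * J / (s * (1 - \<rho>))) * U"
          using h2 ic[OF True] J0 J R0 c_pos[of x] U sr by (intro mult_right_mono mult_mono) (auto intro: less_imp_le)
        also have "\<dots> = D / 2 * (1 / (J * \<delta>\<^sup>2) * E2 x)"
        proof -
          have "(B / J)\<^sup>2 * (e / \<delta>\<^sup>2) * (2 * J / S) * U = 4 * B\<^sup>2 / S / 2 * (1 / (J * \<delta>\<^sup>2) * (e * U))"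
            if "S \<noteq> 0" for e S
            using J0 \<delta> that by (simp add: field_simps power2_eq_square)
          then show ?thesis using sr unfolding D_def E2_def U_def by (metis less_irrefl)
        qed
        finally show ?thesis by simp
      next
        case False
        then have "2 < norm x / J" using J0 by (simp add: field_simps)
        then have "b = 0" using chi'(4) by (simp add: b_def)
        then show ?thesis using J0 sr by (simp add: E2_def D_def)
      qed
      have "(g x)\<^sup>2 \<le> 2 * (a\<^sup>2 * h\<^sup>2) + 2 * (b\<^sup>2 * h\<^sup>2)"
      proof -
        have "(a + b)\<^sup>2 \<le> 2 * a\<^sup>2 + 2 * b\<^sup>2" using sum_squares_bound[of a b] by (simp add: power2_sum)
        then have "(a + b)\<^sup>2 * h\<^sup>2 \<le> (2 * a\<^sup>2 + 2 * b\<^sup>2) * h\<^sup>2" by (rule mult_right_mono) simp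
        moreover have "(g x)\<^sup>2 = (a + b)\<^sup>2 * h\<^sup>2"
          by (simp only: g_def a_def b_def h_def power_mult_distrib)
        moreover have "(2 * a\<^sup>2 + 2 * b\<^sup>2) * h\<^sup>2 = 2 * (a\<^sup>2 * h\<^sup>2) + 2 * (b\<^sup>2 * h\<^sup>2)"
          by (simp add: distrib_right)
        ultimately show ?thesis by simp
      qed
      then have "(g x)\<^sup>2 / c x * U \<le> (2 * (a\<^sup>2 * h\<^sup>2) + 2 * (b\<^sup>2 * h\<^sup>2)) / c x * U"
        using c_pos[of x] U by (intro mult_right_mono divide_right_mono) auto
      also have "\<dots> = 2 * (a\<^sup>2 * h\<^sup>2 / c x * U) + 2 * (b\<^sup>2 * h\<^sup>2 / c x * U)"
        by (simp add: add_divide_distrib distrib_right)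
      also have "\<dots> \<le> 2 * (D / 2 * (R * E1 x)) + 2 * (D / 2 * (1 / (J * \<delta>\<^sup>2) * E2 x))"
        by (intro add_mono mult_left_mono aa bb) auto
      also have "\<dots> = D * (R * E1 x + 1 / (J * \<delta>\<^sup>2) * E2 x)" by (simp add: distrib_left)
      finally show "(g x)\<^sup>2 / c x * (cmod (u x))\<^sup>2 \<le> D * (R * E1 x + 1 / (J * \<delta>\<^sup>2) * E2 x)" by (simp add: U_def)
    qed
    also have "\<dots> = D * (R * (LINT x|lborel. E1 x) + 1 / (J * \<delta>\<^sup>2) * (LINT x|lborel. E2 x))"
      using i1 i2 by simp
    finally show "(LINT x|lborel. (g x)\<^sup>2 / c x * (cmod (u x))\<^sup>2) \<le> (4 * B\<^sup>2 / (s * (1 - \<rho>))) *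
        (R * (LINT x|lborel. indicator (cball 0 (2 * R)) x * (exp (2 * P (norm x)) * (cmod (u x))\<^sup>2))
         + 1 / (J * \<delta>\<^sup>2) * (LINT x|lborel. exp (- 2 * P (norm x)) * (cmod (u x))\<^sup>2))"
      unfolding D_def E1_def E2_def .
  qed
  finally show ?thesis by (simp only: P_def mult.assoc)
qed

lemma capped_exp_tendsto: "(\<lambda>n. capped_exp (1 / real (Suc n)) y) \<longlonglongrightarrow> exp y"
proof -
  have "(\<lambda>n. 1 / real (Suc n)) \<longlonglongrightarrow> 0"
    using LIMSEQ_inverse_real_of_nat by (simp add: inverse_eq_divide)
  then have "(\<lambda>n. 1 / (exp (- y) + 1 / real (Suc n) * exp y)) \<longlonglongrightarrow> 1 / (exp (- y) + 0 * exp y)"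
    by (intro tendsto_intros) auto
  moreover have "1 / (exp (- y) + 0 * exp y) = exp y" by (simp add: exp_minus divide_inverse)
  ultimately show ?thesis by (simp only: capped_exp_def)
qed

text \<open>The outer error is removed by choosing \<open>J\<close> large in dependence on \<open>\<delta>\<close>; Fatou's lemma then handles both limits
  at once.\<close>

lemma weak_solution_decay:
  fixes u F :: "'a::euclidean_space \<Rightarrow> complex"
  assumes chi: "cutoff chi"
    and u: "loc_int u" "L2_loc u" and F: "loc_int F" and sol: "weak_solution k F u"
    and dom: "AE x in lborel. 2 < norm x \<longrightarrow> cmod (F x) \<le> Q * max 1 (norm x) powr (- \<rho>) * cmod (u x)"
    and Q: "0 < Q" and s: "0 < s" and \<rho>: "0 < \<rho>" "\<rho> < 1" and m: "0 < Im k"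
    and big: "Q + 1 \<le> cmod k * (s * (1 - \<rho>))"
    and init: "integrable lborel (\<lambda>x. exp (- 2 * phase (Im k) s \<rho> (norm x)) * (cmod (u x))\<^sup>2)"
  obtains R where "2 < R" "integrable lborel (\<lambda>x. indicator {x. R \<le> norm x} x *
        (max 1 (norm x) powr (- \<rho>) * (exp (phase (Im k) s \<rho> (norm x)))\<^sup>2 * (cmod (u x))\<^sup>2))"
proof -
  obtain chi' B where chi': "\<And>x. (chi has_field_derivative chi' x) (at x)" "continuous_on UNIV chi'"
      "\<And>x. x < 1 \<Longrightarrow> chi' x = 0" "\<And>x. 2 < x \<Longrightarrow> chi' x = 0" "\<And>x. \<bar>chi' x\<bar> \<le> B"
    using cutoff_derivative[OF chi] by blast
  have [measurable]: "u \<in> borel_measurable borel" using u by (simp add: loc_int_def)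
  define P where "P = phase (Im k) s \<rho>"
  have [measurable]: "P \<in> borel_measurable borel"
    unfolding P_def using continuous_on_phase by (rule borel_measurable_continuous_onI)
  define S where "S = s * (1 - \<rho>)"
  have S: "0 < S" using s \<rho> by (simp add: S_def)
  \<comment> \<open>The second entry is the radius from which on the phase is increasing.\<close>
  define R where "R = max 3 ((S / Im k) powr (1 / \<rho>))"
  have R: "2 < R" by (simp add: R_def)
  have "S / Im k = ((S / Im k) powr (1 / \<rho>)) powr \<rho>" using S m \<rho> by (simp add: powr_powr)
  also have "\<dots> \<le> R powr \<rho>" using \<rho> by (intro powr_mono2) (auto simp: R_def)
  finally have small: "s * (1 - \<rho>) * R powr (- \<rho>) \<le> Im k"
    using m R by (simp add: S_def[symmetric] powr_minus field_simps)
  define I1 where "I1 = (LINT x|lborel. indicator (cball 0 (2 * R)) x * (exp (2 * P (norm x)) * (cmod (u x))\<^sup>2))"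
  define I2 where "I2 = (LINT x|lborel. exp (- 2 * P (norm x)) * (cmod (u x))\<^sup>2)"
  have I2: "0 \<le> I2" by (simp add: I2_def)
  define C where "C = cmod k * (4 * B\<^sup>2 / S)"
  have C: "0 \<le> C" using S by (simp add: C_def)
  define \<delta> where "\<delta> n = 1 / real (Suc n)" for n
  \<comment> \<open>The summands: cut off outside the inner transition, exhaust the space, make the outer error at most 1.\<close>
  define J where "J n = 2 * R + real n + I2 / (\<delta> n)\<^sup>2" for n
  define f where "f n x = indicator {x. 2 * R \<le> norm x \<and> norm x \<le> J n} x *
        (max 1 (norm x) powr (- \<rho>) * (capped_exp (\<delta> n) (P (norm x)))\<^sup>2 * (cmod (u x))\<^sup>2)" for n and x :: 'a
  define f0 where "f0 x = indicator {x. 2 * R \<le> norm x} x *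
        (max 1 (norm x) powr (- \<rho>) * (exp (P (norm x)))\<^sup>2 * (cmod (u x))\<^sup>2)" for x :: 'a
  have [measurable]: "capped_exp d \<in> borel_measurable borel" for d unfolding capped_exp_def[abs_def] by measurable
  have mf[measurable]: "f n \<in> borel_measurable borel" for n unfolding f_def by measurable
  have mf0[measurable]: "f0 \<in> borel_measurable borel" unfolding f0_def by measurable
  have \<delta>: "0 < \<delta> n" for n by (simp add: \<delta>_def)
  have bound: "(\<integral>\<^sup>+x. ennreal (f n x) \<partial>lborel) \<le> ennreal (C * (R * I1 + 1))" for n
  proof -
    have "0 \<le> I2 / (\<delta> n)\<^sup>2" using I2 by simp
    then have J: "2 * R \<le> J n" "I2 / (\<delta> n)\<^sup>2 \<le> J n" "0 < J n" using R by (simp_all add: J_def)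
    have "(\<integral>\<^sup>+x. ennreal (f n x) \<partial>lborel) \<le> ennreal (C * (R * I1 + 1 / (J n * (\<delta> n)\<^sup>2) * I2))"
      using truncated_decay_estimate[OF chi chi' u F sol dom Q s \<rho> big R small J(1) \<delta>[of n] init]
      by (simp only: f_def P_def C_def S_def I1_def I2_def)
    also have "\<dots> \<le> ennreal (C * (R * I1 + 1))"
    proof (intro ennreal_leI mult_left_mono C add_left_mono)
      have "1 / (J n * (\<delta> n)\<^sup>2) * I2 = (I2 / (\<delta> n)\<^sup>2) / J n" by simp
      also have "\<dots> \<le> 1" using J(2) by (simp only: divide_le_eq_1_pos[OF J(3)])
      finally show "1 / (J n * (\<delta> n)\<^sup>2) * I2 \<le> 1" .
    qed
    finally show ?thesis .
  qed
  have lim: "(\<lambda>n. f n x) \<longlonglongrightarrow> f0 x" for x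
  proof -
    obtain N :: nat where N: "norm x \<le> real N" using real_arch_simple by blast
    have "(\<lambda>n. indicator {x. 2 * R \<le> norm x} x * (max 1 (norm x) powr (- \<rho>) * (capped_exp (\<delta> n) (P (norm x)))\<^sup>2 * (cmod (u x))\<^sup>2)) \<longlonglongrightarrow> f0 x"
      unfolding f0_def \<delta>_def by (intro tendsto_intros capped_exp_tendsto)
    moreover have "\<forall>\<^sub>F n in sequentially. indicator {x. 2 * R \<le> norm x} x * (max 1 (norm x) powr (- \<rho>) * (capped_exp (\<delta> n) (P (norm x)))\<^sup>2 * (cmod (u x))\<^sup>2) = f n x"
    proof (rule eventually_sequentiallyI)
      fix n assume "N \<le> n"
      moreover have "0 \<le> I2 / (\<delta> n)\<^sup>2" using I2 by simp
      ultimately have "norm x \<le> J n" using N R by (simp add: J_def)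
      then show "indicator {x. 2 * R \<le> norm x} x * (max 1 (norm x) powr (- \<rho>) * (capped_exp (\<delta> n) (P (norm x)))\<^sup>2 * (cmod (u x))\<^sup>2) = f n x"
        by (simp add: f_def indicator_def)
    qed
    ultimately show ?thesis by (rule Lim_transform_eventually)
  qed
  have "(\<integral>\<^sup>+x. ennreal (f0 x) \<partial>lborel) = (\<integral>\<^sup>+x. liminf (\<lambda>n. ennreal (f n x)) \<partial>lborel)"
    by (intro nn_integral_cong lim_imp_Liminf[symmetric] tendsto_ennrealI lim) simp
  also have "\<dots> \<le> liminf (\<lambda>n. \<integral>\<^sup>+x. ennreal (f n x) \<partial>lborel)"
    by (rule nn_integral_liminf) measurable
  also have "\<dots> \<le> ennreal (C * (R * I1 + 1))"
    using bound by (intro Liminf_le) (auto simp: trivial_limit_sequentially)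
  finally have "(\<integral>\<^sup>+x. ennreal (f0 x) \<partial>lborel) < \<infinity>" by (auto intro: le_less_trans)
  then have "integrable lborel f0" by (intro integrableI_nonneg) (auto simp: f0_def)
  then show thesis using that[of "2 * R"] R unfolding f0_def[abs_def] P_def by simp
qed

section \<open>The potential outside a ball\<close>

lemma cutoff_continuous:
  assumes "cutoff chi" shows "continuous_on UNIV chi"
proof -
  have "Ck 0 chi" using assms unfolding cutoff_def smooth_def by blast
  then show ?thesis by simp
qed

lemma weight_outside: "cutoff chi \<Longrightarrow> 2 \<le> norm x \<Longrightarrow> weight chi x = norm x"
  unfolding cutoff_def weight_def by (elim conjE) simp

lemma weight_ge_1:
  assumes "cutoff chi" shows "1 \<le> weight chi x"
proof (cases "norm x \<le> 1")
  case True
  then have "chi (norm x) = 1" using assms unfolding cutoff_def by blast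
  then show ?thesis by (simp add: weight_def)
next
  case False
  then have "1 * (1 - chi (norm x)) \<le> norm x * (1 - chi (norm x))"
    using cutoff_bounds[OF assms] by (intro mult_right_mono) auto
  then show ?thesis by (simp add: weight_def)
qed

lemma continuous_on_weight:
  assumes "cutoff chi" shows "continuous_on UNIV (weight chi)"
  unfolding weight_def[abs_def]
  by (intro continuous_intros continuous_on_compose2[OF cutoff_continuous[OF assms]]) auto

lemma inverse_norm_has_derivative:
  fixes x :: "'a::euclidean_space"
  assumes "x \<noteq> 0"
  shows "((\<lambda>y. inverse (norm y)) has_derivative (\<lambda>h. - (h \<bullet> x) / norm x ^ 3)) (at x)"
proof -
  have "((\<lambda>y. inverse (norm y)) has_derivative (\<lambda>h. (h \<bullet> sgn x) * (- (inverse (norm x) ^ Suc (Suc 0))))) (at x)"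
    using assms by (intro DERIV_compose_FDERIV[OF DERIV_inverse has_derivative_norm]) auto
  then show ?thesis
  proof (rule has_derivative_eq_rhs)
    have "inverse r * a * - (inverse r ^ Suc (Suc 0)) = - a / r ^ 3" if "r \<noteq> 0" for a r :: real
      using that by (simp add: field_simps power3_eq_cube)
    then show "(\<lambda>h. (h \<bullet> sgn x) * (- (inverse (norm x) ^ Suc (Suc 0)))) = (\<lambda>h. - (h \<bullet> x) / norm x ^ 3)"
      using assms by (simp add: sgn_div_norm)
  qed
qed

lemma partial_deriv_local:
  assumes "open S" "x \<in> S" "\<And>y. y \<in> S \<Longrightarrow> u y = g y" "(g has_derivative D) (at x)"
  shows "partial_deriv b u x = D b"
  by (rule partial_deriv_eqI, rule has_derivative_transform_within_open[OF assms(4,1,2)]) (simp add: assms(3))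

text \<open>Here the weight is the norm, with Laplacian \<open>(d - 1) / r\<close>, and its gradient is the radial unit vector.\<close>

lemma effective_potential_outside:
  fixes x :: "'a::euclidean_space"
  assumes chi: "cutoff chi" and x: "2 < norm x"
  shows "effective_potential chi V x = V x + complex_of_real
    (1/8 * ((real DIM('a) - 1) / norm x)\<^sup>2 - 1/4 * ((real DIM('a) - 1) / (norm x)\<^sup>2))"
proof -
  define S where "S = {y::'a. 2 < norm y}"
  have S: "open S" unfolding S_def by (intro open_Collect_less continuous_intros)
  define n where "n = real DIM('a) - 1"
  have sumsq: "(\<Sum>b\<in>Basis. (y \<bullet> b)\<^sup>2) = (norm y)\<^sup>2" for y :: 'a
    unfolding power2_norm_eq_inner by (subst euclidean_inner) (simp add: power2_eq_square)
  have w: "weight chi y = norm y" if "y \<in> S" for y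
    using that weight_outside[OF chi, of y] by (simp add: S_def)
  have 1: "partial_deriv b (weight chi) y = (y \<bullet> b) * inverse (norm y)" if "y \<in> S" for y b :: 'a
  proof -
    have "y \<noteq> 0" using that by (auto simp: S_def)
    then show ?thesis
      using partial_deriv_local[OF S that w has_derivative_norm, of b]
      by (simp add: sgn_div_norm inner_commute)
  qed
  have 2: "partial_deriv b (partial_deriv b (weight chi)) y = (b \<bullet> b) * inverse (norm y) - (y \<bullet> b)\<^sup>2 / norm y ^ 3"
    if "y \<in> S" for y b :: 'a
  proof -
    have "y \<noteq> 0" using that by (auto simp: S_def)
    have "((\<lambda>y. (y \<bullet> b) * inverse (norm y)) has_derivative
        (\<lambda>h. (y \<bullet> b) * (- (h \<bullet> y) / norm y ^ 3) + (h \<bullet> b) * inverse (norm y))) (at y)"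
      by (intro has_derivative_mult inverse_norm_has_derivative \<open>y \<noteq> 0\<close> bounded_linear_imp_has_derivative bounded_linear_inner_left)
    from partial_deriv_local[OF S that 1 this, of b] show ?thesis
      by (simp add: power2_eq_square inner_commute)
  qed
  have lap: "laplacian (weight chi) y = n * inverse (norm y)" if "y \<in> S" for y
  proof -
    have "y \<noteq> 0" using that by (auto simp: S_def)
    have "laplacian (weight chi) y = (\<Sum>b\<in>Basis. inverse (norm y) - (y \<bullet> b)\<^sup>2 / norm y ^ 3)"
      unfolding laplacian_def using 2[OF that] by (intro sum.cong) (auto simp: inner_Basis)
    also have "\<dots> = real DIM('a) * inverse (norm y) - (norm y)\<^sup>2 / norm y ^ 3"
      by (simp add: sum_subtractf sum_divide_distrib[symmetric] sumsq)
    also have "\<dots> = n * inverse (norm y)"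
      using \<open>y \<noteq> 0\<close> by (simp add: n_def field_simps power2_eq_square power3_eq_cube)
    finally show ?thesis .
  qed
  have xS: "x \<in> S" and x0: "x \<noteq> 0" using x by (auto simp: S_def)
  have 3: "partial_deriv b (laplacian (weight chi)) x = n * (- (b \<bullet> x) / norm x ^ 3)" for b
    by (rule partial_deriv_local[OF S xS], erule lap) (intro has_derivative_mult_right inverse_norm_has_derivative x0)
  have "grad_along (weight chi) (laplacian (weight chi)) x = (\<Sum>b\<in>Basis. - n / norm x ^ 4 * (x \<bullet> b)\<^sup>2)"
    unfolding grad_along_def 3 using 1[OF xS] x0
    by (intro sum.cong refl)
       (simp add: inner_commute[of _ x] power2_eq_square power3_eq_cube power4_eq_xxxx field_simps)
  also have "\<dots> = - n / norm x ^ 4 * (norm x)\<^sup>2"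
    by (simp only: sum_distrib_left[symmetric] sumsq)
  also have "\<dots> = - (n / (norm x)\<^sup>2)"
    using x0 by (simp add: power2_eq_square power4_eq_xxxx)
  finally have grad: "grad_along (weight chi) (laplacian (weight chi)) x = - (n / (norm x)\<^sup>2)" .
  show ?thesis
    unfolding effective_potential_def lap[OF xS] grad n_def divide_inverse[of _ "norm x"] by simp
qed

text \<open>The correction terms are \<open>O(r^(-2))\<close>, and \<open>r^(-2) \<le> r^(-\<rho>)\<close> because \<open>\<rho> \<le> 1\<close>; the generous constant avoids a case distinction
  in the dimension.\<close>

lemma potential_bound:
  fixes x :: "'a::euclidean_space"
  assumes chi: "cutoff chi" and x: "2 < norm x" and \<rho>: "\<rho> \<le> 1"
    and q: "effective_potential chi V x = complex_of_real q2 + \<i> * complex_of_real r2"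
    and q2: "\<bar>q2\<bar> \<le> C * weight chi x powr (- \<rho>)" and r2: "\<bar>r2\<bar> \<le> C * weight chi x powr (- \<rho>)"
  shows "cmod (V x) \<le> (2 * C + (real DIM('a))\<^sup>2) * norm x powr (- \<rho>)"
proof -
  define n where "n = real DIM('a)"
  define e where "e = 1/8 * ((n - 1) / norm x)\<^sup>2 - 1/4 * ((n - 1) / (norm x)\<^sup>2)"
  have n: "1 \<le> n" by (simp add: n_def Suc_leI)
  have w: "weight chi x = norm x" using weight_outside[OF chi, of x] x by simp
  have "V x = complex_of_real q2 + \<i> * complex_of_real r2 - complex_of_real e"
    using effective_potential_outside[OF chi x, of V] q by (simp add: e_def n_def algebra_simps)
  then have "cmod (V x) \<le> cmod (complex_of_real q2 + \<i> * complex_of_real r2) + cmod (complex_of_real e)"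
    using norm_triangle_ineq4 by metis
  also have "cmod (complex_of_real q2 + \<i> * complex_of_real r2) \<le> \<bar>q2\<bar> + \<bar>r2\<bar>"
    by (rule order_trans[OF norm_triangle_ineq]) (simp add: norm_mult)
  finally have V: "cmod (V x) \<le> \<bar>q2\<bar> + \<bar>r2\<bar> + \<bar>e\<bar>" by simp
  have "\<bar>e\<bar> \<le> n\<^sup>2 / (norm x)\<^sup>2"
  proof -
    have e: "e = (1/8 * (n - 1)\<^sup>2 - 1/4 * (n - 1)) / (norm x)\<^sup>2"
    proof -
      have "1/8 * (A / B) - 1/4 * (D / B) = (1/8 * A - 1/4 * D) / B" for A B D :: real
        by (simp add: diff_divide_distrib)
      then show ?thesis unfolding e_def power_divide .
    qed
    have "\<bar>1/8 * (n - 1)\<^sup>2 - 1/4 * (n - 1)\<bar> \<le> n\<^sup>2"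
    proof -
      have "0 \<le> 1/8 * (n - 1)\<^sup>2" "0 \<le> 1/4 * (n - 1)" using n by auto
      moreover have "1/8 * (n - 1)\<^sup>2 \<le> n\<^sup>2"
      proof -
        have "1/8 * (n - 1)\<^sup>2 \<le> (n - 1)\<^sup>2" by simp
        also have "\<dots> \<le> n\<^sup>2" using n by (intro power_mono) auto
        finally show ?thesis .
      qed
      moreover have "1/4 * (n - 1) \<le> n\<^sup>2"
      proof -
        have "1/4 * (n - 1) \<le> n" using n by simp
        also have "\<dots> \<le> n\<^sup>2" using n by (simp add: power2_eq_square)
        finally show ?thesis .
      qed
      ultimately show ?thesis unfolding abs_le_iff by (smt (verit))
    qed
    then show ?thesis unfolding e abs_divide by (simp add: divide_right_mono)
  qed
  also have "\<dots> \<le> n\<^sup>2 * norm x powr (- \<rho>)"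
  proof -
    have "norm x powr (- 2) \<le> norm x powr (- \<rho>)" using x \<rho> by (intro powr_mono) auto
    moreover have "norm x powr (- 2) = 1 / (norm x)\<^sup>2" using x by (simp add: powr_minus_divide powr_numeral)
    ultimately have "1 / (norm x)\<^sup>2 \<le> norm x powr (- \<rho>)" by simp
    then have "n\<^sup>2 * (1 / (norm x)\<^sup>2) \<le> n\<^sup>2 * norm x powr (- \<rho>)" by (intro mult_left_mono) auto
    then show ?thesis by simp
  qed
  finally have "\<bar>e\<bar> \<le> n\<^sup>2 * norm x powr (- \<rho>)" .
  then show ?thesis using V q2 r2 unfolding w by (simp add: distrib_right n_def)
qed

section \<open>Lebesgue measurable solutions\<close>

lemma complex_borel_version:
  fixes f :: "'a::euclidean_space \<Rightarrow> complex"
  assumes "f \<in> borel_measurable lebesgue"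
  obtains g where "g \<in> borel_measurable borel" "AE x in lborel. f x = g x"
proof -
  have "(\<lambda>x. Re (f x)) \<in> borel_measurable (completion lborel)" "(\<lambda>x. Im (f x)) \<in> borel_measurable (completion lborel)"
    using assms by (auto intro: borel_measurable_Re borel_measurable_Im)
  then obtain a b where ab: "a \<in> borel_measurable lborel" "AE x in lborel. Re (f x) = a x"
    "b \<in> borel_measurable lborel" "AE x in lborel. Im (f x) = b x"
    using completion_ex_borel_measurable_real by metis
  have "AE x in lborel. f x = Complex (a x) (b x)"
    using ab(2,4) by eventually_elim (simp add: complex_eq_iff)
  moreover have "(\<lambda>x. Complex (a x) (b x)) \<in> borel_measurable borel"
    using ab(1,3) unfolding Complex_eq by (auto intro!: borel_measurable_add borel_measurable_times)
  ultimately show thesis using that by blast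
qed

lemma integral_lebesgue_eq_lborel:
  fixes f g :: "'a::euclidean_space \<Rightarrow> 'b::{banach,second_countable_topology}"
  assumes f: "f \<in> borel_measurable lebesgue" and g: "g \<in> borel_measurable borel" and eq: "AE x in lborel. f x = g x"
  shows "(LINT x|lebesgue. f x) = (LINT x|lborel. g x)"
    and "integrable lebesgue f \<longleftrightarrow> integrable lborel g"
proof -
  have g': "g \<in> borel_measurable lborel" using g by simp
  then have gl: "g \<in> borel_measurable lebesgue" by (rule measurable_completion)
  have AE: "AE x in lebesgue. f x = g x" using eq by (simp only: AE_completion_iff)
  show "(LINT x|lebesgue. f x) = (LINT x|lborel. g x)"
    using integral_cong_AE[OF f gl AE] integral_completion[OF g'] by simp
  show "integrable lebesgue f \<longleftrightarrow> integrable lborel g"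
    using integrable_cong_AE[OF f gl AE] integrable_completion[OF g'] by simp
qed

text \<open>Measurability of \<open>f\<close> is part of the conclusion because it is hidden in local integrability: \<open>f\<close> is the pointwise limit
  of its restrictions to balls. This is used for \<open>V \<phi>\<close>, where \<open>V\<close> itself is not known to be measurable.\<close>

lemma locally_integrable_borel_version:
  fixes f :: "'a::euclidean_space \<Rightarrow> complex"
  assumes "locally_integrable f"
  obtains g where "loc_int g" "AE x in lborel. f x = g x" "f \<in> borel_measurable lebesgue"
proof -
  have int: "integrable lebesgue (\<lambda>x. indicator (cball 0 M) x *\<^sub>R f x)" for M
    using assms by (auto simp: locally_integrable_def set_integrable_def)
  have mf: "f \<in> borel_measurable lebesgue"
  proof (rule borel_measurable_LIMSEQ_metric)
    show "(\<lambda>x. indicator (cball 0 (real n)) x *\<^sub>R f x) \<in> borel_measurable lebesgue" for n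
      using int by (rule borel_measurable_integrable)
    show "(\<lambda>n. indicator (cball 0 (real n)) x *\<^sub>R f x) \<longlonglongrightarrow> f x" for x
    proof -
      obtain N :: nat where "norm x \<le> real N" using real_arch_simple by blast
      then have "indicator (cball 0 (real n)) x *\<^sub>R f x = f x" if "N \<le> n" for n
        using that by (simp add: indicator_def)
      then show ?thesis by (intro tendsto_eventually eventually_sequentiallyI)
    qed
  qed
  obtain g where g: "g \<in> borel_measurable borel" "AE x in lborel. f x = g x"
    using complex_borel_version[OF mf] by blast
  have "integrable lborel (\<lambda>x. indicator (cball 0 M) x *\<^sub>R g x)" for M
  proof (subst integral_lebesgue_eq_lborel(2)[symmetric])
    show "(\<lambda>x. indicator (cball 0 M) x *\<^sub>R f x) \<in> borel_measurable lebesgue"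
      using int by (rule borel_measurable_integrable)
    show "(\<lambda>x. indicator (cball 0 M) x *\<^sub>R g x) \<in> borel_measurable borel"
      using g(1) by (intro borel_measurable_scaleR borel_measurable_indicator) auto
    show "AE x in lborel. indicator (cball 0 M) x *\<^sub>R f x = indicator (cball 0 M) x *\<^sub>R g x"
      using g(2) by eventually_elim simp
  qed (rule int)
  then have "loc_int g" using g(1) by (simp add: loc_int_def set_integrable_def)
  then show thesis using that g(2) mf by blast
qed

lemma test_function_continuous_vanish:
  assumes \<psi>: "test_function \<psi>"
  obtains M where "continuous_on UNIV \<psi>" "continuous_on UNIV (laplacian \<psi>)"
    "\<And>x. M < norm x \<Longrightarrow> \<psi> x = 0" "\<And>x. M < norm x \<Longrightarrow> laplacian \<psi> x = 0"
proof -
  have C: "Ck k \<psi>" for k using \<psi> by (simp add: test_function_def smooth_def)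
  have "bounded {x. \<psi> x \<noteq> 0}"
    using \<psi> bounded_subset[OF compact_imp_bounded closure_subset] by (auto simp: test_function_def)
  then obtain M where M: "\<And>x. \<psi> x \<noteq> 0 \<Longrightarrow> norm x \<le> M" unfolding bounded_iff by blast
  then have v: "\<psi> x = 0" if "M < norm x" for x using that by (meson not_le)
  have D1: "C1_along b \<psi> (partial_deriv b \<psi>)"
    and D2: "C1_along b (partial_deriv b \<psi>) (partial_deriv b (partial_deriv b \<psi>))" if "b \<in> Basis" for b
    using C[of "Suc (Suc 0)"] that Ck_imp_C1_along[of 0 "partial_deriv b \<psi>" b] Ck_imp_C1_along[of "Suc 0" \<psi> b] by auto
  have "partial_deriv b \<psi> x = 0" if "b \<in> Basis" "M < norm x" for b x
    by (rule C1_along_vanish[OF D1[OF that(1)] v that(2)])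
  then have "partial_deriv b (partial_deriv b \<psi>) x = 0" if "b \<in> Basis" "M < norm x" for b x
    using C1_along_vanish[OF D2[OF that(1)] _ that(2)] that(1) by blast
  then have "laplacian \<psi> x = 0" if "M < norm x" for x using that by (simp add: laplacian_def)
  moreover have "continuous_on UNIV (laplacian \<psi>)"
    unfolding laplacian_def[abs_def] using D2 by (intro continuous_on_sum) (simp add: C1_along_def)
  moreover have "continuous_on UNIV \<psi>" using C[of 0] by simp
  ultimately show thesis using that v by blast
qed

lemma loc_int_mult_continuous:
  assumes "loc_int u" "continuous_on UNIV k" "\<And>x. M < norm x \<Longrightarrow> k x = 0"
  shows "integrable lborel (\<lambda>x. u x * k x)"
proof -
  obtain B where "\<And>x. cmod (k x) \<le> B" using continuous_vanish_imp_bounded[OF assms(2,3)] by blast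
  then have "integrable lborel (\<lambda>x. k x * u x)"
    using assms by (intro loc_int_mult[of u k B M]) (auto intro: borel_measurable_continuous_onI)
  then show ?thesis by (simp add: mult.commute)
qed

text \<open>The equation multiplied by \<open>- 2\<close>, with Borel representatives of \<open>\<phi>\<close> and \<open>V \<phi>\<close>.\<close>

lemma distributional_solution_imp_weak_solution:
  fixes \<phi> :: "'a::euclidean_space \<Rightarrow> complex"
  assumes sol: "distributional_solution V z \<phi>"
    and u: "loc_int u" "AE x in lborel. \<phi> x = u x" "\<phi> \<in> borel_measurable lebesgue"
    and G: "loc_int G" "AE x in lborel. V x * \<phi> x = G x" "(\<lambda>x. V x * \<phi> x) \<in> borel_measurable lebesgue"
    and k: "k\<^sup>2 = 2 * z"
  shows "weak_solution k (\<lambda>x. 2 * G x) u"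
  unfolding weak_solution_def
proof (intro allI impI)
  fix \<psi> :: "'a \<Rightarrow> complex" assume \<psi>: "test_function \<psi>"
  obtain M where M: "continuous_on UNIV \<psi>" "continuous_on UNIV (laplacian \<psi>)"
    "\<And>x. M < norm x \<Longrightarrow> \<psi> x = 0" "\<And>x. M < norm x \<Longrightarrow> laplacian \<psi> x = 0"
    using test_function_continuous_vanish[OF \<psi>] by blast
  have m: "\<psi> \<in> borel_measurable borel" "laplacian \<psi> \<in> borel_measurable borel"
    using M(1,2) by (auto intro: borel_measurable_continuous_onI)
  have ml: "\<psi> \<in> borel_measurable lebesgue" "laplacian \<psi> \<in> borel_measurable lebesgue"
    using m by (auto intro!: measurable_completion)
  have mu: "u \<in> borel_measurable borel" "G \<in> borel_measurable borel" using u(1) G(1) by (auto simp: loc_int_def)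
  have i1: "integrable lborel (\<lambda>x. u x * (laplacian \<psi> x + k\<^sup>2 * \<psi> x))"
    using M by (intro loc_int_mult_continuous[OF u(1), where M = M] continuous_intros) auto
  have i2: "integrable lborel (\<lambda>x. G x * \<psi> x)"
    using M by (intro loc_int_mult_continuous[OF G(1), where M = M]) auto
  define A where "A = (LINT x|lborel. u x * (laplacian \<psi> x + k\<^sup>2 * \<psi> x))"
  define B where "B = (LINT x|lborel. G x * \<psi> x)"
  have eq: "\<phi> x * (schroedinger V \<psi> x - z * \<psi> x) = - (1/2) * (\<phi> x * (laplacian \<psi> x + k\<^sup>2 * \<psi> x)) + (V x * \<phi> x) * \<psi> x" for x
    by (simp add: schroedinger_def k algebra_simps)
  have "0 = (LINT x|lebesgue. \<phi> x * (schroedinger V \<psi> x - z * \<psi> x))"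
    using sol \<psi> by (simp add: distributional_solution_def)
  also have "\<dots> = (LINT x|lebesgue. - (1/2) * (\<phi> x * (laplacian \<psi> x + k\<^sup>2 * \<psi> x)) + (V x * \<phi> x) * \<psi> x)"
    by (simp only: eq)
  also have "\<dots> = (LINT x|lborel. - (1/2) * (u x * (laplacian \<psi> x + k\<^sup>2 * \<psi> x)) + G x * \<psi> x)"
  proof (rule integral_lebesgue_eq_lborel(1))
    show "(\<lambda>x. - (1/2) * (\<phi> x * (laplacian \<psi> x + k\<^sup>2 * \<psi> x)) + (V x * \<phi> x) * \<psi> x) \<in> borel_measurable lebesgue"
      by (intro borel_measurable_add borel_measurable_times[OF borel_measurable_const]
          borel_measurable_times[OF u(3)] borel_measurable_times[OF G(3)] ml)
    show "(\<lambda>x. - (1/2) * (u x * (laplacian \<psi> x + k\<^sup>2 * \<psi> x)) + G x * \<psi> x) \<in> borel_measurable borel"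
      using mu m by (intro borel_measurable_add borel_measurable_times borel_measurable_const)
    show "AE x in lborel. - (1/2) * (\<phi> x * (laplacian \<psi> x + k\<^sup>2 * \<psi> x)) + (V x * \<phi> x) * \<psi> x
        = - (1/2) * (u x * (laplacian \<psi> x + k\<^sup>2 * \<psi> x)) + G x * \<psi> x"
      using u(2) G(2) by eventually_elim simp
  qed
  also have "\<dots> = - (1/2) * A + B"
  proof -
    have "(LINT x|lborel. - (1/2) * (u x * (laplacian \<psi> x + k\<^sup>2 * \<psi> x))) = - (1/2) * A"
      unfolding A_def by (rule Bochner_Integration.integral_mult_right) (rule i1)
    then show ?thesis
      unfolding Bochner_Integration.integral_add[OF integrable_mult_right[OF i1] i2] B_def by (rule arg_cong)
  qed
  finally have "0 = - (1/2) * A + B" .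
  moreover have "A - 2 * B = - 2 * (- (1/2) * A + B)" by (simp add: algebra_simps)
  ultimately have "A = 2 * B" by (metis eq_iff_diff_eq_0 mult_zero_right)
  also have "\<dots> = (LINT x|lborel. 2 * (G x * \<psi> x))"
    unfolding B_def by (rule Bochner_Integration.integral_mult_right[symmetric]) (rule i2)
  finally show "(LINT x|lborel. u x * (laplacian \<psi> x + k\<^sup>2 * \<psi> x)) = (LINT x|lborel. 2 * G x * \<psi> x)"
    by (simp only: A_def mult.assoc)
qed

section \<open>The decay theorem\<close>

text \<open>Lowering \<open>t\<close> by \<open>\<rho> / (1 - \<rho>)\<close> gains the factor \<open>e^(2y)\<close> with \<open>y = \<rho> r^(1-\<rho>) / (1 - \<rho>) \<ge> \<rho> ln r\<close>, which outweighs \<open>r\<^sup>\<rho>\<close>; in the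
  hypothesis on growth the same shift goes in the harmless direction.\<close>

lemma phase_shift:
  assumes "0 < \<rho>" "\<rho> < 1" "1 \<le> r"
  shows "(exp (phase m t \<rho> r))\<^sup>2 \<le> r powr (- \<rho>) * (exp (phase m (t - \<rho> / (1 - \<rho>)) \<rho> r))\<^sup>2"
    and "exp (- 2 * phase m (t - \<rho> / (1 - \<rho>)) \<rho> r) \<le> exp (- 2 * phase m t \<rho> r)"
proof -
  define y where "y = \<rho> / (1 - \<rho>) * r powr (1 - \<rho>)"
  have y: "0 \<le> y" using assms by (simp add: y_def)
  have p: "phase m (t - \<rho> / (1 - \<rho>)) \<rho> r = phase m t \<rho> r + y"
    using assms by (simp add: phase_def y_def max_def algebra_simps)
  have "ln r \<le> r powr (1 - \<rho>) / (1 - \<rho>)" using assms by (intro ln_powr_bound) auto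
  then have "\<rho> * ln r \<le> y" using mult_left_mono[of "ln r" "r powr (1 - \<rho>) / (1 - \<rho>)" \<rho>] assms by (simp add: y_def)
  then have "\<rho> * ln r \<le> 2 * y" using y by linarith
  then have "exp (\<rho> * ln r) \<le> exp (2 * y)" by simp
  then have "1 \<le> exp (- \<rho> * ln r) * exp (2 * y)" by (simp add: exp_minus field_simps)
  also have "exp (- \<rho> * ln r) = r powr (- \<rho>)" using assms by (simp add: powr_def)
  finally have "1 * (exp (phase m t \<rho> r))\<^sup>2 \<le> r powr (- \<rho>) * exp (2 * y) * (exp (phase m t \<rho> r))\<^sup>2"
    by (intro mult_right_mono) auto
  moreover have "(exp (phase m t \<rho> r + y))\<^sup>2 = exp (2 * y) * (exp (phase m t \<rho> r))\<^sup>2"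
    by (simp add: exp_add power_mult_distrib exp_double)
  ultimately show "(exp (phase m t \<rho> r))\<^sup>2 \<le> r powr (- \<rho>) * (exp (phase m (t - \<rho> / (1 - \<rho>)) \<rho> r))\<^sup>2"
    unfolding p by (simp add: mult.assoc)
  show "exp (- 2 * phase m (t - \<rho> / (1 - \<rho>)) \<rho> r) \<le> exp (- 2 * phase m t \<rho> r)"
    unfolding p using y by simp
qed

lemma weight_phase:
  assumes "cutoff chi" "2 \<le> norm x"
  shows "m * weight chi x - t * weight chi x powr (1 - \<rho>) = phase m t \<rho> (norm x)"
  using assms(2) by (simp add: weight_outside[OF assms] phase_def max_def)

lemma L2_locI:
  assumes u: "u \<in> borel_measurable borel" and a: "continuous_on UNIV a" "\<And>x. 0 < a x"
    and int: "integrable lborel (\<lambda>x. a x * (cmod (u x))\<^sup>2)"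
  shows "L2_loc u"
  unfolding L2_loc_def L2_def
proof (intro allI conjI)
  fix M
  have m: "(\<lambda>x. indicator (cball 0 M) x *\<^sub>R u x) \<in> borel_measurable borel"
    using u by (intro borel_measurable_scaleR borel_measurable_indicator) auto
  then show "(\<lambda>x. indicator (cball 0 M) x *\<^sub>R u x) \<in> borel_measurable borel" .
  have "a x \<noteq> 0" for x using a(2)[of x] by simp
  then have "continuous_on UNIV (\<lambda>x. 1 / a x)" using a(1) by (intro continuous_intros) auto
  then have "bounded ((\<lambda>x. 1 / a x) ` cball 0 M)"
    by (intro compact_imp_bounded compact_continuous_image) (auto intro: continuous_on_subset)
  then obtain B where B: "\<forall>x\<in>cball 0 M. norm (1 / a x) \<le> B" unfolding bounded_iff by auto
  show "integrable lborel (\<lambda>x. (cmod (indicator (cball 0 M) x *\<^sub>R u x))\<^sup>2)"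
  proof (rule Bochner_Integration.integrable_bound)
    show "integrable lborel (\<lambda>x. B * (a x * (cmod (u x))\<^sup>2))" using int by simp
    show "(\<lambda>x. (cmod (indicator (cball 0 M) x *\<^sub>R u x))\<^sup>2) \<in> borel_measurable lborel"
      using measurable_compose[OF m borel_measurable_norm] by simp
    show "AE x in lborel. norm ((cmod (indicator (cball 0 M) x *\<^sub>R u x))\<^sup>2) \<le> norm (B * (a x * (cmod (u x))\<^sup>2))"
    proof (rule AE_I2)
      fix x
      show "norm ((cmod (indicator (cball 0 M) x *\<^sub>R u x))\<^sup>2) \<le> norm (B * (a x * (cmod (u x))\<^sup>2))"
      proof (cases "norm x \<le> M")
        case True
        then have "norm (1 / a x) \<le> B" using B by simp
        then have "1 / a x \<le> B" using a(2)[of x] by simp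
        then have "1 \<le> B * a x" using a(2)[of x] by (simp add: divide_le_eq)
        then have "1 * (cmod (u x))\<^sup>2 \<le> (B * a x) * (cmod (u x))\<^sup>2" by (rule mult_right_mono) simp
        then show ?thesis using True by (simp add: mult.assoc)
      qed simp
    qed
  qed
qed

text \<open>Local square integrability covers the ball, so only the behaviour at infinity has to be controlled.\<close>

lemma integrable_split_ball:
  fixes w :: "'a::euclidean_space \<Rightarrow> complex"
  assumes w: "w \<in> borel_measurable borel" "L2_loc w" and a: "continuous_on UNIV a" "\<And>x. 0 \<le> a x"
    and h: "integrable lborel h" "\<And>x. R \<le> norm x \<Longrightarrow> a x * (cmod (w x))\<^sup>2 \<le> h x" "\<And>x. 0 \<le> h x"
  shows "integrable lborel (\<lambda>x. a x * (cmod (w x))\<^sup>2)"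
proof (rule Bochner_Integration.integrable_bound)
  show "integrable lborel (\<lambda>x. indicator (cball 0 R) x * (a x * (cmod (w x))\<^sup>2) + h x)"
    by (intro Bochner_Integration.integrable_add loc_square_integrable_bounded w a h)
  show "(\<lambda>x. a x * (cmod (w x))\<^sup>2) \<in> borel_measurable lborel"
    using w(1) borel_measurable_continuous_onI[OF a(1)] by simp
  show "AE x in lborel. norm (a x * (cmod (w x))\<^sup>2) \<le> norm (indicator (cball 0 R) x * (a x * (cmod (w x))\<^sup>2) + h x)"
  proof (rule AE_I2)
    fix x
    show "norm (a x * (cmod (w x))\<^sup>2) \<le> norm (indicator (cball 0 R) x * (a x * (cmod (w x))\<^sup>2) + h x)"
      using a(2)[of x] h(2,3)[of x] by (cases "norm x \<le> R") auto
  qed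
qed

text \<open>The theorem for an arbitrary potential that satisfies the decay bound outside a ball, with the condition on \<open>t\<close> made explicit.\<close>

lemma weighted_solution_decays:
  fixes V \<phi> :: "'a::euclidean_space \<Rightarrow> complex"
  assumes chi: "cutoff chi" and \<rho>: "0 < \<rho>" "\<rho> < 1" and Q: "0 < Q"
    and V: "AE x in lebesgue. 2 < norm x \<longrightarrow> 2 * cmod (V x) \<le> Q * norm x powr (- \<rho>)"
    and k: "k\<^sup>2 = 2 * z" and m: "0 < Im k"
    and t: "0 < t - \<rho> / (1 - \<rho>)" "Q + 1 \<le> cmod k * ((t - \<rho> / (1 - \<rho>)) * (1 - \<rho>))"
    and \<phi>: "\<phi> \<in> weighted_L_two chi \<rho> (Im k) (- t)" and sol: "distributional_solution V z \<phi>"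
  shows "\<phi> \<in> weighted_L_two chi \<rho> (- Im k) t"
proof -
  define s where "s = t - \<rho> / (1 - \<rho>)"
  define p where "p x = Im k * weight chi x - t * weight chi x powr (1 - \<rho>)" for x :: 'a
  have cw: "continuous_on UNIV (weight chi :: 'a \<Rightarrow> real)" by (rule continuous_on_weight[OF chi])
  have "weight chi x \<noteq> 0" for x :: 'a using weight_ge_1[OF chi, of x] by simp
  then have cp: "continuous_on UNIV p" unfolding p_def using cw by (intro continuous_intros) auto
  have p_phase: "p x = phase (Im k) t \<rho> (norm x)" if "2 \<le> norm x" for x
    using weight_phase[OF chi that] by (simp add: p_def)
  have cph: "continuous_on UNIV (\<lambda>x::'a. phase (Im k) s \<rho> (norm x))"
    by (intro continuous_on_compose2[OF continuous_on_phase] continuous_intros) auto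
  obtain w where w: "w \<in> L_two" and \<phi>w: "\<phi> = (\<lambda>x. complex_of_real (exp (p x)) * w x)"
    using \<phi> by (auto simp: weighted_L_two_def p_def)
  have wn: "(cmod (w x))\<^sup>2 = exp (- 2 * p x) * (cmod (\<phi> x))\<^sup>2" for x
  proof -
    have "exp (- 2 * p x) * (exp (p x))\<^sup>2 = 1" by (simp add: exp_double[symmetric] mult_exp_exp)
    then show ?thesis by (simp add: \<phi>w norm_mult power_mult_distrib mult.assoc[symmetric])
  qed
  obtain u where u: "loc_int u" "AE x in lborel. \<phi> x = u x" and m\<phi>: "\<phi> \<in> borel_measurable lebesgue"
    using sol locally_integrable_borel_version unfolding distributional_solution_def by metis
  obtain G where G: "loc_int G" "AE x in lborel. V x * \<phi> x = G x" "(\<lambda>x. V x * \<phi> x) \<in> borel_measurable lebesgue"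
    using sol locally_integrable_borel_version unfolding distributional_solution_def by metis
  have mu: "u \<in> borel_measurable borel" using u(1) by (simp add: loc_int_def)
  have transfer: "integrable lebesgue (\<lambda>x. a x * (cmod (\<phi> x))\<^sup>2) \<longleftrightarrow> integrable lborel (\<lambda>x. a x * (cmod (u x))\<^sup>2)"
    if a: "continuous_on UNIV a" for a :: "'a \<Rightarrow> real"
  proof (rule integral_lebesgue_eq_lborel(2))
    have ma: "a \<in> borel_measurable borel" using a by (rule borel_measurable_continuous_onI)
    then have ml: "a \<in> borel_measurable lebesgue" by (intro measurable_completion) simp
    show "(\<lambda>x. a x * (cmod (\<phi> x))\<^sup>2) \<in> borel_measurable lebesgue"
      by (intro borel_measurable_times borel_measurable_power measurable_compose[OF m\<phi> borel_measurable_norm] ml)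
    show "(\<lambda>x. a x * (cmod (u x))\<^sup>2) \<in> borel_measurable borel"
      by (intro borel_measurable_times borel_measurable_power measurable_compose[OF mu borel_measurable_norm] ma)
    show "AE x in lborel. a x * (cmod (\<phi> x))\<^sup>2 = a x * (cmod (u x))\<^sup>2"
      using u(2) by eventually_elim simp
  qed
  have "integrable lebesgue (\<lambda>x. exp (- 2 * p x) * (cmod (\<phi> x))\<^sup>2)"
    using w by (simp only: L_two_def wn[symmetric]) blast
  then have init0: "integrable lborel (\<lambda>x. exp (- 2 * p x) * (cmod (u x))\<^sup>2)"
    by (subst (asm) transfer) (intro continuous_intros cp)
  have u2: "L2_loc u"
    by (rule L2_locI[OF mu _ _ init0]) (auto intro!: continuous_intros cp)
  have init: "integrable lborel (\<lambda>x. exp (- 2 * phase (Im k) s \<rho> (norm x)) * (cmod (u x))\<^sup>2)"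
  proof (rule integrable_split_ball[OF mu u2 _ _ init0])
    show "continuous_on UNIV (\<lambda>x::'a. exp (- 2 * phase (Im k) s \<rho> (norm x)))" by (intro continuous_intros cph)
    show "exp (- 2 * phase (Im k) s \<rho> (norm x)) * (cmod (u x))\<^sup>2 \<le> exp (- 2 * p x) * (cmod (u x))\<^sup>2" if "2 \<le> norm x" for x
      using phase_shift(2)[OF \<rho>, of "norm x"] that unfolding p_phase[OF that] s_def by (intro mult_right_mono) auto
  qed auto
  have dom: "AE x in lborel. 2 < norm x \<longrightarrow> cmod (2 * G x) \<le> Q * max 1 (norm x) powr (- \<rho>) * cmod (u x)"
  proof -
    have "AE x in lborel. 2 < norm x \<longrightarrow> 2 * cmod (V x) \<le> Q * norm x powr (- \<rho>)" using V by (simp only: AE_completion_iff)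
    then show ?thesis using u(2) G(2)
    proof eventually_elim
      case (elim x)
      show ?case
      proof
        assume x: "2 < norm x"
        then have "2 * cmod (V x) * cmod (u x) \<le> Q * norm x powr (- \<rho>) * cmod (u x)"
          using elim(1) by (intro mult_right_mono) auto
        then show "cmod (2 * G x) \<le> Q * max 1 (norm x) powr (- \<rho>) * cmod (u x)"
          using x elim(2) by (simp add: elim(3)[symmetric] norm_mult max_def)
      qed
    qed
  qed
  have G2: "loc_int (\<lambda>x. 2 * G x)"
  proof -
    have "integrable lborel (\<lambda>x. 2 * (indicator (cball 0 M) x *\<^sub>R G x))" for M
      using G(1) by (intro integrable_mult_right) (auto simp: loc_int_def set_integrable_def)
    moreover have "(\<lambda>x. 2 * G x) \<in> borel_measurable borel"
      using G(1) by (intro borel_measurable_times[OF borel_measurable_const]) (simp add: loc_int_def)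
    ultimately show ?thesis by (simp add: loc_int_def set_integrable_def)
  qed
  have weak: "weak_solution k (\<lambda>x. 2 * G x) u"
    by (rule distributional_solution_imp_weak_solution[OF sol u m\<phi> G k])
  obtain R where R: "2 < R" and decay: "integrable lborel (\<lambda>x. indicator {x. R \<le> norm x} x *
        (max 1 (norm x) powr (- \<rho>) * (exp (phase (Im k) s \<rho> (norm x)))\<^sup>2 * (cmod (u x))\<^sup>2))"
    using weak_solution_decay[OF chi u(1) u2 G2 weak dom Q t(1) \<rho> m t(2) init[unfolded s_def]] unfolding s_def by blast
  have "integrable lborel (\<lambda>x. (exp (p x))\<^sup>2 * (cmod (u x))\<^sup>2)"
  proof (rule integrable_split_ball[OF mu u2 _ _ decay])
    show "continuous_on UNIV (\<lambda>x. (exp (p x))\<^sup>2)" by (intro continuous_intros cp)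
    show "(exp (p x))\<^sup>2 * (cmod (u x))\<^sup>2 \<le> indicator {x. R \<le> norm x} x *
        (max 1 (norm x) powr (- \<rho>) * (exp (phase (Im k) s \<rho> (norm x)))\<^sup>2 * (cmod (u x))\<^sup>2)" if "R \<le> norm x" for x
    proof -
      have "(exp (p x))\<^sup>2 \<le> norm x powr (- \<rho>) * (exp (phase (Im k) s \<rho> (norm x)))\<^sup>2"
        using phase_shift(1)[OF \<rho>, of "norm x"] p_phase[of x] that R by (simp add: s_def)
      then have "(exp (p x))\<^sup>2 * (cmod (u x))\<^sup>2 \<le> norm x powr (- \<rho>) * (exp (phase (Im k) s \<rho> (norm x)))\<^sup>2 * (cmod (u x))\<^sup>2"
        by (rule mult_right_mono) simp
      then show ?thesis using that R by (simp add: max_def)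
    qed
  qed (auto simp: indicator_def)
  then have int: "integrable lebesgue (\<lambda>x. (exp (p x))\<^sup>2 * (cmod (\<phi> x))\<^sup>2)"
    by (subst transfer) (intro continuous_intros cp)
  define v where "v x = complex_of_real (exp (p x)) * \<phi> x" for x
  have "(\<lambda>x. complex_of_real (exp (p x))) \<in> borel_measurable borel"
    using cp by (intro borel_measurable_continuous_onI continuous_intros)
  then have "(\<lambda>x. complex_of_real (exp (p x))) \<in> borel_measurable lebesgue" by (intro measurable_completion) simp
  then have "v \<in> borel_measurable lebesgue" unfolding v_def using m\<phi> by (rule borel_measurable_times)
  moreover have "integrable lebesgue (\<lambda>x. (cmod (v x))\<^sup>2)" using int by (simp add: v_def norm_mult power_mult_distrib)
  ultimately have v: "v \<in> L_two" by (simp add: L_two_def)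
  have "\<phi> x = complex_of_real (exp (- Im k * weight chi x + t * weight chi x powr (1 - \<rho>))) * v x" for x
  proof -
    have "exp (- Im k * weight chi x + t * weight chi x powr (1 - \<rho>)) * exp (p x) = 1"
      by (simp add: p_def mult_exp_exp)
    then show ?thesis unfolding v_def by (simp only: mult.assoc[symmetric] of_real_mult[symmetric]) simp
  qed
  then show ?thesis using v unfolding weighted_L_two_def by blast
qed

theorem theorem1p3:
  fixes chi :: "real \<Rightarrow> real"
    and V :: "real ^ 'd \<Rightarrow> complex"
    and q\<^sub>2 r\<^sub>2 :: "real ^ 'd \<Rightarrow> real"
    and \<rho> C lam \<mu> :: real
    and \<kappa> :: complex
  assumes "cutoff chi"
    and "0 < \<rho>" and "\<rho> < 1" and "C > 0"
    and "q\<^sub>2 \<in> L_infinity" and "r\<^sub>2 \<in> L_infinity"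
    and "AE x in lebesgue. effective_potential chi V x = complex_of_real (q\<^sub>2 x) + \<i> * complex_of_real (r\<^sub>2 x)"
    and "AE x in lebesgue. \<bar>q\<^sub>2 x\<bar> \<le> C * weight chi x powr (- \<rho>)"
    and "AE x in lebesgue. \<bar>r\<^sub>2 x\<bar> \<le> C * weight chi x powr (- \<rho>)"
    and "\<kappa> = complex_of_real lam + \<i> * complex_of_real \<mu>" and "\<mu> > 0"
  shows "\<exists>t\<^sub>0\<ge>1. \<forall>t\<ge>t\<^sub>0. \<forall>\<phi> :: real ^ 'd \<Rightarrow> complex.
           \<phi> \<in> weighted_L_two chi \<rho> (sqrt 2 * \<mu>) (- t) \<longrightarrow>
           distributional_solution V (\<kappa>\<^sup>2) \<phi> \<longrightarrow>
           \<phi> \<in> weighted_L_two chi \<rho> (- (sqrt 2 * \<mu>)) t"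
proof -
  define k where "k = complex_of_real (sqrt 2) * \<kappa>"
  define Q where "Q = 2 * (2 * C + (real DIM(real ^ 'd))\<^sup>2)"
  have k: "k\<^sup>2 = 2 * \<kappa>\<^sup>2"
    unfolding k_def power_mult_distrib by (simp flip: of_real_power)
  have Im_k: "Im k = sqrt 2 * \<mu>" using assms(10) by (simp add: k_def)
  have m: "0 < Im k" using assms(11) by (simp add: Im_k)
  have k0: "0 < cmod k" using m by auto
  have Q: "0 < Q" using assms(4) by (simp add: Q_def add_pos_nonneg)
  have V: "AE x in lebesgue. 2 < norm x \<longrightarrow> 2 * cmod (V x) \<le> Q * norm x powr (- \<rho>)"
    using assms(7-9)
  proof eventually_elim
    case (elim x)
    show ?case
      using potential_bound[OF assms(1) _ less_imp_le[OF assms(3)] elim] by (auto simp: Q_def algebra_simps)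
  qed
  \<comment> \<open>The value of \<open>t\<close> at which the gain \<open>|k| (t - \<rho> / (1 - \<rho>)) (1 - \<rho>)\<close> reaches \<open>Q + 1\<close>.\<close>
  define t0 where "t0 = max 1 (\<rho> / (1 - \<rho>) + (Q + 1) / (cmod k * (1 - \<rho>)))"
  show ?thesis
  proof (intro exI[of _ t0] conjI allI impI)
    show "1 \<le> t0" by (simp add: t0_def)
    fix t and \<phi> :: "real ^ 'd \<Rightarrow> complex"
    assume t: "t0 \<le> t" and \<phi>: "\<phi> \<in> weighted_L_two chi \<rho> (sqrt 2 * \<mu>) (- t)" "distributional_solution V (\<kappa>\<^sup>2) \<phi>"
    have pos: "0 < cmod k * (1 - \<rho>)" using k0 assms(3) by simp
    have ge: "(Q + 1) / (cmod k * (1 - \<rho>)) \<le> t - \<rho> / (1 - \<rho>)" using t by (simp add: t0_def)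
    have "0 < (Q + 1) / (cmod k * (1 - \<rho>))" using pos Q by simp
    then have s: "0 < t - \<rho> / (1 - \<rho>)" using ge by simp
    have "Q + 1 \<le> (t - \<rho> / (1 - \<rho>)) * (cmod k * (1 - \<rho>))" using ge unfolding pos_divide_le_eq[OF pos] .
    then have big: "Q + 1 \<le> cmod k * ((t - \<rho> / (1 - \<rho>)) * (1 - \<rho>))" by (simp only: mult_ac)
    show "\<phi> \<in> weighted_L_two chi \<rho> (- (sqrt 2 * \<mu>)) t"
      using weighted_solution_decays[OF assms(1-3) Q V k m s big] \<phi> by (simp only: Im_k)
  qed
qed

end
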